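(* Let $\kappa\in\{+1,-1\}$ and let $\phi(t,x)\in L^\infty_{t\in[0,\infty)}C^\infty(\mathbb{R})$, with $\|\phi(t,\cdot)\|_{L^2(\mathbb{R})}=1$, be a solution to the cubic nonlinear Schrödinger equation $i\phi_t+\partial_{xx}\phi=2\kappa|\phi|^2\phi$ on $\mathbb{R}$. Suppose that $$\Bigl\{\prod_{\ell=1}^{n}\phi(t,x_\ell)\overline{\phi}(t,x_\ell')\Bigr\}_{n=1}^\infty$$ is a sequence of factorized solutions to the cubic Gross-Pitaevskii hierarchy on $\mathbb{R}$ in $L^\infty_{t\in[0,\infty)}\mathfrak{H}^\infty$. Then for each $n\in\mathbb{N}$ the quantity $\mathrm{Tr}\,\mathbf{W}_n^1\bigl(\prod_{\ell=1}^n\phi(t,x_\ell)\overline{\phi}(t,x_\ell')\bigr)$ is conserved in time, that is, for any $t\ge0$, $$\mathrm{Tr}\,\mathbf{W}_n^1\Bigl(\prod_{\ell=1}^n\phi(t,x_\ell)\overline{\phi}(t,x_\ell')\Bigr)=\mathrm{Tr}\,\mathbf{W}_n^1\Bigl(\prod_{\ell=1}^n\phi(0,x_\ell)\overline{\phi}(0,x_\ell')\Bigr).$$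
   Context: Notation. $\mathbb{N}=\{1,2,\dots\}$, $\underline{x}_k=(x_1,\dots,x_k)$, $\underline{x}_k'=(x_1',\dots,x_k')$. Operators on $L^2(\mathbb{R}^k)$ are identified with their kernels; $\mathrm{Tr}$ is the full trace and $\mathrm{Tr}_i$ the partial trace in the $i$-th variable pair (set $x_i'=x_i$ and integrate in $x_i$). GP hierarchy. The cubic GP hierarchy on $\mathbb{R}$ is $$i\partial_t\gamma^{(k)}=-\sum_{j=1}^k(\Delta_{x_j}-\Delta_{x_j'})\gamma^{(k)}+2\kappa B_{k+1}\gamma^{(k+1)},\quad k\in\mathbb{N},$$ where $B_{k+1}\gamma^{(k+1)}=\sum_{j=1}^k(B^+_{j;k+1}-B^-_{j;k+1})\gamma^{(k+1)}$, $(B^+_{j;k+1}\gamma^{(k+1)})(\underline{x}_k;\underline{x}_k')=\gamma^{(k+1)}(\underline{x}_k,x_j;\underline{x}_k',x_j)$ and $(B^-_{j;k+1}\gamma^{(k+1)})(\underline{x}_k;\underline{x}_k')=\gamma^{(k+1)}(\underline{x}_k,x_j';\underline{x}_k',x_j')$. Spaces. $\|\gamma^{(k)}\|_{\mathfrak{h}^\alpha_k}=\mathrm{Tr}(|S^{(k,\alpha)}\gamma^{(k)}|)$ with $S^{(k,\alpha)}=\prod_{j=1}^k(1-\Delta_{x_j})^{\alpha/2}(1-\Delta_{x_j'})^{\alpha/2}$. $\mathfrak{H}^\alpha$ is the set of sequences $(\gamma^{(k)})_k$ for which there is $R<\infty$ with $\|\gamma^{(k)}\|_{\mathfrak{h}^\alpha_k}<R^{2k}$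 for all $k$, and $\mathfrak{H}^\infty=\bigcap_{\alpha\ge0}\mathfrak{H}^\alpha$. Membership in $L^\infty_{t\in[0,\infty)}\mathfrak{H}^\infty$ means that for each $\alpha$ there is $R<\infty$ (independent of $k$) with $\sup_{t\ge0}\|\gamma^{(k)}(t)\|_{\mathfrak{h}^\alpha_k}<R^{2k}$ for all $k$. The operators $\mathbf{W}_n^j$. For $i\ne l$, let $B_{i,l}$ be the operator that sets $x_l=x_l'=x_i$ in a kernel (removing the $l$-th variable pair). For $n,j\ge1$, $\mathbf{W}_n^j$ acts on kernels in the variable pairs labelled $j,\dots,j+n-1$ and produces a kernel in $(x_j;x_j')$. It is defined on factorized density matrices $\prod_{\ell=j}^{j+n-1}\phi(x_\ell)\overline{\phi}(x_\ell')$, $\|\phi\|_{L^2}=1$, recursively by $\mathbf{W}_1^j=\mathrm{Id}$ and, for $n\ge1$, $$\mathbf{W}_{n+1}^j=-i\partial_{x_j}\mathbf{W}_n^j\,\mathrm{Tr}_{j+n}+\kappa\sum_{k=1}^{n-1}B_{j,j+k}\,\bigl(\mathbf{W}_k^j\otimes\mathbf{W}_{n-k}^{j+k}\bigr)\,\mathrm{Tr}_{j+n},$$ where $\mathbf{W}_k^j$ acts on the pairs $j,\dots,j+k-1$ and $\mathbf{W}_{n-k}^{j+k}$ on the pairs $j+k,\dots,j+n-1$ (the sum is empty for $n=1$). *)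

theory Defs
  imports "HOL-Analysis.Analysis"
begin

section \<open>Kernels in labelled variable pairs\<close>

text \<open>
  A kernel is a function of two families of real variables \<open>x\<close>, \<open>x'\<close> indexed by labels in
  \<^typ>\<open>nat\<close>; a kernel in the variable pairs labelled by \<open>I\<close> is one that reads only the
  coordinates in \<open>I\<close>. In this way operators on kernels act on the pairs they name, with all other
  pairs as parameters.
\<close>

type_synonym kernel = "(nat \<Rightarrow> real) \<Rightarrow> (nat \<Rightarrow> real) \<Rightarrow> complex"

definition xderiv :: "(real \<Rightarrow> complex) \<Rightarrow> real \<Rightarrow> complex" where
  "xderiv f = (\<lambda>x. vector_derivative f (at x))"

definition smooth :: "(real \<Rightarrow> complex) \<Rightarrow> bool" where
  "smooth f \<longleftrightarrow> (\<forall>m x. (xderiv ^^ m) f differentiable (at x))"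

definition pderiv_x :: "nat \<Rightarrow> kernel \<Rightarrow> kernel" where
  "pderiv_x j \<gamma> = (\<lambda>x x'. xderiv (\<lambda>s. \<gamma> (x(j := s)) x') (x j))"

definition pderiv_x' :: "nat \<Rightarrow> kernel \<Rightarrow> kernel" where
  "pderiv_x' j \<gamma> = (\<lambda>x x'. xderiv (\<lambda>s. \<gamma> x (x'(j := s))) (x' j))"

definition differentiable_x :: "nat \<Rightarrow> kernel \<Rightarrow> bool" where
  "differentiable_x j \<gamma> \<longleftrightarrow> (\<forall>x x'. (\<lambda>s. \<gamma> (x(j := s)) x') differentiable (at (x j)))"

definition differentiable_x' :: "nat \<Rightarrow> kernel \<Rightarrow> bool" where
  "differentiable_x' j \<gamma> \<longleftrightarrow> (\<forall>x x'. (\<lambda>s. \<gamma> x (x'(j := s))) differentiable (at (x' j)))"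

definition partial_trace :: "nat \<Rightarrow> kernel \<Rightarrow> kernel" where
  "partial_trace l \<gamma> = (\<lambda>x x'. LINT y|lborel. \<gamma> (x(l := y)) (x'(l := y)))"

definition full_trace :: "nat set \<Rightarrow> kernel \<Rightarrow> complex" where
  "full_trace I \<gamma> = (LINT x|PiM I (\<lambda>_. lborel). \<gamma> x x)"

definition contract :: "nat \<Rightarrow> nat \<Rightarrow> kernel \<Rightarrow> kernel" where
  "contract i l \<gamma> = (\<lambda>x x'. \<gamma> (x(l := x i)) (x'(l := x i)))"

definition contract' :: "nat \<Rightarrow> nat \<Rightarrow> kernel \<Rightarrow> kernel" where
  "contract' i l \<gamma> = (\<lambda>x x'. \<gamma> (x(l := x' i)) (x'(l := x' i)))"

definition factorized :: "(real \<Rightarrow> complex) \<Rightarrow> nat \<Rightarrow> kernel" where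
  "factorized f n = (\<lambda>x x'. \<Prod>l=1..n. f (x l) * cnj (f (x' l)))"


section \<open>The operators \<open>W\<close>\<close>

text \<open>
  \<open>W \<kappa> n j\<close> is \<open>\<^bold>W\<^sub>n\<^sup>j\<close> for \<open>n \<ge> 1\<close>; the value at \<open>n = 0\<close> is a dummy. In the second summand, the
  total number of pairs left after the partial trace is \<open>Suc m\<close>. The tensor product of two
  operators acting on disjoint sets of labels is their composition, as each of them leaves the
  labels of the other untouched.
\<close>

fun W :: "real \<Rightarrow> nat \<Rightarrow> nat \<Rightarrow> kernel \<Rightarrow> kernel" where
  "W \<kappa> 0 j = id"
| "W \<kappa> (Suc 0) j = id"
| "W \<kappa> (Suc (Suc m)) j = (\<lambda>\<gamma> x x'.
     - \<i> * pderiv_x j (W \<kappa> (Suc m) j (partial_trace (j + Suc m) \<gamma>)) x x'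
     + complex_of_real \<kappa> * (\<Sum>k=1..m. contract j (j + k)
         ((W \<kappa> k j \<circ> W \<kappa> (Suc m - k) (j + k)) (partial_trace (j + Suc m) \<gamma>)) x x'))"


section \<open>The nonlinear Schroedinger equation and the Gross-Pitaevskii hierarchy\<close>

definition nls_solution :: "real \<Rightarrow> (real \<Rightarrow> real \<Rightarrow> complex) \<Rightarrow> bool" where
  "nls_solution \<kappa> \<phi> \<longleftrightarrow> (\<forall>t\<ge>0. \<forall>x. \<exists>D.
     ((\<lambda>s. \<phi> s x) has_vector_derivative D) (at t within {0..}) \<and>
     \<i> * D + (xderiv ^^ 2) (\<phi> t) x
       = complex_of_real (2 * \<kappa> * (cmod (\<phi> t x))\<^sup>2) * \<phi> t x)"

text \<open>
  \<open>C\<^sup>\<infinity>(\<real>)\<close> carries its usual Frechet topology, given by the suprema of the derivatives over compact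
  intervals; membership in \<open>L\<^sup>\<infinity>\<close> in time means that each of these seminorms is bounded in time.
\<close>

definition Linfty_smooth :: "(real \<Rightarrow> real \<Rightarrow> complex) \<Rightarrow> bool" where
  "Linfty_smooth \<phi> \<longleftrightarrow> (\<forall>t\<ge>0. smooth (\<phi> t)) \<and>
     (\<forall>m a b. \<exists>C. \<forall>t\<ge>0. \<forall>x\<in>{a..b}. cmod ((xderiv ^^ m) (\<phi> t) x) \<le> C)"

text \<open>
  Classical solutions: \<open>\<Gamma> t k\<close> is \<open>\<gamma>\<^sup>(\<^sup>k\<^sup>)(t)\<close>, a kernel in the pairs \<open>1, \<dots>, k\<close>.
\<close>

definition gp_solution :: "real \<Rightarrow> (real \<Rightarrow> nat \<Rightarrow> kernel) \<Rightarrow> bool" where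
  "gp_solution \<kappa> \<Gamma> \<longleftrightarrow> (\<forall>k\<ge>1. \<forall>t\<ge>0.
     (\<forall>j\<in>{1..k}. differentiable_x j (\<Gamma> t k) \<and> differentiable_x j (pderiv_x j (\<Gamma> t k)) \<and>
        differentiable_x' j (\<Gamma> t k) \<and> differentiable_x' j (pderiv_x' j (\<Gamma> t k))) \<and>
     (\<forall>x x'. \<exists>D. ((\<lambda>s. \<Gamma> s k x x') has_vector_derivative D) (at t within {0..}) \<and>
        \<i> * D = - (\<Sum>j=1..k. pderiv_x j (pderiv_x j (\<Gamma> t k)) x x'
                           - pderiv_x' j (pderiv_x' j (\<Gamma> t k)) x x')
          + complex_of_real (2 * \<kappa>) *
            (\<Sum>j=1..k. contract j (Suc k) (\<Gamma> t (Suc k)) x x'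
                    - contract' j (Suc k) (\<Gamma> t (Suc k)) x x')))"


section \<open>Operators on \<open>L\<^sup>2(\<real>\<^sup>k)\<close> and the trace norm\<close>

definition lebk :: "nat \<Rightarrow> (nat \<Rightarrow> real) measure" where
  "lebk k = PiM {1..k} (\<lambda>_. lborel)"

definition sq_norm :: "'a measure \<Rightarrow> ('a \<Rightarrow> complex) \<Rightarrow> ennreal" where
  "sq_norm M f = (\<integral>\<^sup>+x. ennreal ((cmod (f x))\<^sup>2) \<partial>M)"

definition L2 :: "'a measure \<Rightarrow> ('a \<Rightarrow> complex) set" where
  "L2 M = {f \<in> borel_measurable M. sq_norm M f < \<infinity>}"

definition L2_inner :: "'a measure \<Rightarrow> ('a \<Rightarrow> complex) \<Rightarrow> ('a \<Rightarrow> complex) \<Rightarrow> complex" where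
  "L2_inner M f g = (LINT x|M. cnj (f x) * g x)"

definition hilbert_basis :: "'a measure \<Rightarrow> (nat \<Rightarrow> 'a \<Rightarrow> complex) \<Rightarrow> bool" where
  "hilbert_basis M e \<longleftrightarrow> (\<forall>n. e n \<in> L2 M) \<and>
     (\<forall>m n. L2_inner M (e m) (e n) = (if m = n then 1 else 0)) \<and>
     (\<forall>f\<in>L2 M. (\<lambda>N. sq_norm M (\<lambda>x. f x - (\<Sum>n<N. L2_inner M (e n) f * e n x))) \<longlonglongrightarrow> 0)"

text \<open>
  Operators of trace class, and their absolute values, are Hilbert-Schmidt, so that they are given
  by square integrable kernels.
\<close>

definition L2_kernel :: "nat \<Rightarrow> kernel \<Rightarrow> bool" where
  "L2_kernel k \<gamma> \<longleftrightarrow> (\<lambda>(x, x'). \<gamma> x x') \<in> L2 (lebk k \<Otimes>\<^sub>M lebk k)"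

definition kernel_op :: "nat \<Rightarrow> kernel \<Rightarrow> ((nat \<Rightarrow> real) \<Rightarrow> complex) \<Rightarrow> (nat \<Rightarrow> real) \<Rightarrow> complex" where
  "kernel_op k \<gamma> f = (\<lambda>x. LINT y|lebk k. \<gamma> x y * f y)"

definition adjoint_kernel :: "kernel \<Rightarrow> kernel" where
  "adjoint_kernel \<gamma> = (\<lambda>x x'. cnj (\<gamma> x' x))"

text \<open>
  \<open>P\<close> is (the kernel of) \<open>\<bar>A\<bar>\<close>, the positive square root of \<open>A\<^sup>* A\<close>.
\<close>

definition is_abs :: "nat \<Rightarrow> kernel \<Rightarrow> kernel \<Rightarrow> bool" where
  "is_abs k A P \<longleftrightarrow> L2_kernel k P \<and>
     (\<forall>f\<in>L2 (lebk k). L2_inner (lebk k) f (kernel_op k P f) \<in> \<real>\<^sub>\<ge>\<^sub>0) \<and>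
     (\<forall>f\<in>L2 (lebk k). AE x in lebk k.
        kernel_op k P (kernel_op k P f) x
          = kernel_op k (adjoint_kernel A) (kernel_op k A f) x)"

text \<open>
  The trace of the positive operator \<open>\<bar>A\<bar>\<close>, in \<open>[0, \<infinity>]\<close>, is the sum of its diagonal matrix
  elements in a Hilbert basis. Up to null sets there is exactly one \<open>P\<close> in the definition below, and
  the sum does not depend on the choice of \<open>e\<close>; the infimum merely makes this choice.
\<close>

definition trace_norm :: "nat \<Rightarrow> kernel \<Rightarrow> ennreal" where
  "trace_norm k A = (INF P\<in>{P. is_abs k A P}. INF e\<in>{e. hilbert_basis (lebk k) e}.
     \<Sum>n. ennreal (Re (L2_inner (lebk k) (e n) (kernel_op k P (e n)))))"


section \<open>The spaces of density matrices\<close>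

text \<open>
  The Fourier transform on \<open>L\<^sup>2(\<real>\<^sup>k \<times> \<real>\<^sup>k)\<close> is the \<open>L\<^sup>2\<close>-limit of the Fourier integrals of the
  truncations to cubes.
\<close>

definition fourier_trunc :: "nat \<Rightarrow> real \<Rightarrow> kernel \<Rightarrow> kernel" where
  "fourier_trunc k R \<gamma> = (\<lambda>\<xi> \<xi>'. complex_of_real ((1 / (2 * pi)) ^ k) *
     integral\<^sup>L (lebk k \<Otimes>\<^sub>M lebk k) (\<lambda>(x, x').
        of_bool (\<forall>j\<in>{1..k}. \<bar>x j\<bar> \<le> R \<and> \<bar>x' j\<bar> \<le> R) *
        exp (- \<i> * complex_of_real (\<Sum>j=1..k. \<xi> j * x j + \<xi>' j * x' j)) * \<gamma> x x'))"

definition is_fourier :: "nat \<Rightarrow> kernel \<Rightarrow> kernel \<Rightarrow> bool" where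
  "is_fourier k \<gamma> g \<longleftrightarrow> L2_kernel k \<gamma> \<and> L2_kernel k g \<and>
     ((\<lambda>R. sq_norm (lebk k \<Otimes>\<^sub>M lebk k) (\<lambda>(\<xi>, \<xi>'). g \<xi> \<xi>' - fourier_trunc k R \<gamma> \<xi> \<xi>'))
        \<longlongrightarrow> 0) at_top"

text \<open>
  \<open>\<sigma> = S\<^sup>(\<^sup>k\<^sup>,\<^sup>\<alpha>\<^sup>) \<gamma>\<close>, where \<open>(1 - \<Delta>)\<^sup>\<alpha>\<^sup>/\<^sup>2\<close> is the Fourier multiplier \<open>(1 + \<xi>\<^sup>2)\<^sup>\<alpha>\<^sup>/\<^sup>2\<close>.
\<close>

definition is_S :: "nat \<Rightarrow> real \<Rightarrow> kernel \<Rightarrow> kernel \<Rightarrow> bool" where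
  "is_S k \<alpha> \<gamma> \<sigma> \<longleftrightarrow> (\<exists>g. is_fourier k \<gamma> g \<and>
     is_fourier k \<sigma> (\<lambda>\<xi> \<xi>'. complex_of_real (\<Prod>j=1..k.
        (1 + (\<xi> j)\<^sup>2) powr (\<alpha> / 2) * (1 + (\<xi>' j)\<^sup>2) powr (\<alpha> / 2)) * g \<xi> \<xi>'))"

text \<open>
  The norm of \<open>\<hh>\<^sup>\<alpha>\<^sub>k\<close>. There is at most one \<open>S\<^sup>(\<^sup>k\<^sup>,\<^sup>\<alpha>\<^sup>) \<gamma>\<close> up to null sets; if there is none, the
  norm is \<open>\<infinity>\<close>.
\<close>

definition h_norm :: "nat \<Rightarrow> real \<Rightarrow> kernel \<Rightarrow> ennreal" where
  "h_norm k \<alpha> \<gamma> = (INF \<sigma>\<in>{\<sigma>. is_S k \<alpha> \<gamma> \<sigma>}. trace_norm k \<sigma>)"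

text \<open>
  Membership in \<open>L\<^sup>\<infinity>\<close> on \<open>[0, \<infinity>)\<close> with values in the intersection of the spaces \<open>\<HH>\<^sup>\<alpha>\<close>,
  \<open>\<alpha> \<ge> 0\<close>.
\<close>

definition Linfty_H_infty :: "(real \<Rightarrow> nat \<Rightarrow> kernel) \<Rightarrow> bool" where
  "Linfty_H_infty \<Gamma> \<longleftrightarrow> (\<forall>\<alpha>\<ge>0. \<exists>R::real. \<forall>k\<ge>1.
     (SUP t\<in>{0..}. h_norm k \<alpha> (\<Gamma> t k)) < ennreal (R ^ (2 * k)))"

end

theory Submission
  imports Defs "HOL-Probability.Characteristic_Functions" "HOL-Probability.Sinc_Integral"
begin

text \<open>
  On factorized states \<open>W \<kappa> n 1\<close> produces the kernel \<open>w\<^sub>n(x) cnj (\<phi>(x'))\<close>, where \<open>w\<^sub>1 = \<phi>\<close> and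
  \<open>w\<^sub>n\<^sub>+\<^sub>1 = - \<i> w\<^sub>n' + \<kappa> cnj \<phi> S\<^sub>n\<close> with \<open>S\<^sub>n = \<Sum> w\<^sub>k w\<^sub>n\<^sub>-\<^sub>k\<close>: the Zakharov-Shabat densities. Under
  the NLS flow \<open>\<partial>\<^sub>t w\<^sub>n = - w\<^sub>n\<^sub>+\<^sub>1' - 2 \<i> \<kappa> |\<phi>|\<^sup>2 w\<^sub>n - \<kappa> cnj \<phi>' S\<^sub>n\<close>, by induction on \<open>n\<close>, and this
  turns into the local conservation law
  \<open>\<partial>\<^sub>t (cnj \<phi> w\<^sub>n) = - \<partial>\<^sub>x (cnj \<phi> w\<^sub>n\<^sub>+\<^sub>1 + \<i> cnj \<phi>' w\<^sub>n)\<close>.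

  It can be integrated over the line because the flux is bounded in \<open>L\<^sup>1\<close> uniformly in time: all
  derivatives of \<open>\<phi>\<close> are bounded in \<open>L\<^sup>2\<close>. Indeed, for one pair and \<open>\<alpha> = 2 p\<close>, the operator
  \<open>S \<gamma>\<close> is the rank one operator of \<open>u = (1 - \<Delta>)\<^sup>p \<phi>\<close>. Its trace norm dominates its operator norm, and
  pairing it with cut-offs of \<open>u\<close> itself shows that the trace norm bounds the squared \<open>L\<^sup>2\<close> norm of \<open>u\<close>.
\<close>

subsection \<open>Smooth functions\<close>

text \<open>Two obstacles shape the proof. The equation provides a time derivative separately at
  each point x, while the recursion for \<open>w\<close> contains space derivatives, so the two
  derivatives have to be interchanged. This is done with difference quotients in x whose error is of
  order h uniformly in time; hence all families carry bounds on compact intervals, uniform in time,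
  for every space derivative. Decay of \<phi> is known only through \<open>h_norm\<close>, where
  S\<gamma> is given by L2 limits of Fourier integrals. It is reached by duality: for \<alpha> = 2p
  the multiplier is the polynomial (1 + \<xi>^2)^p, so S passes to compactly supported test
  functions as a differential operator. Fourier inversion is applied to these test functions alone.
  Their order 3 + 2p pays for 2p derivatives and for two more that make the transform integrable.
  Finally, the nonlinear terms of \<open>w\<close> are products; uniform sup bounds, from the
  one-dimensional Sobolev inequality, keep them in L2.\<close>

lemma xderiv_eqI: "(\<And>x. (f has_vector_derivative g x) (at x)) \<Longrightarrow> xderiv f = g"
  by (auto simp: xderiv_def fun_eq_iff intro!: vector_derivative_at)

lemma xderiv_works:
  "f differentiable (at x) \<Longrightarrow> (f has_vector_derivative xderiv f x) (at x)"
  by (simp add: xderiv_def vector_derivative_works)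

text \<open>The mean value inequality. It serves in both variables: in x for difference quotients
  and Lipschitz bounds, in t for the drift of weighted integrals.\<close>

lemma vector_derivative_bound:
  fixes f :: "real \<Rightarrow> 'a :: real_normed_vector"
  assumes "convex S" "\<And>s. s \<in> S \<Longrightarrow> (f has_vector_derivative f' s) (at s within S)"
    and "\<And>s. s \<in> S \<Longrightarrow> norm (f' s) \<le> B" and "x \<in> S" "y \<in> S"
  shows "norm (f x - f y) \<le> B * \<bar>x - y\<bar>"
proof -
  have "norm (f x - f y) \<le> B * norm (x - y)"
  proof (rule differentiable_bound[OF assms(1)])
    show "(f has_derivative (\<lambda>h. h *\<^sub>R f' s)) (at s within S)" if "s \<in> S" for s
      using assms(2)[OF that] by (simp add: has_vector_derivative_def)
    show "onorm (\<lambda>h. h *\<^sub>R f' s) \<le> B" if "s \<in> S" for s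
    proof (rule onorm_le)
      fix h :: real
      show "norm (h *\<^sub>R f' s) \<le> B * norm h"
        using mult_left_mono[OF assms(3)[OF that] norm_ge_zero[of h]] by (simp add: mult.commute)
    qed
  qed (use assms in auto)
  then show ?thesis by simp
qed

text \<open>Finite orders of smoothness, with the derivative peeled off from the inside. In contrast
  to \<open>smooth\<close>, this form supports an induction on the order with the functions
  generalized, as closure under products requires: the derivative of a product is a sum of products
  of other functions.\<close>

fun times_differentiable :: "nat \<Rightarrow> (real \<Rightarrow> complex) \<Rightarrow> bool" where
  "times_differentiable 0 f \<longleftrightarrow> True"
| "times_differentiable (Suc n) f \<longleftrightarrow>
     (\<forall>x. f differentiable (at x)) \<and> times_differentiable n (xderiv f)"

lemma times_differentiable_iff:
  "times_differentiable n f \<longleftrightarrow> (\<forall>m<n. \<forall>x. (xderiv ^^ m) f differentiable (at x))"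
proof (induction n arbitrary: f)
  case (Suc n)
  have "(\<forall>m<Suc n. \<forall>x. (xderiv ^^ m) f differentiable (at x)) \<longleftrightarrow>
     (\<forall>x. f differentiable (at x)) \<and> (\<forall>m<n. \<forall>x. (xderiv ^^ m) (xderiv f) differentiable (at x))"
    by (simp add: All_less_Suc2 funpow_swap1)
  then show ?case by (simp add: Suc.IH)
qed simp

lemma smooth_iff: "smooth f \<longleftrightarrow> (\<forall>n. times_differentiable n f)"
  by (auto simp: smooth_def times_differentiable_iff)

lemma smooth_differentiable: "smooth f \<Longrightarrow> f differentiable (at x)"
  unfolding smooth_def by (drule spec[of _ 0]) simp

lemma smooth_xderiv: "smooth f \<Longrightarrow> smooth (xderiv f)"
  unfolding smooth_iff by (metis times_differentiable.simps(2))

lemma smooth_has_xderiv: "smooth f \<Longrightarrow> (f has_vector_derivative xderiv f x) (at x)"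
  by (simp add: smooth_differentiable xderiv_works)

lemma smooth_continuous: "smooth f \<Longrightarrow> continuous_on A f"
  by (meson continuous_on_vector_derivative has_vector_derivative_at_within smooth_has_xderiv)

lemma smooth_borel: "smooth f \<Longrightarrow> f \<in> borel_measurable borel"
  by (intro borel_measurable_continuous_onI smooth_continuous)

lemma times_differentiable_SucD: "times_differentiable (Suc n) f \<Longrightarrow> times_differentiable n f"
  by (auto simp: times_differentiable_iff)

lemma xderiv_add_at:
  "\<lbrakk>f differentiable (at x); g differentiable (at x)\<rbrakk> \<Longrightarrow>
    ((\<lambda>x. f x + g x) has_vector_derivative xderiv f x + xderiv g x) (at x)"
  by (auto intro!: derivative_eq_intros xderiv_works)

lemma xderiv_mult_at:
  fixes f g :: "real \<Rightarrow> complex"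
  shows "\<lbrakk>f differentiable (at x); g differentiable (at x)\<rbrakk> \<Longrightarrow>
    ((\<lambda>x. f x * g x) has_vector_derivative xderiv f x * g x + f x * xderiv g x) (at x)"
  by (auto intro!: derivative_eq_intros xderiv_works simp: add.commute)

lemma xderiv_cnj_at:
  "f differentiable (at x) \<Longrightarrow>
    ((\<lambda>x. cnj (f x)) has_vector_derivative cnj (xderiv f x)) (at x)"
  by (auto intro!: derivative_eq_intros xderiv_works)

lemma has_vector_derivative_differentiable:
  "(f has_vector_derivative d) (at x) \<Longrightarrow> f differentiable (at x)"
  by (rule differentiableI_vector)

lemma times_differentiable_add:
  "\<lbrakk>times_differentiable n f; times_differentiable n g\<rbrakk> \<Longrightarrow>
    times_differentiable n (\<lambda>x. f x + g x)"
proof (induction n arbitrary: f g)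
  case (Suc n)
  then have d: "((\<lambda>x. f x + g x) has_vector_derivative xderiv f x + xderiv g x) (at x)" for x
    by (intro xderiv_add_at) auto
  show ?case
    using Suc by (auto simp: xderiv_eqI[OF d] intro: has_vector_derivative_differentiable[OF d])
qed simp

lemma times_differentiable_mult:
  "\<lbrakk>times_differentiable n f; times_differentiable n g\<rbrakk> \<Longrightarrow>
    times_differentiable n (\<lambda>x. f x * g x)"
proof (induction n arbitrary: f g)
  case (Suc n)
  then have d: "((\<lambda>x. f x * g x) has_vector_derivative xderiv f x * g x + f x * xderiv g x) (at x)" for x
    by (intro xderiv_mult_at) auto
  have "times_differentiable n (\<lambda>x. xderiv f x * g x + f x * xderiv g x)"
    using Suc.prems Suc.prems[THEN times_differentiable_SucD]
    by (intro times_differentiable_add Suc.IH) auto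
  then show ?case
    by (auto simp: xderiv_eqI[OF d] intro: has_vector_derivative_differentiable[OF d])
qed simp

lemma times_differentiable_cnj:
  "times_differentiable n f \<Longrightarrow> times_differentiable n (\<lambda>x. cnj (f x))"
proof (induction n arbitrary: f)
  case (Suc n)
  then have d: "((\<lambda>x. cnj (f x)) has_vector_derivative cnj (xderiv f x)) (at x)" for x
    by (intro xderiv_cnj_at) auto
  show ?case
    using Suc by (auto simp: xderiv_eqI[OF d] intro: has_vector_derivative_differentiable[OF d])
qed simp

lemma times_differentiable_const: "times_differentiable n (\<lambda>x. c)"
proof (induction n arbitrary: c)
  case (Suc n)
  have "xderiv (\<lambda>x. c) = (\<lambda>x. 0)" by (rule xderiv_eqI) (rule has_vector_derivative_const)
  with Suc show ?case by simp
qed simp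

lemma smooth_add: "smooth f \<Longrightarrow> smooth g \<Longrightarrow> smooth (\<lambda>x. f x + g x)"
  by (simp add: smooth_iff times_differentiable_add)

lemma smooth_mult: "smooth f \<Longrightarrow> smooth g \<Longrightarrow> smooth (\<lambda>x. f x * g x)"
  by (simp add: smooth_iff times_differentiable_mult)

lemma smooth_cnj: "smooth f \<Longrightarrow> smooth (\<lambda>x. cnj (f x))"
  by (simp add: smooth_iff times_differentiable_cnj)

lemma smooth_const: "smooth (\<lambda>x. c)"
  by (simp add: smooth_iff times_differentiable_const)

lemma smooth_sum: "(\<And>i. i \<in> I \<Longrightarrow> smooth (f i)) \<Longrightarrow> smooth (\<lambda>x. \<Sum>i\<in>I. f i x)"
  by (induction I rule: infinite_finite_induct) (auto intro: smooth_const smooth_add)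

lemma smooth_uminus: "smooth f \<Longrightarrow> smooth (\<lambda>x. - f x)"
  using smooth_mult[OF smooth_const[of "-1"], of f] by simp

lemma smooth_diff: "smooth f \<Longrightarrow> smooth g \<Longrightarrow> smooth (\<lambda>x. f x - g x)"
  using smooth_add[OF _ smooth_uminus, of f g] by simp

lemma smooth_power: "smooth f \<Longrightarrow> smooth (\<lambda>x. f x ^ n)"
  by (induction n) (auto intro: smooth_const smooth_mult)

lemma smooth_of_real: "smooth complex_of_real"
proof -
  have x: "xderiv complex_of_real = (\<lambda>x. 1)"
    by (rule xderiv_eqI) (use has_vector_derivative_of_real[OF DERIV_ident] in simp)
  have d: "complex_of_real differentiable (at x)" for x
    by (rule differentiableI_vector) (use has_vector_derivative_of_real[OF DERIV_ident] in simp)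
  have "times_differentiable n complex_of_real" for n
    by (cases n) (auto simp: x d times_differentiable_const)
  then show ?thesis by (simp add: smooth_iff)
qed

lemmas smooth_intros = smooth_add smooth_mult smooth_cnj smooth_const smooth_sum smooth_uminus
  smooth_diff smooth_power smooth_of_real smooth_xderiv

lemma xderiv_exp:
  "xderiv (\<lambda>x. c * exp (\<i> * of_real (a * x))) = (\<lambda>x. (\<i> * a * c) * exp (\<i> * of_real (a * x)))"
proof (rule xderiv_eqI)
  fix x
  have "((\<lambda>z. c * exp (\<i> * (of_real a * z))) has_field_derivative
      (\<i> * a * c) * exp (\<i> * (of_real a * of_real x))) (at (of_real x))"
    by (auto intro!: derivative_eq_intros)
  from has_vector_derivative_real_field[OF this]
  show "((\<lambda>x. c * exp (\<i> * of_real (a * x))) has_vector_derivative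
      (\<i> * a * c) * exp (\<i> * of_real (a * x))) (at x)"
    by simp
qed

text \<open>The coefficient c is carried along because differentiation multiplies it by \<i> a; the
  functions of this form are thus closed under \<open>xderiv\<close>.\<close>

lemma smooth_exp: "smooth (\<lambda>x. c * exp (\<i> * of_real (a * x)))"
proof -
  have d: "(\<lambda>x. c * exp (\<i> * of_real (a * x))) differentiable (at x)" for x c
  proof -
    have "((\<lambda>z. c * exp (\<i> * (of_real a * z))) has_field_derivative
        (\<i> * a * c) * exp (\<i> * (of_real a * of_real x))) (at (of_real x))"
      by (auto intro!: derivative_eq_intros)
    from has_vector_derivative_real_field[OF this] show ?thesis
      by (intro differentiableI_vector) simp
  qed
  have "times_differentiable n (\<lambda>x. c * exp (\<i> * of_real (a * x)))" for n
  proof (induction n arbitrary: c)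
    case (Suc n)
    then show ?case unfolding times_differentiable.simps xderiv_exp using d by blast
  qed simp
  then show ?thesis by (simp add: smooth_iff)
qed

lemma xderiv_add: "smooth f \<Longrightarrow> smooth g \<Longrightarrow> xderiv (\<lambda>x. f x + g x) = (\<lambda>x. xderiv f x + xderiv g x)"
  by (rule xderiv_eqI) (simp add: xderiv_add_at smooth_differentiable)

lemma xderiv_mult: "smooth f \<Longrightarrow> smooth g \<Longrightarrow>
    xderiv (\<lambda>x. f x * g x) = (\<lambda>x. xderiv f x * g x + f x * xderiv g x)"
  by (rule xderiv_eqI) (simp add: xderiv_mult_at smooth_differentiable)

lemma xderiv_cnj: "smooth f \<Longrightarrow> xderiv (\<lambda>x. cnj (f x)) = (\<lambda>x. cnj (xderiv f x))"
  by (rule xderiv_eqI) (simp add: xderiv_cnj_at smooth_differentiable)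

lemma xderiv_const: "xderiv (\<lambda>x. c) = (\<lambda>x. 0)"
  by (rule xderiv_eqI) (rule has_vector_derivative_const)

lemma xderiv_cmult: "smooth f \<Longrightarrow> xderiv (\<lambda>x. c * f x) = (\<lambda>x. c * xderiv f x)"
  by (simp add: xderiv_mult[OF smooth_const] xderiv_const)

lemma xderiv_uminus: "smooth f \<Longrightarrow> xderiv (\<lambda>x. - f x) = (\<lambda>x. - xderiv f x)"
  using xderiv_cmult[of f "-1"] by simp

lemma xderiv_diff: "smooth f \<Longrightarrow> smooth g \<Longrightarrow> xderiv (\<lambda>x. f x - g x) = (\<lambda>x. xderiv f x - xderiv g x)"
  using xderiv_add[OF _ smooth_uminus, of f g] by (simp add: xderiv_uminus)

lemma xderiv_sum: "(\<And>i. i \<in> I \<Longrightarrow> smooth (f i)) \<Longrightarrow>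
    xderiv (\<lambda>x. \<Sum>i\<in>I. f i x) = (\<lambda>x. \<Sum>i\<in>I. xderiv (f i) x)"
  by (induction I rule: infinite_finite_induct) (auto simp: xderiv_const xderiv_add smooth_intros)

lemma smooth_xderiv_power: "smooth f \<Longrightarrow> smooth ((xderiv ^^ m) f)"
  by (induction m) (auto intro: smooth_xderiv)

lemma xderiv_power_add: "smooth f \<Longrightarrow> smooth g \<Longrightarrow>
    (xderiv ^^ m) (\<lambda>x. f x + g x) = (\<lambda>x. (xderiv ^^ m) f x + (xderiv ^^ m) g x)"
  by (induction m) (auto simp: xderiv_add smooth_xderiv_power)

lemma xderiv_power_cmult: "smooth f \<Longrightarrow> (xderiv ^^ m) (\<lambda>x. c * f x) = (\<lambda>x. c * (xderiv ^^ m) f x)"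
  by (induction m) (auto simp: xderiv_cmult smooth_xderiv_power)

lemma xderiv_power_cnj: "smooth f \<Longrightarrow> (xderiv ^^ m) (\<lambda>x. cnj (f x)) = (\<lambda>x. cnj ((xderiv ^^ m) f x))"
  by (induction m) (auto simp: xderiv_cnj smooth_xderiv_power)

subsection \<open>The operators \<open>W\<close> on factorized states\<close>

text \<open>The value 0 at index 0 matters: convolution sums over w may run over all k \<le> n, as
  their end terms vanish.\<close>

fun w :: "real \<Rightarrow> (real \<Rightarrow> complex) \<Rightarrow> nat \<Rightarrow> real \<Rightarrow> complex" where
  "w \<kappa> f 0 = (\<lambda>x. 0)"
| "w \<kappa> f (Suc 0) = f"
| "w \<kappa> f (Suc (Suc m)) = (\<lambda>x. - \<i> * xderiv (w \<kappa> f (Suc m)) x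
     + of_real \<kappa> * (cnj (f x) * (\<Sum>k=1..m. w \<kappa> f k x * w \<kappa> f (Suc m - k) x)))"

lemma smooth_w: "smooth f \<Longrightarrow> smooth (w \<kappa> f n)"
proof (induction n rule: less_induct)
  case (less n)
  consider "n = 0" | "n = Suc 0" | m where "n = Suc (Suc m)"
    by (metis not0_implies_Suc)
  then show ?case
  proof cases
    case 3
    with less show ?thesis by (auto intro!: smooth_intros)
  qed (use less in \<open>auto intro: smooth_const\<close>)
qed

definition ignores :: "nat set \<Rightarrow> kernel \<Rightarrow> bool" where
  "ignores I c \<longleftrightarrow> (\<forall>x x' y y'. (\<forall>l. l \<notin> I \<longrightarrow> x l = y l \<and> x' l = y' l) \<longrightarrow> c x x' = c y y')"

lemma ignoresD: "ignores I c \<Longrightarrow> (\<And>l. l \<notin> I \<Longrightarrow> x l = y l) \<Longrightarrow> (\<And>l. l \<notin> I \<Longrightarrow> x' l = y' l) \<Longrightarrow>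
    c x x' = c y y'"
  by (auto simp: ignores_def)

text \<open>The traced pair occurs in a single factor, which integrates to the squared norm of f,
  that is, to 1.\<close>

lemma partial_trace_product:
  assumes c: "ignores {j..<j + Suc n} c" and f: "(LINT y|lborel. f y * cnj (f y)) = 1"
  shows "partial_trace (j + n) (\<lambda>x x'. c x x' * (\<Prod>l=j..<j + Suc n. f (x l) * cnj (f (x' l))))
    = (\<lambda>x x'. c x x' * (\<Prod>l=j..<j + n. f (x l) * cnj (f (x' l))))"
proof (intro ext)
  fix x x' :: "nat \<Rightarrow> real"
  have 1: "c (x(j + n := y)) (x'(j + n := y)) = c x x'" for y
    by (rule ignoresD[OF c]) auto
  have 2: "(\<Prod>l=j..<j + n. f ((x(j + n := y)) l) * cnj (f ((x'(j + n := y)) l)))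
     = (\<Prod>l=j..<j + n. f (x l) * cnj (f (x' l)))" for y
    by (rule prod.cong) auto
  have "(\<lambda>y. c (x(j + n := y)) (x'(j + n := y)) *
       (\<Prod>l=j..<j + Suc n. f ((x(j + n := y)) l) * cnj (f ((x'(j + n := y)) l))))
    = (\<lambda>y. (c x x' * (\<Prod>l=j..<j + n. f (x l) * cnj (f (x' l)))) * (f y * cnj (f y)))"
    unfolding add_Suc_right prod.op_ivl_Suc 1 using 2 by (auto simp: mult_ac)
  then show "partial_trace (j + n) (\<lambda>x x'. c x x' * (\<Prod>l=j..<j + Suc n. f (x l) * cnj (f (x' l)))) x x'
    = c x x' * (\<Prod>l=j..<j + n. f (x l) * cnj (f (x' l)))"
    unfolding partial_trace_def by (simp add: f)
qed

text \<open>
  The factor \<open>c\<close> collects the pairs that \<open>W \<kappa> n j\<close> does not act on; it makes the induction go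
  through the nested operators in the nonlinear term.
\<close>

lemma W_product:
  assumes f: "smooth f" "(LINT y|lborel. f y * cnj (f y)) = 1"
  shows "ignores {j..<j + n} c \<Longrightarrow> 0 < n \<Longrightarrow>
    W \<kappa> n j (\<lambda>x x'. c x x' * (\<Prod>l=j..<j + n. f (x l) * cnj (f (x' l))))
      = (\<lambda>x x'. c x x' * (w \<kappa> f n (x j) * cnj (f (x' j))))"
proof (induction n arbitrary: j c rule: less_induct)
  case (less n)
  consider "n = Suc 0" | m where "n = Suc (Suc m)"
    using less.prems by (metis not0_implies_Suc not_less_zero)
  then show ?case
  proof cases
    case 1
    then show ?thesis by simp
  next
    case (2 m)
    let ?F = "\<lambda>I x x'. \<Prod>l\<in>I. f (x l) * cnj (f (x' l))"
    have c: "ignores {j..<j + Suc (Suc m)} c" using less.prems 2 by simp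
    have pt: "partial_trace (j + Suc m) (\<lambda>x x'. c x x' * ?F {j..<j + n} x x')
        = (\<lambda>x x'. c x x' * ?F {j..<j + Suc m} x x')"
      unfolding 2 by (rule partial_trace_product[OF c f(2)])
    have c1: "ignores {j..<j + Suc m} c"
      unfolding ignores_def
    proof (intro allI impI)
      fix x x' y y' :: "nat \<Rightarrow> real"
      assume "\<forall>l. l \<notin> {j..<j + Suc m} \<longrightarrow> x l = y l \<and> x' l = y' l"
      then show "c x x' = c y y'" by (intro ignoresD[OF c]) auto
    qed
    have W1: "W \<kappa> (Suc m) j (\<lambda>x x'. c x x' * ?F {j..<j + Suc m} x x')
        = (\<lambda>x x'. c x x' * (w \<kappa> f (Suc m) (x j) * cnj (f (x' j))))"
      using 2 c1 by (intro less.IH) auto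
    have d: "pderiv_x j (W \<kappa> (Suc m) j (\<lambda>x x'. c x x' * ?F {j..<j + Suc m} x x')) x x'
        = c x x' * (xderiv (w \<kappa> f (Suc m)) (x j) * cnj (f (x' j)))" for x x'
    proof -
      have "c (x(j := s)) x' = c x x'" for s by (rule ignoresD[OF c]) auto
      then have "(\<lambda>s. c (x(j := s)) x' * (w \<kappa> f (Suc m) s * cnj (f (x' j))))
          = (\<lambda>s. (c x x' * cnj (f (x' j))) * w \<kappa> f (Suc m) s)"
        by (auto simp: mult_ac)
      then show ?thesis
        unfolding W1 pderiv_x_def by (simp add: xderiv_cmult smooth_w f)
    qed
    \<comment> \<open>For the inner operator the pairs j, ..., j + k - 1 belong to the inert factor;
      for the outer one the output of the inner operator does. The contraction puts x and x' at
      label j + k equal to x j, so the leftover conjugate factor of the inner output becomes the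
      \<open>cnj (f (x j))\<close> of the recursion for \<open>w\<close>.\<close>
    have s: "contract j (j + k) ((W \<kappa> k j \<circ> W \<kappa> (Suc m - k) (j + k))
          (\<lambda>x x'. c x x' * ?F {j..<j + Suc m} x x')) x x'
        = c x x' * (w \<kappa> f k (x j) * w \<kappa> f (Suc m - k) (x j) * cnj (f (x j)) * cnj (f (x' j)))"
      if k: "k \<in> {1..m}" for k x x'
    proof -
      have "(\<lambda>x x'. c x x' * ?F {j..<j + Suc m} x x')
        = (\<lambda>x x'. (c x x' * ?F {j..<j + k} x x') * ?F {j + k..<j + k + (Suc m - k)} x x')"
      proof (intro ext)
        fix x x'
        have "?F {j..<j + Suc m} x x' = ?F {j..<j + k} x x' * ?F {j + k..<j + k + (Suc m - k)} x x'"
          using k by (subst prod.atLeastLessThan_concat) auto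
        then show "c x x' * ?F {j..<j + Suc m} x x'
            = (c x x' * ?F {j..<j + k} x x') * ?F {j + k..<j + k + (Suc m - k)} x x'" by simp
      qed
      moreover have "ignores {j + k..<j + k + (Suc m - k)} (\<lambda>x x'. c x x' * ?F {j..<j + k} x x')"
        unfolding ignores_def
      proof (intro allI impI)
        fix x x' y y' :: "nat \<Rightarrow> real"
        assume a: "\<forall>l. l \<notin> {j + k..<j + k + (Suc m - k)} \<longrightarrow> x l = y l \<and> x' l = y' l"
        have "c x x' = c y y'" using a k by (intro ignoresD[OF c]) auto
        moreover have "?F {j..<j + k} x x' = ?F {j..<j + k} y y'"
          using a by (intro prod.cong) auto
        ultimately show "c x x' * ?F {j..<j + k} x x' = c y y' * ?F {j..<j + k} y y'" by simp
      qed
      ultimately have "W \<kappa> (Suc m - k) (j + k) (\<lambda>x x'. c x x' * ?F {j..<j + Suc m} x x')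
        = (\<lambda>x x'. (c x x' * ?F {j..<j + k} x x') * (w \<kappa> f (Suc m - k) (x (j + k)) * cnj (f (x' (j + k)))))"
        using less.IH[of "Suc m - k" "j + k"] k 2 by simp
      also have "\<dots> = (\<lambda>x x'. (c x x' * (w \<kappa> f (Suc m - k) (x (j + k)) * cnj (f (x' (j + k))))) * ?F {j..<j + k} x x')"
        by (simp add: mult_ac)
      finally have W2: "W \<kappa> (Suc m - k) (j + k) (\<lambda>x x'. c x x' * ?F {j..<j + Suc m} x x') = \<dots>" .
      have "ignores {j..<j + k} (\<lambda>x x'. c x x' * (w \<kappa> f (Suc m - k) (x (j + k)) * cnj (f (x' (j + k)))))"
        unfolding ignores_def
      proof (intro allI impI)
        fix x x' y y' :: "nat \<Rightarrow> real"
        assume a: "\<forall>l. l \<notin> {j..<j + k} \<longrightarrow> x l = y l \<and> x' l = y' l"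
        have "c x x' = c y y'" using a k by (intro ignoresD[OF c]) auto
        moreover have "x (j + k) = y (j + k)" "x' (j + k) = y' (j + k)" using a by auto
        ultimately show "c x x' * (w \<kappa> f (Suc m - k) (x (j + k)) * cnj (f (x' (j + k))))
          = c y y' * (w \<kappa> f (Suc m - k) (y (j + k)) * cnj (f (y' (j + k))))" by simp
      qed
      then have "(W \<kappa> k j \<circ> W \<kappa> (Suc m - k) (j + k)) (\<lambda>x x'. c x x' * ?F {j..<j + Suc m} x x')
        = (\<lambda>x x'. (c x x' * (w \<kappa> f (Suc m - k) (x (j + k)) * cnj (f (x' (j + k))))) * (w \<kappa> f k (x j) * cnj (f (x' j))))"
        unfolding o_def W2 using k 2 by (intro less.IH) auto
      moreover have "c (x(j + k := x j)) (x'(j + k := x j)) = c x x'"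
        using k by (intro ignoresD[OF c]) auto
      ultimately show ?thesis
        using k unfolding contract_def by (simp add: mult_ac)
    qed
    have s': "(\<Sum>k=1..m. contract j (j + k) ((W \<kappa> k j \<circ> W \<kappa> (Suc m - k) (j + k))
          (\<lambda>x x'. c x x' * ?F {j..<j + Suc m} x x')) x x')
        = (\<Sum>k=1..m. c x x' * (w \<kappa> f k (x j) * w \<kappa> f (Suc m - k) (x j) * cnj (f (x j)) * cnj (f (x' j))))"
      for x x' by (rule sum.cong[OF refl s])
    show ?thesis
      unfolding 2 W.simps w.simps
      unfolding 2[symmetric] pt d s'
      by (intro ext) (simp add: algebra_simps sum_distrib_left)
  qed
qed

lemma W_factorized:
  assumes f: "smooth f" "(LINT y|lborel. f y * cnj (f y)) = 1" and n: "0 < n"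
  shows "W \<kappa> n 1 (factorized f n) = (\<lambda>x x'. w \<kappa> f n (x 1) * cnj (f (x' 1)))"
proof -
  have "factorized f n = (\<lambda>x x'. 1 * (\<Prod>l=1..<1 + n. f (x l) * cnj (f (x' l))))"
    by (simp add: factorized_def atLeastLessThanSuc_atLeastAtMost)
  with W_product[OF f, of 1 n "\<lambda>_ _. 1" \<kappa>] n show ?thesis
    by (simp add: ignores_def)
qed

lemma full_trace_singleton:
  assumes [measurable]: "f \<in> borel_measurable borel"
  shows "full_trace {i} (\<lambda>x x'. f (x i)) = (LINT y|lborel. f y)"
proof -
  interpret product_sigma_finite "\<lambda>_::nat. lborel :: real measure" by standard
  show ?thesis unfolding full_trace_def by (rule product_integral_singleton) simp
qed

subsection \<open>Families of smooth functions\<close>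

text \<open>Q is imposed on the family as a whole and not on its members one by one, so its bounds
  are uniform in the index, which will be time.\<close>

definition tower :: "(('i \<Rightarrow> real \<Rightarrow> complex) \<Rightarrow> bool) \<Rightarrow> ('i \<Rightarrow> real \<Rightarrow> complex) \<Rightarrow> bool" where
  "tower Q u \<longleftrightarrow> (\<forall>i. smooth (u i)) \<and> (\<forall>m. Q (\<lambda>i. (xderiv ^^ m) (u i)))"

lemma tower_smooth: "tower Q u \<Longrightarrow> smooth (u i)"
  by (simp add: tower_def)

lemma tower_base: "tower Q u \<Longrightarrow> Q u"
  unfolding tower_def by (drule conjunct2, drule spec[of _ 0]) simp

lemma tower_xderiv: "tower Q u \<Longrightarrow> tower Q (\<lambda>i. xderiv (u i))"
proof -
  assume u: "tower Q u"
  have "Q (\<lambda>i. (xderiv ^^ m) (xderiv (u i)))" for m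
    using u unfolding tower_def by (auto dest!: spec[of _ "Suc m"] simp: funpow_swap1)
  with u show ?thesis by (simp add: tower_def smooth_xderiv)
qed

text \<open>
  A class \<open>Q\<close> of families that is closed under the algebra operations gives a class \<open>tower Q\<close>
  closed under them and under \<open>xderiv\<close>; it is used with local boundedness and with
  boundedness in \<open>L\<^sup>2\<close> and \<open>L\<^sup>\<infinity>\<close>.
\<close>

locale family_class =
  fixes Q :: "('i \<Rightarrow> real \<Rightarrow> complex) \<Rightarrow> bool"
  assumes Q_add: "\<lbrakk>\<And>i. smooth (u i); \<And>i. smooth (v i); Q u; Q v\<rbrakk> \<Longrightarrow> Q (\<lambda>i x. u i x + v i x)"
    and Q_mult: "\<lbrakk>\<And>i. smooth (u i); \<And>i. smooth (v i); Q u; Q v\<rbrakk> \<Longrightarrow> Q (\<lambda>i x. u i x * v i x)"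
    and Q_scale: "\<lbrakk>\<And>i. smooth (u i); Q u\<rbrakk> \<Longrightarrow> Q (\<lambda>i x. c * u i x)"
    and Q_cnj: "\<lbrakk>\<And>i. smooth (u i); Q u\<rbrakk> \<Longrightarrow> Q (\<lambda>i x. cnj (u i x))"
begin

lemma tower_add:
  assumes "tower Q u" "tower Q v" shows "tower Q (\<lambda>i x. u i x + v i x)"
proof -
  have "Q (\<lambda>i. (xderiv ^^ m) (\<lambda>x. u i x + v i x))" for m
    using Q_add[of "\<lambda>i. (xderiv ^^ m) (u i)" "\<lambda>i. (xderiv ^^ m) (v i)"] assms
    by (simp add: tower_def xderiv_power_add smooth_xderiv_power)
  with assms show ?thesis by (simp add: tower_def smooth_add)
qed

lemma tower_scale:
  assumes "tower Q u" shows "tower Q (\<lambda>i x. c * u i x)"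
proof -
  have "Q (\<lambda>i. (xderiv ^^ m) (\<lambda>x. c * u i x))" for m
    using Q_scale[of "\<lambda>i. (xderiv ^^ m) (u i)" c] assms
    by (simp add: tower_def xderiv_power_cmult smooth_xderiv_power)
  with assms show ?thesis by (simp add: tower_def smooth_mult smooth_const)
qed

lemma tower_cnj:
  assumes "tower Q u" shows "tower Q (\<lambda>i x. cnj (u i x))"
proof -
  have "Q (\<lambda>i. (xderiv ^^ m) (\<lambda>x. cnj (u i x)))" for m
    using Q_cnj[of "\<lambda>i. (xderiv ^^ m) (u i)"] assms
    by (simp add: tower_def xderiv_power_cnj smooth_xderiv_power)
  with assms show ?thesis by (simp add: tower_def smooth_cnj)
qed

lemma tower_mult:
  assumes "tower Q u" "tower Q v" shows "tower Q (\<lambda>i x. u i x * v i x)"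
proof -
  \<comment> \<open>The factors are generalized in place of using the Leibniz formula: one product
    rule reduces m + 1 derivatives of u v to m derivatives of u' v and of u v', and u', v' are again
    towers.\<close>
  have "Q (\<lambda>i. (xderiv ^^ m) (\<lambda>x. u i x * v i x))" if "tower Q u" "tower Q v" for m u v
    using that
  proof (induction m arbitrary: u v)
    case 0
    then show ?case by (simp add: Q_mult tower_base tower_smooth)
  next
    case (Suc n)
    note s = Suc.prems[THEN tower_smooth] and d = Suc.prems[THEN tower_xderiv]
    have "Q (\<lambda>i x. (xderiv ^^ n) (\<lambda>x. xderiv (u i) x * v i x) x + (xderiv ^^ n) (\<lambda>x. u i x * xderiv (v i) x) x)"
      by (intro Q_add smooth_xderiv_power smooth_mult smooth_xderiv s Suc.IH d Suc.prems)
    then show ?case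
      using s by (simp add: funpow_Suc_right xderiv_mult xderiv_power_add smooth_intros del: funpow.simps)
  qed
  with assms show ?thesis by (simp add: tower_def smooth_mult)
qed

lemma tower_zero: "tower Q u \<Longrightarrow> tower Q (\<lambda>i x. 0)"
  using tower_scale[of u 0] by simp

lemma tower_sum:
  assumes "tower Q u0" "\<And>k. k \<in> I \<Longrightarrow> tower Q (u k)"
  shows "tower Q (\<lambda>i x. \<Sum>k\<in>I. u k i x)"
  using assms(2)
  by (induction I rule: infinite_finite_induct) (auto intro: tower_zero[OF assms(1)] tower_add)

lemma tower_w: "tower Q u \<Longrightarrow> tower Q (\<lambda>i. w \<kappa> (u i) n)"
proof (induction n rule: less_induct)
  case (less n)
  consider "n = 0" | "n = Suc 0" | m where "n = Suc (Suc m)"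
    by (metis not0_implies_Suc)
  then show ?case
  proof cases
    case 1
    with less show ?thesis by (simp add: tower_zero)
  next
    case 2
    with less show ?thesis by simp
  next
    case (3 m)
    have w: "tower Q (\<lambda>i. w \<kappa> (u i) k)" if "k \<le> Suc m" for k
      using less.IH[of k] less.prems that 3 by simp
    have "tower Q (\<lambda>i x. \<Sum>k=1..m. w \<kappa> (u i) k x * w \<kappa> (u i) (Suc m - k) x)"
      by (rule tower_sum[OF less.prems], rule tower_mult) (rule w, simp)+
    from tower_mult[OF tower_cnj[OF less.prems] this]
    have "tower Q (\<lambda>i x. of_real \<kappa> * (cnj (u i x) * (\<Sum>k=1..m. w \<kappa> (u i) k x * w \<kappa> (u i) (Suc m - k) x)))"
      by (rule tower_scale)
    from tower_add[OF tower_scale[OF tower_xderiv[OF w[OF order_refl]]] this]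
    show ?thesis unfolding 3 w.simps .
  qed
qed

end

text \<open>\<open>tower locally_bounded\<close> expresses the seminorm bounds of
  \<open>Linfty_smooth\<close> for an arbitrary index set.\<close>

definition locally_bounded :: "('i \<Rightarrow> real \<Rightarrow> complex) \<Rightarrow> bool" where
  "locally_bounded u \<longleftrightarrow> (\<forall>a b. \<exists>C. \<forall>i. \<forall>x\<in>{a..b}. cmod (u i x) \<le> C)"

lemma locally_boundedD:
  assumes "locally_bounded u"
  obtains C where "\<And>i x. x \<in> {a..b} \<Longrightarrow> cmod (u i x) \<le> C" "0 < C"
proof -
  obtain C where C: "\<And>i x. x \<in> {a..b} \<Longrightarrow> cmod (u i x) \<le> C"
    using assms unfolding locally_bounded_def by blast
  have "cmod (u i x) \<le> max C 1" if "x \<in> {a..b}" for i x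
    using C[OF that, of i] by linarith
  then show ?thesis using that[of "max C 1"] by auto
qed

lemma family_class_locally_bounded: "family_class locally_bounded"
proof
  fix u v :: "'i \<Rightarrow> real \<Rightarrow> complex"
  assume u: "locally_bounded u"
  show "locally_bounded (\<lambda>i x. c * u i x)" for c
    unfolding locally_bounded_def
  proof (intro allI)
    fix a b
    obtain C where "\<And>i x. x \<in> {a..b} \<Longrightarrow> cmod (u i x) \<le> C" by (rule locally_boundedD[OF u, of a b]) blast
    then show "\<exists>C. \<forall>i. \<forall>x\<in>{a..b}. cmod (c * u i x) \<le> C"
      by (intro exI[of _ "cmod c * C"]) (simp add: norm_mult mult_left_mono)
  qed
  show "locally_bounded (\<lambda>i x. cnj (u i x))"
    using u by (simp add: locally_bounded_def)
  assume v: "locally_bounded v"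
  show "locally_bounded (\<lambda>i x. u i x + v i x)"
    unfolding locally_bounded_def
  proof (intro allI)
    fix a b
    obtain C where C: "\<And>i x. x \<in> {a..b} \<Longrightarrow> cmod (u i x) \<le> C" by (rule locally_boundedD[OF u, of a b]) blast
    obtain D where D: "\<And>i x. x \<in> {a..b} \<Longrightarrow> cmod (v i x) \<le> D" by (rule locally_boundedD[OF v, of a b]) blast
    show "\<exists>C. \<forall>i. \<forall>x\<in>{a..b}. cmod (u i x + v i x) \<le> C"
      by (intro exI[of _ "C + D"] allI ballI norm_triangle_le add_mono C D)
  qed
  show "locally_bounded (\<lambda>i x. u i x * v i x)"
    unfolding locally_bounded_def
  proof (intro allI)
    fix a b
    obtain C where C: "\<And>i x. x \<in> {a..b} \<Longrightarrow> cmod (u i x) \<le> C" "0 < C" by (rule locally_boundedD[OF u, of a b]) blast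
    obtain D where D: "\<And>i x. x \<in> {a..b} \<Longrightarrow> cmod (v i x) \<le> D" by (rule locally_boundedD[OF v, of a b]) blast
    show "\<exists>C. \<forall>i. \<forall>x\<in>{a..b}. cmod (u i x * v i x) \<le> C"
      unfolding norm_mult using C
      by (intro exI[of _ "C * D"] allI ballI mult_mono C D) auto
  qed
qed

interpretation LB: family_class locally_bounded
  by (rule family_class_locally_bounded)

subsection \<open>Time dependence\<close>

definition time_continuous :: "(real \<Rightarrow> real \<Rightarrow> complex) \<Rightarrow> bool" where
  "time_continuous u \<longleftrightarrow> (\<forall>x. continuous_on {0..} (\<lambda>t. u t x))"

text \<open>The error of the difference quotient is governed by the second derivative on [x, x + 1],
  which is bounded for all indices at once. This uniformity allows limits h \<rightarrow> 0 to be
  exchanged with limits in time.\<close>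

lemma tower_difference_quotient:
  fixes u :: "'i \<Rightarrow> real \<Rightarrow> complex"
  assumes u: "tower locally_bounded u"
  obtains C where "C > 0" "\<And>i h. 0 < h \<Longrightarrow> h \<le> 1 \<Longrightarrow>
    cmod ((u i (x + h) - u i x) / of_real h - xderiv (u i) x) \<le> C * h"
proof -
  have "locally_bounded (\<lambda>i. xderiv (xderiv (u i)))"
    using u[THEN tower_xderiv, THEN tower_xderiv] by (rule tower_base)
  then obtain C where C: "\<And>i y. y \<in> {x..x+1} \<Longrightarrow> cmod (xderiv (xderiv (u i)) y) \<le> C" "0 < C"
    by (rule locally_boundedD[of _ x "x + 1"]) (rule that)
  have "cmod ((u i (x + h) - u i x) / of_real h - xderiv (u i) x) \<le> C * h"
    if h: "0 < h" "h \<le> 1" for i h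
  proof -
    have s: "smooth (u i)" "smooth (xderiv (u i))"
      using u by (auto intro: tower_smooth smooth_xderiv)
    have lip: "cmod (xderiv (u i) y - xderiv (u i) x) \<le> C * h" if y: "y \<in> {x..x+h}" for y
    proof -
      have "norm (xderiv (u i) y - xderiv (u i) x) \<le> C * \<bar>y - x\<bar>"
        using y h C by (intro vector_derivative_bound[of "{x..x+1}" _ "xderiv (xderiv (u i))"]
            has_vector_derivative_at_within[OF smooth_has_xderiv[OF s(2)]]) auto
      also have "\<dots> \<le> C * h" using y C(2) by (intro mult_left_mono) auto
      finally show ?thesis .
    qed
    \<comment> \<open>With the linear part removed, the derivative of g is u' minus its value at x,
      hence at most C h on [x, x + h]; the mean value inequality gives C h^2, and division by h
      leaves C h.\<close>
    define g where "g = (\<lambda>y. u i y - (y - x) *\<^sub>R xderiv (u i) x)"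
    have g: "(g has_vector_derivative (xderiv (u i) y - xderiv (u i) x)) (at y)" for y
      unfolding g_def
      by (rule has_vector_derivative_eq_rhs[OF has_vector_derivative_diff[OF smooth_has_xderiv[OF s(1)]
            has_vector_derivative_scaleR[OF DERIV_diff[OF DERIV_ident DERIV_const] has_vector_derivative_const]]]) simp
    have "norm (g (x + h) - g x) \<le> (C * h) * \<bar>(x + h) - x\<bar>"
      using h lip by (intro vector_derivative_bound[of "{x..x+h}" _ "\<lambda>y. xderiv (u i) y - xderiv (u i) x"]
            has_vector_derivative_at_within[OF g]) auto
    then have "cmod (u i (x + h) - u i x - of_real h * xderiv (u i) x) \<le> C * h * h"
      using h by (simp add: g_def algebra_simps scaleR_conv_of_real)
    moreover have "(u i (x + h) - u i x) / of_real h - xderiv (u i) x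
        = (u i (x + h) - u i x - of_real h * xderiv (u i) x) / of_real h"
      using h by (simp add: field_simps)
    ultimately show ?thesis
      using h by (simp add: norm_divide field_simps)
  qed
  then show ?thesis using that C(2) by blast
qed


text \<open>The difference quotients with step 1 / (n + 1) are continuous in time and converge
  uniformly in time, so their limit is continuous.\<close>

lemma time_continuous_xderiv:
  assumes u: "tower locally_bounded u" and c: "time_continuous u"
  shows "time_continuous (\<lambda>t. xderiv (u t))"
  unfolding time_continuous_def
proof (rule allI)
  fix x
  obtain C where C: "C > 0" "\<And>t h. 0 < h \<Longrightarrow> h \<le> 1 \<Longrightarrow>
      cmod ((u t (x + h) - u t x) / of_real h - xderiv (u t) x) \<le> C * h"
    by (rule tower_difference_quotient[OF u, of x]) (rule that)
  show "continuous_on {0..} (\<lambda>t. xderiv (u t) x)"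
  proof (rule uniform_limit_theorem)
    show "\<forall>\<^sub>F n in sequentially. continuous_on {0..} (\<lambda>t. (u t (x + 1 / real (Suc n)) - u t x) / of_real (1 / real (Suc n)))"
      using c by (intro always_eventually allI continuous_intros)
        (auto simp: time_continuous_def simp del: of_nat_Suc)
    show "uniform_limit {0..} (\<lambda>n t. (u t (x + 1 / real (Suc n)) - u t x) / of_real (1 / real (Suc n)))
        (\<lambda>t. xderiv (u t) x) sequentially"
      unfolding uniform_limit_iff
    proof (intro allI impI)
      fix e :: real assume "e > 0"
      have "(\<lambda>n. C * (1 / real (Suc n))) \<longlonglongrightarrow> C * 0"
        by (rule tendsto_mult[OF tendsto_const LIMSEQ_inverse_real_of_nat[unfolded inverse_eq_divide]])
      then have "\<forall>\<^sub>F n in sequentially. C * (1 / real (Suc n)) < e"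
        using \<open>e > 0\<close> by (intro order_tendstoD(2)[where y = "C * 0"]) auto
      then show "\<forall>\<^sub>F n in sequentially. \<forall>t\<in>{0..}.
          dist ((u t (x + 1 / real (Suc n)) - u t x) / of_real (1 / real (Suc n))) (xderiv (u t) x) < e"
      proof eventually_elim
        case (elim n)
        have "0 < 1 / real (Suc n)" "1 / real (Suc n) \<le> 1" by simp_all
        from C(2)[OF this] elim show ?case
          unfolding dist_norm by (blast intro: le_less_trans)
      qed
    qed
  qed simp
qed

text \<open>The time derivative v must itself be a tower and continuous in time. This makes the
  relation stable under \<open>xderiv\<close> and later justifies differentiation under the integral
  sign.\<close>

definition evolves :: "(real \<Rightarrow> real \<Rightarrow> complex) \<Rightarrow> (real \<Rightarrow> real \<Rightarrow> complex) \<Rightarrow> bool" where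
  "evolves u v \<longleftrightarrow> tower locally_bounded u \<and> tower locally_bounded v \<and>
     time_continuous u \<and> time_continuous v \<and>
     (\<forall>t\<ge>0. \<forall>x. ((\<lambda>s. u s x) has_vector_derivative v t x) (at t within {0..}))"

lemma evolvesD:
  assumes "evolves u v"
  shows "tower locally_bounded u" "tower locally_bounded v" "time_continuous u" "time_continuous v"
    "t \<ge> 0 \<Longrightarrow> ((\<lambda>s. u s x) has_vector_derivative v t x) (at t within {0..})"
  using assms by (auto simp: evolves_def)

lemma evolves_add:
  assumes "evolves u v" "evolves u' v'"
  shows "evolves (\<lambda>t x. u t x + u' t x) (\<lambda>t x. v t x + v' t x)"
  using assms unfolding evolves_def time_continuous_def
  by (intro conjI allI impI LB.tower_add continuous_intros has_vector_derivative_add) auto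

lemma evolves_mult:
  assumes "evolves u v" "evolves u' v'"
  shows "evolves (\<lambda>t x. u t x * u' t x) (\<lambda>t x. v t x * u' t x + u t x * v' t x)"
  using assms unfolding evolves_def time_continuous_def
  by (intro conjI allI impI LB.tower_add LB.tower_mult continuous_intros
      has_vector_derivative_eq_rhs[OF has_vector_derivative_mult]) auto

lemma evolves_scale:
  assumes "evolves u v"
  shows "evolves (\<lambda>t x. c * u t x) (\<lambda>t x. c * v t x)"
  using assms unfolding evolves_def time_continuous_def
  by (intro conjI allI impI LB.tower_scale continuous_intros has_vector_derivative_mult_right) auto

lemma evolves_cnj:
  assumes "evolves u v"
  shows "evolves (\<lambda>t x. cnj (u t x)) (\<lambda>t x. cnj (v t x))"
  using assms unfolding evolves_def time_continuous_def
  by (intro conjI allI impI LB.tower_cnj continuous_intros has_vector_derivative_cnj) auto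

lemma evolves_zero: "evolves u v \<Longrightarrow> evolves (\<lambda>t x. 0) (\<lambda>t x. 0)"
  using evolves_scale[of u v 0] by simp

lemma evolves_sum:
  assumes "evolves u0 v0" "\<And>k. k \<in> I \<Longrightarrow> evolves (u k) (v k)"
  shows "evolves (\<lambda>t x. \<Sum>k\<in>I. u k t x) (\<lambda>t x. \<Sum>k\<in>I. v k t x)"
  using assms(2)
  by (induction I rule: infinite_finite_induct) (auto intro: evolves_zero[OF assms(1)] evolves_add)

text \<open>The interchange of time and space derivative. For fixed h the difference quotient in x
  can be differentiated in time; the mean value inequality in time bounds its linearization error by
  (D h + e) |s - t|, and replacing the two quotients of u by derivatives costs at most C h
  each.\<close>

lemma evolves_xderiv:
  assumes uv: "evolves u v"
  shows "evolves (\<lambda>t. xderiv (u t)) (\<lambda>t. xderiv (v t))"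
proof -
  note * = evolvesD[OF uv]
  have cv: "time_continuous (\<lambda>t. xderiv (v t))"
    by (rule time_continuous_xderiv[OF *(2,4)])
  have "((\<lambda>s. xderiv (u s) x) has_vector_derivative xderiv (v t) x) (at t within {0..})"
    if t: "t \<ge> 0" for t x
  proof -
    obtain C where C: "C > 0" "\<And>s h. 0 < h \<Longrightarrow> h \<le> 1 \<Longrightarrow>
        cmod ((u s (x + h) - u s x) / of_real h - xderiv (u s) x) \<le> C * h"
      by (rule tower_difference_quotient[OF *(1), of x]) (rule that)
    obtain D where D: "D > 0" "\<And>s h. 0 < h \<Longrightarrow> h \<le> 1 \<Longrightarrow>
        cmod ((v s (x + h) - v s x) / of_real h - xderiv (v s) x) \<le> D * h"
      by (rule tower_difference_quotient[OF *(2), of x]) (rule that)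
    show ?thesis
      unfolding has_vector_derivative_def has_derivative_within_alt
    proof (intro conjI allI impI)
      show "bounded_linear (\<lambda>h. h *\<^sub>R xderiv (v t) x)" by (rule bounded_linear_scaleR_left)
      fix e :: real assume e: "e > 0"
      have "continuous (at t within {0..}) (\<lambda>t. xderiv (v t) x)"
        using cv t by (auto simp: time_continuous_def continuous_on_eq_continuous_within)
      then obtain d where d: "d > 0" "\<And>s. s \<ge> 0 \<Longrightarrow> \<bar>s - t\<bar> < d \<Longrightarrow> cmod (xderiv (v s) x - xderiv (v t) x) < e"
        unfolding continuous_within_eps_delta using e by (force simp: dist_norm)
      have "cmod (xderiv (u s) x - xderiv (u t) x - (s - t) *\<^sub>R xderiv (v t) x) \<le> e * \<bar>s - t\<bar>"
        if s: "s \<ge> 0" "\<bar>s - t\<bar> < d" for s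
      proof -
        have bound: "cmod (xderiv (u s) x - xderiv (u t) x - (s - t) *\<^sub>R xderiv (v t) x)
            \<le> (D * h + e) * \<bar>s - t\<bar> + 2 * (C * h)" if h: "0 < h" "h \<le> 1" for h
        proof -
          define q where "q = (\<lambda>(u :: real \<Rightarrow> real \<Rightarrow> complex) s. (u s (x + h) - u s x) / complex_of_real h :: complex)"
          let ?g = "\<lambda>\<tau>. q u \<tau> - \<tau> *\<^sub>R xderiv (v t) x"
          have der: "(?g has_vector_derivative (q v \<tau> - xderiv (v t) x)) (at \<tau> within {min s t..max s t})"
            if "\<tau> \<in> {min s t..max s t}" for \<tau>
          proof -
            have "\<tau> \<ge> 0" using that s t by auto
            then have "((\<lambda>s. q u s) has_vector_derivative q v \<tau>) (at \<tau> within {min s t..max s t})"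
              unfolding q_def divide_inverse using s t
              by (intro has_vector_derivative_mult_left has_vector_derivative_diff
                  has_vector_derivative_within_subset[OF *(5)]) auto
            then show ?thesis
              by (rule has_vector_derivative_eq_rhs[OF has_vector_derivative_diff[OF _
                has_vector_derivative_scaleR[OF DERIV_ident has_vector_derivative_const]]]) simp
          qed
          have "norm (?g s - ?g t) \<le> (D * h + e) * \<bar>s - t\<bar>"
          proof (rule vector_derivative_bound[OF _ der])
            fix \<tau> assume \<tau>: "\<tau> \<in> {min s t..max s t}"
            have "\<tau> \<ge> 0" "\<bar>\<tau> - t\<bar> < d" using \<tau> s t by auto
            have "cmod (q v \<tau> - xderiv (v t) x) \<le> cmod (q v \<tau> - xderiv (v \<tau>) x) + cmod (xderiv (v \<tau>) x - xderiv (v t) x)"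
              using norm_triangle_ineq[of "q v \<tau> - xderiv (v \<tau>) x" "xderiv (v \<tau>) x - xderiv (v t) x"] by simp
            also have "\<dots> \<le> D * h + e"
              using D(2)[OF h, of \<tau>] d(2)[OF \<open>\<tau> \<ge> 0\<close> \<open>\<bar>\<tau> - t\<bar> < d\<close>] by (simp add: q_def)
            finally show "cmod (q v \<tau> - xderiv (v t) x) \<le> D * h + e" .
          qed auto
          then have g: "cmod (?g s - ?g t) \<le> (D * h + e) * \<bar>s - t\<bar>" by simp
          have "xderiv (u s) x - xderiv (u t) x - (s - t) *\<^sub>R xderiv (v t) x
              = (?g s - ?g t) - (q u s - xderiv (u s) x) + (q u t - xderiv (u t) x)"
            by (simp add: scaleR_conv_of_real algebra_simps)
          moreover have "cmod (a - b + c) \<le> cmod a + cmod b + cmod c" for a b c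
            using norm_triangle_ineq4[of a b] norm_triangle_ineq[of "a - b" c] by linarith
          ultimately have "cmod (xderiv (u s) x - xderiv (u t) x - (s - t) *\<^sub>R xderiv (v t) x)
              \<le> cmod (?g s - ?g t) + cmod (q u s - xderiv (u s) x) + cmod (q u t - xderiv (u t) x)"
            by (simp only:)
          also have "\<dots> \<le> (D * h + e) * \<bar>s - t\<bar> + 2 * (C * h)"
            using g C(2)[OF h, of s] C(2)[OF h, of t] by (simp add: q_def)
          finally show ?thesis .
        qed
        \<comment> \<open>The time window d does not depend on h, so h may tend to 0 while s and t
          stay fixed; only e |s - t| survives.\<close>
        have "((\<lambda>h. (D * h + e) * \<bar>s - t\<bar> + 2 * (C * h)) \<longlongrightarrow> (D * 0 + e) * \<bar>s - t\<bar> + 2 * (C * 0)) (at_right 0)"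
          by (intro tendsto_intros)
        moreover have "\<forall>\<^sub>F h in at_right (0::real). cmod (xderiv (u s) x - xderiv (u t) x - (s - t) *\<^sub>R xderiv (v t) x)
            \<le> (D * h + e) * \<bar>s - t\<bar> + 2 * (C * h)"
          using bound by (auto simp: eventually_at_right_field intro!: exI[of _ 1])
        ultimately show ?thesis
          by (auto dest!: tendsto_lowerbound)
      qed
      then show "\<exists>d>0. \<forall>y\<in>{0..}. norm (y - t) < d \<longrightarrow>
          norm (xderiv (u y) x - xderiv (u t) x - (y - t) *\<^sub>R xderiv (v t) x) \<le> e * norm (y - t)"
        using d(1) by auto
    qed
  qed
  then show ?thesis
    using * cv by (auto simp: evolves_def intro: tower_xderiv time_continuous_xderiv)
qed

section \<open>Recursions and time evolution of the Zakharov-Shabat densities\<close>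

lemma sum_atMost_rev: "(\<Sum>k\<le>n. f k (n - k)) = (\<Sum>k\<le>n. f (n - k) k)" for n :: nat
  by (rule sum.reindex_bij_witness[of _ "\<lambda>k. n - k" "\<lambda>k. n - k"]) auto

text \<open>With the generating series W = \<Sum> w_n z^n this is the coefficient of z^n in W^2. The
  recursion for \<open>w\<close> is then the Riccati equation W = z (f - \<i> W' + \<kappa> cnj f
  W^2), where ' is the derivative in x, and the next lemmas are its consequences read off
  coefficientwise.\<close>

definition w_square :: "real \<Rightarrow> (real \<Rightarrow> complex) \<Rightarrow> nat \<Rightarrow> real \<Rightarrow> complex" where
  "w_square \<kappa> f n = (\<lambda>x. \<Sum>k\<le>n. w \<kappa> f k x * w \<kappa> f (n - k) x)"

lemma w_Suc:
  assumes "0 < n"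
  shows "w \<kappa> f (Suc n) = (\<lambda>x. - \<i> * xderiv (w \<kappa> f n) x + of_real \<kappa> * (cnj (f x) * w_square \<kappa> f n x))"
proof -
  obtain m where m: "n = Suc m" using assms gr0_conv_Suc by blast
  have "w_square \<kappa> f n x = (\<Sum>k=1..m. w \<kappa> f k x * w \<kappa> f (Suc m - k) x)" for x
    unfolding w_square_def m
    by (rule sum.mono_neutral_right) (auto simp: not_le le_Suc_eq Suc_le_eq)
  then show ?thesis by (simp add: m)
qed

lemma smooth_w_square: "smooth f \<Longrightarrow> smooth (w_square \<kappa> f n)"
  unfolding w_square_def by (intro smooth_intros smooth_w)

lemma xderiv_w_square:
  assumes "smooth f"
  shows "xderiv (w_square \<kappa> f n) x = 2 * (\<Sum>k\<le>n. xderiv (w \<kappa> f k) x * w \<kappa> f (n - k) x)"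
proof -
  have "xderiv (w_square \<kappa> f n) x
      = (\<Sum>k\<le>n. xderiv (w \<kappa> f k) x * w \<kappa> f (n - k) x) + (\<Sum>k\<le>n. w \<kappa> f k x * xderiv (w \<kappa> f (n - k)) x)"
    unfolding w_square_def using assms
    by (simp add: xderiv_sum smooth_intros smooth_w xderiv_mult sum.distrib)
  also have "(\<Sum>k\<le>n. w \<kappa> f k x * xderiv (w \<kappa> f (n - k)) x) = (\<Sum>k\<le>n. xderiv (w \<kappa> f k) x * w \<kappa> f (n - k) x)"
    by (subst sum_atMost_rev[of "\<lambda>i j. w \<kappa> f i x * xderiv (w \<kappa> f j) x"]) (simp add: mult.commute)
  finally show ?thesis by simp
qed

lemma sum_w_Suc: "(\<Sum>k\<le>Suc n. a k * w \<kappa> f (Suc n - k) x) = a 0 * w \<kappa> f (Suc n) x + (\<Sum>k\<le>n. a (Suc k) * w \<kappa> f (n - k) x)"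
  by (simp add: sum.atMost_Suc_shift del: sum.atMost_Suc)

text \<open>The Riccati equation multiplied by W, with W W' = (W^2)' / 2. The last sum is the
  coefficient of W^3.\<close>

lemma w_square_Suc:
  assumes "smooth f"
  shows "w_square \<kappa> f (Suc n) x = f x * w \<kappa> f n x - \<i> / 2 * xderiv (w_square \<kappa> f n) x
    + of_real \<kappa> * (cnj (f x) * (\<Sum>k\<le>n. w_square \<kappa> f k x * w \<kappa> f (n - k) x))"
proof -
  \<comment> \<open>The correction at k = 0 is the inhomogeneous term of the Riccati equation: there
    the remaining right-hand side vanishes, while w_1 = f.\<close>
  have 1: "w \<kappa> f (Suc k) x = - \<i> * xderiv (w \<kappa> f k) x + of_real \<kappa> * (cnj (f x) * w_square \<kappa> f k x) + (if k = 0 then f x else 0)" for k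
    by (cases "k = 0") (simp_all add: w_Suc xderiv_const w_square_def)
  have "w_square \<kappa> f (Suc n) x = (\<Sum>k\<le>n. w \<kappa> f (Suc k) x * w \<kappa> f (n - k) x)"
    unfolding w_square_def by (subst sum_w_Suc) simp
  also have "\<dots> = (\<Sum>k\<le>n. - \<i> * (xderiv (w \<kappa> f k) x * w \<kappa> f (n - k) x))
     + (\<Sum>k\<le>n. of_real \<kappa> * (cnj (f x) * (w_square \<kappa> f k x * w \<kappa> f (n - k) x)))
     + (\<Sum>k\<le>n. if k = 0 then f x * w \<kappa> f (n - k) x else 0)"
    unfolding 1 sum.distrib[symmetric] by (rule sum.cong) (auto simp: algebra_simps)
  also have "\<dots> = - \<i> * (\<Sum>k\<le>n. xderiv (w \<kappa> f k) x * w \<kappa> f (n - k) x)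
     + of_real \<kappa> * (cnj (f x) * (\<Sum>k\<le>n. w_square \<kappa> f k x * w \<kappa> f (n - k) x)) + f x * w \<kappa> f n x"
    by (simp add: sum.delta sum_distrib_left)
  finally show ?thesis using assms by (simp add: xderiv_w_square)
qed

text \<open>The time derivative of \<open>w \<kappa> f n\<close> under the NLS flow, eliminating \<open>f\<^sub>t\<close>.\<close>

definition w_dot :: "real \<Rightarrow> (real \<Rightarrow> complex) \<Rightarrow> nat \<Rightarrow> real \<Rightarrow> complex" where
  "w_dot \<kappa> f n = (\<lambda>x. if n = 0 then 0 else - xderiv (w \<kappa> f (Suc n)) x
     - (2 * \<i> * of_real \<kappa> * (f x * cnj (f x) * w \<kappa> f n x) + of_real \<kappa> * (cnj (xderiv f x) * w_square \<kappa> f n x)))"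

definition nls_rhs :: "real \<Rightarrow> (real \<Rightarrow> complex) \<Rightarrow> real \<Rightarrow> complex" where
  "nls_rhs \<kappa> f = (\<lambda>x. \<i> * xderiv (xderiv f) x - 2 * \<i> * of_real \<kappa> * (f x * f x * cnj (f x)))"

text \<open>Half of the formal time derivative of W^2. The leading part of \<open>w_dot\<close>
  contributes the derivatives of w_1, w_2, ... paired with W; these make up half the derivative of
  \<open>w_square\<close> at n + 1, once the missing k = 0 correction is added. The cubic sum is
  kept as it is.\<close>

lemma w_dot_square:
  assumes "smooth f"
  shows "(\<Sum>k\<le>n. w_dot \<kappa> f k x * w \<kappa> f (n - k) x)
    = - xderiv (w_square \<kappa> f (Suc n)) x / 2 + xderiv f x * w \<kappa> f n x
      - 2 * \<i> * of_real \<kappa> * (f x * cnj (f x) * w_square \<kappa> f n x)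
      - of_real \<kappa> * (cnj (xderiv f x) * (\<Sum>k\<le>n. w_square \<kappa> f k x * w \<kappa> f (n - k) x))"
proof -
  have 1: "w_dot \<kappa> f k x = - xderiv (w \<kappa> f (Suc k)) x + (if k = 0 then xderiv f x else 0)
     - (2 * \<i> * of_real \<kappa> * (f x * cnj (f x) * w \<kappa> f k x) + of_real \<kappa> * (cnj (xderiv f x) * w_square \<kappa> f k x))" for k
    by (cases "k = 0") (simp_all add: w_dot_def w_square_def)
  have "(\<Sum>k\<le>n. w_dot \<kappa> f k x * w \<kappa> f (n - k) x) =
     - (\<Sum>k\<le>n. xderiv (w \<kappa> f (Suc k)) x * w \<kappa> f (n - k) x)
     + (\<Sum>k\<le>n. if k = 0 then xderiv f x * w \<kappa> f (n - k) x else 0)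
     - (\<Sum>k\<le>n. 2 * \<i> * of_real \<kappa> * (f x * cnj (f x) * (w \<kappa> f k x * w \<kappa> f (n - k) x)))
     - (\<Sum>k\<le>n. of_real \<kappa> * (cnj (xderiv f x) * (w_square \<kappa> f k x * w \<kappa> f (n - k) x)))"
    unfolding 1 sum.distrib[symmetric] sum_subtractf[symmetric] sum_negf[symmetric]
    by (rule sum.cong) (auto simp: algebra_simps)
  also have "(\<Sum>k\<le>n. xderiv (w \<kappa> f (Suc k)) x * w \<kappa> f (n - k) x) = xderiv (w_square \<kappa> f (Suc n)) x / 2"
    using assms sum_w_Suc[of "\<lambda>k. xderiv (w \<kappa> f k) x" \<kappa> f n x]
    by (simp add: xderiv_w_square xderiv_const)
  also have "(\<Sum>k\<le>n. if k = 0 then xderiv f x * w \<kappa> f (n - k) x else 0) = xderiv f x * w \<kappa> f n x"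
    by (simp add: sum.delta)
  finally show ?thesis
    unfolding w_square_def[of _ _ n] by (simp add: sum_distrib_left)
qed

text \<open>The right-hand side is the formal time derivative of the recursion \<open>w_Suc\<close>,
  with \<open>nls_rhs\<close> and \<open>w_dot\<close> as the time derivatives of f and w. The
  identity concerns one fixed function and is the algebraic core of the induction in
  \<open>w_evolves\<close>.\<close>

lemma w_dot_Suc:
  assumes f: "smooth f" and n: "0 < n"
  shows "w_dot \<kappa> f (Suc n) x = - \<i> * xderiv (w_dot \<kappa> f n) x + of_real \<kappa> *
    (cnj (nls_rhs \<kappa> f x) * w_square \<kappa> f n x
     + cnj (f x) * (\<Sum>k\<le>n. w_dot \<kappa> f k x * w \<kappa> f (n - k) x + w \<kappa> f k x * w_dot \<kappa> f (n - k) x))"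
proof -
  note s = smooth_intros smooth_w[OF f] smooth_w_square[OF f] f
  define T where "T = (\<Sum>k\<le>n. w_square \<kappa> f k x * w \<kappa> f (n - k) x)"
  define P where "P = xderiv (w_square \<kappa> f n) x"
  define P' where "P' = xderiv (w_square \<kappa> f (Suc n)) x"
  have sq: "(\<Sum>k\<le>n. w_dot \<kappa> f k x * w \<kappa> f (n - k) x + w \<kappa> f k x * w_dot \<kappa> f (n - k) x)
      = 2 * (\<Sum>k\<le>n. w_dot \<kappa> f k x * w \<kappa> f (n - k) x)"
    using sum_atMost_rev[of "\<lambda>i j. w \<kappa> f i x * w_dot \<kappa> f j x" n]
    by (simp add: sum.distrib mult.commute)
  have d: "xderiv (w_dot \<kappa> f n) x = - xderiv (xderiv (w \<kappa> f (Suc n))) x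
      - (2 * \<i> * of_real \<kappa> * ((xderiv f x * cnj (f x) + f x * cnj (xderiv f x)) * w \<kappa> f n x
            + f x * cnj (f x) * xderiv (w \<kappa> f n) x)
         + of_real \<kappa> * (cnj (xderiv (xderiv f) x) * w_square \<kappa> f n x + cnj (xderiv f x) * P))"
    unfolding w_dot_def P_def using n
    by (simp add: s xderiv_add xderiv_diff xderiv_uminus xderiv_cmult xderiv_mult xderiv_cnj del: w.simps)
  have w': "xderiv (w \<kappa> f (Suc (Suc n))) x = - \<i> * xderiv (xderiv (w \<kappa> f (Suc n))) x
      + of_real \<kappa> * (cnj (xderiv f x) * w_square \<kappa> f (Suc n) x + cnj (f x) * P')"
    unfolding w_Suc[OF zero_less_Suc, of \<kappa> f n] P'_def
    by (simp add: s xderiv_add xderiv_diff xderiv_uminus xderiv_cmult xderiv_mult xderiv_cnj del: w.simps)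
  have wn: "w \<kappa> f (Suc n) x = - \<i> * xderiv (w \<kappa> f n) x + of_real \<kappa> * (cnj (f x) * w_square \<kappa> f n x)"
    by (simp add: w_Suc[OF n])
  have w_dot: "w_dot \<kappa> f (Suc n) x = - xderiv (w \<kappa> f (Suc (Suc n))) x
     - (2 * \<i> * of_real \<kappa> * (f x * cnj (f x) * w \<kappa> f (Suc n) x) + of_real \<kappa> * (cnj (xderiv f x) * w_square \<kappa> f (Suc n) x))"
    by (simp add: w_dot_def del: w.simps)
  \<comment> \<open>The derivative P' has the same coefficient on both sides and need not be
    expanded. Inserting \<open>w_square_Suc\<close> for the undifferentiated \<open>w_square\<close>
    at n + 1 produces the cubic sum T, which then matches as well; the rest is polynomial
    algebra.\<close>
  show ?thesis
    unfolding w_dot sq d w_dot_square[OF f] w' wn P'_def[symmetric]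
    unfolding w_square_Suc[OF f] nls_rhs_def T_def[symmetric] P_def[symmetric]
    by (simp add: algebra_simps)
qed

lemma w_square_evolves:
  assumes "evolves \<psi> F" "\<And>k. k \<le> n \<Longrightarrow> evolves (\<lambda>t. w \<kappa> (\<psi> t) k) (\<lambda>t. w_dot \<kappa> (\<psi> t) k)"
  shows "evolves (\<lambda>t. w_square \<kappa> (\<psi> t) n)
    (\<lambda>t x. \<Sum>k\<le>n. w_dot \<kappa> (\<psi> t) k x * w \<kappa> (\<psi> t) (n - k) x + w \<kappa> (\<psi> t) k x * w_dot \<kappa> (\<psi> t) (n - k) x)"
  unfolding w_square_def
  by (rule evolves_sum[OF assms(1)], rule evolves_mult) (rule assms(2), simp)+

lemma w_evolves:
  assumes \<psi>: "evolves \<psi> (\<lambda>t. nls_rhs \<kappa> (\<psi> t))"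
  shows "evolves (\<lambda>t. w \<kappa> (\<psi> t) n) (\<lambda>t. w_dot \<kappa> (\<psi> t) n)"
proof (induction n rule: less_induct)
  case (less n)
  have s: "smooth (\<psi> t)" for t using evolvesD(1)[OF \<psi>] by (rule tower_smooth)
  consider "n = 0" | "n = Suc 0" | m where "n = Suc m" "0 < m"
    by (metis not0_implies_Suc gr0I)
  then show ?case
  proof cases
    case 1
    with evolves_zero[OF \<psi>] show ?thesis by (simp add: w_dot_def)
  next
    case 2
    \<comment> \<open>Here w_2 = - \<i> f' and \<open>w_square\<close> vanishes at index 1, so
      \<open>w_dot\<close> at 1 is the equation itself.\<close>
    have "w_dot \<kappa> (\<psi> t) 1 = nls_rhs \<kappa> (\<psi> t)" for t
      by (auto simp: fun_eq_iff w_dot_def nls_rhs_def w_square_def xderiv_cmult xderiv_uminus smooth_intros s mult_ac)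
    with \<psi> 2 show ?thesis by simp
  next
    case (3 m)
    from less.IH 3 have IH: "evolves (\<lambda>t. w \<kappa> (\<psi> t) k) (\<lambda>t. w_dot \<kappa> (\<psi> t) k)" if "k \<le> m" for k
      using that by simp
    have "evolves (\<lambda>t x. - \<i> * xderiv (w \<kappa> (\<psi> t) m) x + of_real \<kappa> * (cnj (\<psi> t x) * w_square \<kappa> (\<psi> t) m x))
      (\<lambda>t x. - \<i> * xderiv (w_dot \<kappa> (\<psi> t) m) x + of_real \<kappa> *
        (cnj (nls_rhs \<kappa> (\<psi> t) x) * w_square \<kappa> (\<psi> t) m x
          + cnj (\<psi> t x) * (\<Sum>k\<le>m. w_dot \<kappa> (\<psi> t) k x * w \<kappa> (\<psi> t) (m - k) x + w \<kappa> (\<psi> t) k x * w_dot \<kappa> (\<psi> t) (m - k) x)))"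
      by (rule evolves_add[OF evolves_scale[OF evolves_xderiv[OF IH[OF order_refl]]]
          evolves_scale[OF evolves_mult[OF evolves_cnj[OF \<psi>] w_square_evolves[OF \<psi> IH]]]])
    then show ?thesis
      unfolding 3 w_Suc[OF 3(2)] by (simp add: w_dot_Suc[OF s 3(2), abs_def] cong del: if_cong)
  qed
qed

definition w_flux :: "real \<Rightarrow> (real \<Rightarrow> complex) \<Rightarrow> nat \<Rightarrow> real \<Rightarrow> complex" where
  "w_flux \<kappa> f n = (\<lambda>x. cnj (f x) * w \<kappa> f (Suc n) x + \<i> * (cnj (xderiv f x) * w \<kappa> f n x))"

text \<open>The terms with |f|^2 from the conjugated equation and from \<open>w_dot\<close> cancel.
  In the remaining nonlinear term, \<kappa> cnj f S_n is rewritten by the recursion as w_{n+1} +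
  \<i> w_n'; everything is then an exact x-derivative.\<close>

lemma density_evolves:
  assumes \<psi>: "evolves \<psi> (\<lambda>t. nls_rhs \<kappa> (\<psi> t))" and n: "0 < n"
  shows "evolves (\<lambda>t x. cnj (\<psi> t x) * w \<kappa> (\<psi> t) n x) (\<lambda>t x. - xderiv (w_flux \<kappa> (\<psi> t) n) x)"
proof -
  have s: "smooth (\<psi> t)" for t using evolvesD(1)[OF \<psi>] by (rule tower_smooth)
  have "cnj (nls_rhs \<kappa> f x) * w \<kappa> f n x + cnj (f x) * w_dot \<kappa> f n x = - xderiv (w_flux \<kappa> f n) x"
    if f: "smooth f" for f x
  proof -
    have "xderiv (w_flux \<kappa> f n) x = cnj (xderiv f x) * w \<kappa> f (Suc n) x + cnj (f x) * xderiv (w \<kappa> f (Suc n)) x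
      + \<i> * (cnj (xderiv (xderiv f) x) * w \<kappa> f n x + cnj (xderiv f x) * xderiv (w \<kappa> f n) x)"
      unfolding w_flux_def
      by (simp add: f smooth_intros smooth_w xderiv_add xderiv_cmult xderiv_mult xderiv_cnj del: w.simps)
    moreover have "w \<kappa> f (Suc n) x = - \<i> * xderiv (w \<kappa> f n) x + of_real \<kappa> * (cnj (f x) * w_square \<kappa> f n x)"
      by (simp add: w_Suc[OF n])
    ultimately show ?thesis
      using n by (simp add: w_dot_def nls_rhs_def algebra_simps del: w.simps)
  qed
  from this[OF s] evolves_mult[OF evolves_cnj[OF \<psi>] w_evolves[OF \<psi>, of n]] show ?thesis by simp
qed


section \<open>From the local conservation law to the integral over the line\<close>

lemma tower_lipschitz:
  assumes v: "tower locally_bounded v"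
  obtains C where "C > 0" "\<And>t x y. x \<in> {a..b} \<Longrightarrow> y \<in> {a..b} \<Longrightarrow> cmod (v t x - v t y) \<le> C * \<bar>x - y\<bar>"
proof -
  have "locally_bounded (\<lambda>t. xderiv (v t))" using v[THEN tower_xderiv] by (rule tower_base)
  then obtain C where C: "\<And>t x. x \<in> {a..b} \<Longrightarrow> cmod (xderiv (v t) x) \<le> C" "C > 0"
    by (rule locally_boundedD[of _ a b]) (rule that)
  have "cmod (v t x - v t y) \<le> C * \<bar>x - y\<bar>" if "x \<in> {a..b}" "y \<in> {a..b}" for t x y
    using that C
    by (intro vector_derivative_bound[of "{a..b}" _ "xderiv (v t)"]
        has_vector_derivative_at_within[OF smooth_has_xderiv[OF tower_smooth[OF v]]]) auto
  with C(2) show ?thesis by (rule that)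
qed

text \<open>Continuity in time at each point, combined with a Lipschitz constant in x valid for all
  times, gives joint continuity, as the Leibniz integral rule demands.\<close>

lemma jointly_continuous:
  assumes v: "tower locally_bounded v" and c: "time_continuous v"
  shows "continuous_on ({0..} \<times> {a..b}) (\<lambda>(t, x). v t x)"
proof -
  obtain C where C: "C > 0" "\<And>t x y. x \<in> {a..b} \<Longrightarrow> y \<in> {a..b} \<Longrightarrow> cmod (v t x - v t y) \<le> C * \<bar>x - y\<bar>"
    by (rule tower_lipschitz[OF v]) (rule that)
  have "((\<lambda>p. v (fst p) (snd p)) \<longlongrightarrow> v s y) (at (s, y) within {0..} \<times> {a..b})"
    if sy: "s \<ge> 0" "y \<in> {a..b}" for s y
  proof -
    let ?F = "at (s, y) within {0..} \<times> {a..b}"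
    have 0: "(snd \<longlongrightarrow> y) ?F"
      by (rule tendsto_eq_rhs[OF tendsto_snd[OF tendsto_ident_at]]) simp
    have "continuous_on ({0..} \<times> {a..b}) (\<lambda>p. v (fst p) y)"
      using c by (intro continuous_on_compose2[of "{0..}" "\<lambda>t. v t y", OF _ continuous_on_fst[OF continuous_on_id]])
        (auto simp: time_continuous_def)
    then have 1: "((\<lambda>p. v (fst p) y) \<longlongrightarrow> v s y) ?F"
      using sy by (force simp: continuous_on_def)
    have "((\<lambda>p. C * \<bar>snd p - y\<bar> + cmod (v (fst p) y - v s y)) \<longlongrightarrow> C * \<bar>y - y\<bar> + cmod (v s y - v s y)) ?F"
      by (intro tendsto_add tendsto_mult tendsto_const tendsto_rabs tendsto_norm tendsto_diff 0 1)
    then have 2: "((\<lambda>p. C * \<bar>snd p - y\<bar> + cmod (v (fst p) y - v s y)) \<longlongrightarrow> 0) ?F" by simp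
    have "((\<lambda>p. v (fst p) (snd p) - v s y) \<longlongrightarrow> 0) ?F"
    proof (rule Lim_null_comparison[OF _ 2])
      have "cmod (v t x - v s y) \<le> C * \<bar>x - y\<bar> + cmod (v t y - v s y)" if "x \<in> {a..b}" for t x
        using C(2)[OF that sy(2), of t] norm_triangle_ineq[of "v t x - v t y" "v t y - v s y"] by simp
      then show "\<forall>\<^sub>F p in ?F. cmod (v (fst p) (snd p) - v s y) \<le> C * \<bar>snd p - y\<bar> + cmod (v (fst p) y - v s y)"
        unfolding eventually_at_filter by (intro always_eventually) auto
    qed
    then show ?thesis by (rule LIM_zero_cancel)
  qed
  then show ?thesis by (auto simp: continuous_on_def case_prod_unfold)
qed

lemma integral_parabola_xderiv:
  fixes J :: "real \<Rightarrow> complex"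
  assumes J: "smooth J" and R: "0 < R"
    and C: "integrable lborel J" "(LINT x|lborel. cmod (J x)) \<le> C"
  shows "cmod (integral {-R..R} (\<lambda>x. (1 - (x / R)\<^sup>2) *\<^sub>R xderiv J x)) \<le> 2 / R * C"
proof -
  have "((\<lambda>x. (1 - (x / R)\<^sup>2) *\<^sub>R J x) has_vector_derivative
      ((1 - (x / R)\<^sup>2) *\<^sub>R xderiv J x + (- 2 * x / R\<^sup>2) *\<^sub>R J x)) (at x within {-R..R})" for x
    by (rule has_vector_derivative_scaleR[OF _ has_vector_derivative_at_within[OF smooth_has_xderiv[OF J]]])
      (use R in \<open>auto intro!: derivative_eq_intros simp: power2_eq_square field_simps\<close>)
  from fundamental_theorem_of_calculus[OF _ this]
  have 1: "((\<lambda>x. (1 - (x / R)\<^sup>2) *\<^sub>R xderiv J x + (- 2 * x / R\<^sup>2) *\<^sub>R J x) has_integral 0) {-R..R}"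
    using R by simp
  have 2: "(\<lambda>x. (1 - (x / R)\<^sup>2) *\<^sub>R xderiv J x) integrable_on {-R..R}"
    using R by (intro integrable_continuous_interval continuous_intros smooth_continuous smooth_xderiv J) auto
  have 3: "(\<lambda>x. (- 2 * x / R\<^sup>2) *\<^sub>R J x) integrable_on {-R..R}"
    using R by (intro integrable_continuous_interval continuous_intros smooth_continuous J) auto
  have "integral {-R..R} (\<lambda>x. (1 - (x / R)\<^sup>2) *\<^sub>R xderiv J x) = - integral {-R..R} (\<lambda>x. (- 2 * x / R\<^sup>2) *\<^sub>R J x)"
    using integral_unique[OF 1] integral_add[OF 2 3] by (simp add: eq_neg_iff_add_eq_0)
  also have "cmod \<dots> \<le> integral {-R..R} (\<lambda>x. 2 / R * cmod (J x))"
    unfolding norm_minus_cancel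
  proof (rule integral_norm_bound_integral[OF 3])
    show "(\<lambda>x. 2 / R * cmod (J x)) integrable_on {-R..R}"
      by (intro integrable_continuous_interval continuous_intros smooth_continuous J)
    fix x assume "x \<in> {-R..R}"
    then have "\<bar>x\<bar> / R\<^sup>2 \<le> 1 / R" using R by (auto simp: power2_eq_square field_simps abs_le_iff)
    then have "2 * \<bar>x\<bar> / R\<^sup>2 * cmod (J x) \<le> 2 / R * cmod (J x)" by (intro mult_right_mono) auto
    then show "norm ((- 2 * x / R\<^sup>2) *\<^sub>R J x) \<le> 2 / R * cmod (J x)" using R by (simp add: abs_mult)
  qed
  also have "\<dots> = 2 / R * integral {-R..R} (\<lambda>x. cmod (J x))" by simp
  also have "\<dots> \<le> 2 / R * C"
  proof -
    have "set_integrable lborel {-R..R} (\<lambda>x. cmod (J x))"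
      unfolding set_integrable_def by (rule integrable_mult_indicator[OF _ integrable_norm[OF C(1)]]) simp
    then have "integral {-R..R} (\<lambda>x. cmod (J x)) = (LINT x:{-R..R}|lborel. cmod (J x))"
      by (rule set_borel_integral_eq_integral(2)[symmetric])
    also have "\<dots> \<le> (LINT x|lborel. cmod (J x))"
      unfolding set_lebesgue_integral_def
      by (rule integral_mono[OF integrable_mult_indicator[OF _ integrable_norm[OF C(1)]] integrable_norm[OF C(1)]])
        (auto simp: indicator_def)
    finally show ?thesis using C(2) R by (intro mult_left_mono) auto
  qed
  finally show ?thesis .
qed

text \<open>Dominated convergence with majorant |f|: on their intervals the weights lie between 0
  and 1, and they tend to 1 pointwise.\<close>

lemma integral_parabola_tendsto:
  fixes f :: "real \<Rightarrow> complex"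
  assumes f: "smooth f" "integrable lborel f"
  shows "(\<lambda>n. integral {-real (Suc n)..real (Suc n)} (\<lambda>x. (1 - (x / real (Suc n))\<^sup>2) *\<^sub>R f x))
    \<longlonglongrightarrow> (LINT x|lborel. f x)"
proof -
  define g where "g = (\<lambda>n x. indicator {-real (Suc n)..real (Suc n)} x *\<^sub>R ((1 - (x / real (Suc n))\<^sup>2) *\<^sub>R f x))"
  note [measurable] = smooth_borel[OF f(1)]
  have [measurable]: "g n \<in> borel_measurable lborel" for n unfolding g_def by measurable
  have bnd: "norm (g n x) \<le> norm (f x)" for n x
  proof (cases "\<bar>x\<bar> \<le> real (Suc n)")
    case True
    then have "\<bar>x / real (Suc n)\<bar> \<le> 1" by (simp add: abs_divide del: of_nat_Suc)
    then have "(x / real (Suc n))\<^sup>2 \<le> 1" by (simp only: abs_square_le_1)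
    then have "\<bar>1 - (x / real (Suc n))\<^sup>2\<bar> \<le> 1" by (simp del: of_nat_Suc)
    then have "\<bar>1 - (x / real (Suc n))\<^sup>2\<bar> * norm (f x) \<le> 1 * norm (f x)" by (intro mult_right_mono) auto
    then show ?thesis by (simp add: g_def indicator_def del: of_nat_Suc)
  qed (auto simp: g_def indicator_def)
  have lim: "(\<lambda>n. g n x) \<longlonglongrightarrow> f x" for x
  proof -
    have "(\<lambda>n. (1 - (x * (1 / real (Suc n)))\<^sup>2) *\<^sub>R f x) \<longlonglongrightarrow> (1 - (x * 0)\<^sup>2) *\<^sub>R f x"
      by (intro tendsto_scaleR tendsto_diff tendsto_const tendsto_power tendsto_mult LIMSEQ_Suc[OF lim_1_over_n])
    moreover have "\<forall>\<^sub>F n in sequentially. (1 - (x * (1 / real (Suc n)))\<^sup>2) *\<^sub>R f x = g n x"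
      using eventually_ge_at_top[of "nat \<lceil>\<bar>x\<bar>\<rceil>"]
    proof eventually_elim
      case (elim n)
      then have "\<bar>x\<bar> \<le> real (Suc n)" by linarith
      then show ?case by (simp add: g_def indicator_def abs_le_iff del: of_nat_Suc)
    qed
    ultimately have "(\<lambda>n. g n x) \<longlonglongrightarrow> (1 - (x * 0)\<^sup>2) *\<^sub>R f x" by (rule Lim_transform_eventually)
    then show ?thesis by simp
  qed
  have "(\<lambda>n. LINT x|lborel. g n x) \<longlonglongrightarrow> (LINT x|lborel. f x)"
    by (rule integral_dominated_convergence[where w = "\<lambda>x. norm (f x)"]) (use f bnd lim in auto)
  moreover have "(LINT x|lborel. g n x) = integral {-real (Suc n)..real (Suc n)} (\<lambda>x. (1 - (x / real (Suc n))\<^sup>2) *\<^sub>R f x)" for n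
  proof -
    have "integrable lborel (g n)"
      by (rule Bochner_Integration.integrable_bound[OF f(2)]) (use bnd in auto)
    then have "set_integrable lborel {-real (Suc n)..real (Suc n)} (\<lambda>x. (1 - (x / real (Suc n))\<^sup>2) *\<^sub>R f x)"
      by (simp only: g_def set_integrable_def)
    from set_borel_integral_eq_integral(2)[OF this] show ?thesis
      by (simp only: g_def set_lebesgue_integral_def)
  qed
  ultimately show ?thesis by simp
qed

text \<open>
  The weight \<open>1 - (x / R)\<^sup>2\<close> on \<open>[-R, R]\<close> vanishes at the end points, and its derivative is of
  order \<open>1 / R\<close>; so the weighted integrals are constant in time up to an error of order \<open>1 / R\<close>.
\<close>

lemma integral_conserved:
  assumes \<rho>: "evolves \<rho> (\<lambda>t x. - xderiv (J t) x)" and J: "\<And>t. smooth (J t)"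
    and C: "\<And>t. integrable lborel (J t)" "\<And>t. (LINT x|lborel. cmod (J t x)) \<le> C"
    and int: "\<And>t. integrable lborel (\<rho> t)" and t: "t \<ge> 0"
  shows "(LINT x|lborel. \<rho> t x) = (LINT x|lborel. \<rho> 0 x)"
proof -
  define K where "K = (\<lambda>R t. integral {-R..R} (\<lambda>x. (1 - (x / R)\<^sup>2) *\<^sub>R \<rho> t x))"
  have s: "smooth (\<rho> t)" for t using evolvesD(1)[OF \<rho>] by (rule tower_smooth)
  have bound: "cmod (K R t - K R 0) \<le> 2 / R * C * t" if R: "R > 0" for R
  proof -
    have "(K R has_vector_derivative integral (cbox (-R) R) (\<lambda>x. (1 - (x / R)\<^sup>2) *\<^sub>R (- xderiv (J s) x))) (at s within {0..})"
      if "s \<in> {0..}" for s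
      unfolding K_def interval_cbox
    proof (rule leibniz_rule_vector_derivative)
      show "((\<lambda>t. (1 - (x / R)\<^sup>2) *\<^sub>R \<rho> t x) has_vector_derivative (1 - (x / R)\<^sup>2) *\<^sub>R (- xderiv (J s) x)) (at s within {0..})"
        if "s \<in> {0..}" for s x
        using has_vector_derivative_scaleR[OF DERIV_const evolvesD(5)[OF \<rho>, of s x]] that by simp
      show "(\<lambda>x. (1 - (x / R)\<^sup>2) *\<^sub>R \<rho> s x) integrable_on cbox (- R) R" for s
        unfolding interval_cbox[symmetric] using R
        by (intro integrable_continuous_interval continuous_intros smooth_continuous s) auto
      have "continuous_on ({0..} \<times> {-R..R}) (\<lambda>p. (1 - (snd p / R)\<^sup>2) *\<^sub>R (case p of (t, x) \<Rightarrow> - xderiv (J t) x))"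
        using R by (intro continuous_on_scaleR jointly_continuous[OF evolvesD(2,4)[OF \<rho>]] continuous_intros) auto
      then show "continuous_on ({0..} \<times> cbox (- R) R) (\<lambda>(t, x). (1 - (x / R)\<^sup>2) *\<^sub>R (- xderiv (J t) x))"
        by (simp add: case_prod_unfold)
    qed (use that in auto)
    then have d: "(K R has_vector_derivative - integral {-R..R} (\<lambda>x. (1 - (x / R)\<^sup>2) *\<^sub>R xderiv (J s) x)) (at s within {0..})"
      if "s \<ge> 0" for s using that by simp
    have "norm (K R t - K R 0) \<le> 2 / R * C * \<bar>t - 0\<bar>"
      by (rule vector_derivative_bound[where S = "{0..}", OF _ d])
        (use t integral_parabola_xderiv[OF J R C] in auto)
    with t show ?thesis by simp
  qed
  \<comment> \<open>Now t is fixed and R = n + 1 grows: the drift bound 2 C t / R vanishes, and the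
    weighted integrals tend to the full ones.\<close>
  have "(\<lambda>n. K (real (Suc n)) t - K (real (Suc n)) 0) \<longlonglongrightarrow> (LINT x|lborel. \<rho> t x) - (LINT x|lborel. \<rho> 0 x)"
    unfolding K_def by (intro tendsto_diff integral_parabola_tendsto s int)
  moreover have "(\<lambda>n. K (real (Suc n)) t - K (real (Suc n)) 0) \<longlonglongrightarrow> 0"
  proof (rule Lim_null_comparison)
    show "\<forall>\<^sub>F n in sequentially. norm (K (real (Suc n)) t - K (real (Suc n)) 0) \<le> (2 * C * t) * (1 / real (Suc n))"
    proof (intro always_eventually allI)
      fix n show "norm (K (real (Suc n)) t - K (real (Suc n)) 0) \<le> (2 * C * t) * (1 / real (Suc n))"
        using bound[of "real (Suc n)"] by (simp del: of_nat_Suc)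
    qed
    show "(\<lambda>n. (2 * C * t) * (1 / real (Suc n))) \<longlonglongrightarrow> 0"
      by (rule tendsto_mult_right_zero[OF LIMSEQ_Suc[OF lim_1_over_n]])
  qed
  ultimately have "(LINT x|lborel. \<rho> t x) - (LINT x|lborel. \<rho> 0 x) = 0" by (rule LIMSEQ_unique)
  then show ?thesis by simp
qed

subsection \<open>Positive sesquilinear forms\<close>

text \<open>Two instances are intended: the L2 inner product and the form (f, P g) of a positive
  operator. Both may be degenerate on the set V of honest functions, where null sets are not divided
  out; hence only a seminorm arises.\<close>

locale positive_form =
  fixes V :: "('a \<Rightarrow> complex) set" and \<Phi> :: "('a \<Rightarrow> complex) \<Rightarrow> ('a \<Rightarrow> complex) \<Rightarrow> complex"
  assumes V_add: "f \<in> V \<Longrightarrow> g \<in> V \<Longrightarrow> (\<lambda>x. f x + g x) \<in> V"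
    and V_scale: "f \<in> V \<Longrightarrow> (\<lambda>x. c * f x) \<in> V"
    and add_left: "f \<in> V \<Longrightarrow> g \<in> V \<Longrightarrow> h \<in> V \<Longrightarrow> \<Phi> (\<lambda>x. f x + g x) h = \<Phi> f h + \<Phi> g h"
    and add_right: "f \<in> V \<Longrightarrow> g \<in> V \<Longrightarrow> h \<in> V \<Longrightarrow> \<Phi> h (\<lambda>x. f x + g x) = \<Phi> h f + \<Phi> h g"
    and scale_left: "f \<in> V \<Longrightarrow> h \<in> V \<Longrightarrow> \<Phi> (\<lambda>x. c * f x) h = cnj c * \<Phi> f h"
    and scale_right: "f \<in> V \<Longrightarrow> h \<in> V \<Longrightarrow> \<Phi> h (\<lambda>x. c * f x) = c * \<Phi> h f"
    and nonneg: "f \<in> V \<Longrightarrow> \<Phi> f f \<in> \<real>\<^sub>\<ge>\<^sub>0"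
begin

definition seminorm :: "('a \<Rightarrow> complex) \<Rightarrow> real" where
  "seminorm f = sqrt (Re (\<Phi> f f))"

lemma diag: "f \<in> V \<Longrightarrow> Im (\<Phi> f f) = 0" "f \<in> V \<Longrightarrow> 0 \<le> Re (\<Phi> f f)"
  using nonneg[of f] by (auto simp: complex_nonneg_Reals_iff)

lemma expand:
  assumes "f \<in> V" "g \<in> V"
  shows "\<Phi> (\<lambda>x. f x + c * g x) (\<lambda>x. f x + c * g x)
    = \<Phi> f f + c * \<Phi> f g + cnj c * \<Phi> g f + (cnj c * c) * \<Phi> g g"
  using assms by (simp add: V_add V_scale add_left add_right scale_left scale_right algebra_simps)

text \<open>Polarization: the diagonal value at f + c g is real for c = 1 and for c = \<i>, which
  settles the imaginary and the real part.\<close>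

lemma hermitian:
  assumes "f \<in> V" "g \<in> V" shows "\<Phi> g f = cnj (\<Phi> f g)"
proof (rule complex_eqI)
  have "Im (\<Phi> (\<lambda>x. f x + c * g x) (\<lambda>x. f x + c * g x)) = 0" for c
    using assms by (intro diag V_add V_scale)
  from this[of 1] this[of \<i>] assms show "Re (\<Phi> g f) = Re (cnj (\<Phi> f g))" "Im (\<Phi> g f) = Im (cnj (\<Phi> f g))"
    unfolding expand[OF assms] by (auto simp: diag)
qed

lemma expand_nonneg:
  assumes "f \<in> V" "g \<in> V"
  shows "0 \<le> Re (\<Phi> f f) + 2 * Re (c * \<Phi> f g) + (cmod c)\<^sup>2 * Re (\<Phi> g g)"
proof -
  have "0 \<le> Re (\<Phi> (\<lambda>x. f x + c * g x) (\<lambda>x. f x + c * g x))"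
    using assms by (intro diag V_add V_scale)
  also have "\<dots> = Re (\<Phi> f f) + 2 * Re (c * \<Phi> f g) + (cmod c)\<^sup>2 * Re (\<Phi> g g)"
    unfolding expand[OF assms] hermitian[OF assms] cmod_power2
    using assms by (simp add: diag power2_eq_square)
  finally show ?thesis .
qed

lemma cauchy_schwarz:
  assumes "f \<in> V" "g \<in> V" shows "cmod (\<Phi> f g) \<le> seminorm f * seminorm g"
proof -
  define a b d where "a = Re (\<Phi> f f)" and "b = Re (\<Phi> g g)" and "d = \<Phi> f g"
  have ab: "0 \<le> a" "0 \<le> b" using assms by (auto simp: a_def b_def diag)
  \<comment> \<open>Positivity at f + c g with c = - t times the conjugate of d, so that the mixed
    term is real and negative for t > 0. The optimal choice is t = 1 / b.\<close>
  have *: "0 \<le> a - 2 * t * (cmod d)\<^sup>2 + t\<^sup>2 * (cmod d)\<^sup>2 * b" for t :: real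
  proof -
    have "- (of_real t * cnj d) * d = - of_real (t * (cmod d)\<^sup>2)"
      by (simp only: of_real_mult complex_norm_square) (simp add: mult_ac)
    then have "Re (- (of_real t * cnj d) * d) = - (t * (cmod d)\<^sup>2)"
      by (simp only: uminus_complex.sel Re_complex_of_real)
    moreover have "(cmod (- (of_real t * cnj d)))\<^sup>2 = t\<^sup>2 * (cmod d)\<^sup>2"
      by (simp add: norm_mult power_mult_distrib)
    ultimately show ?thesis
      using expand_nonneg[OF assms, of "- (of_real t * cnj d)"] by (simp add: a_def b_def d_def)
  qed
  have "(cmod d)\<^sup>2 \<le> a * b"
  proof (cases "b = 0")
    case False
    with *[of "1 / b"] ab show ?thesis by (simp add: power2_eq_square field_simps)
  next
    case True
    have "cmod d = 0"
    proof (rule ccontr)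
      \<comment> \<open>With b = 0 the expression is linear in t, and the chosen t makes it a - (a +
        1) = -1.\<close>
      assume "cmod d \<noteq> 0"
      with *[of "(a + 1) / (2 * (cmod d)\<^sup>2)"] True show False by simp
    qed
    with True show ?thesis by simp
  qed
  then have "sqrt ((cmod d)\<^sup>2) \<le> sqrt (a * b)" by (rule real_sqrt_le_mono)
  then show ?thesis by (simp add: seminorm_def a_def b_def d_def real_sqrt_mult)
qed

lemma seminorm_power2: "f \<in> V \<Longrightarrow> (seminorm f)\<^sup>2 = Re (\<Phi> f f)"
  by (simp add: seminorm_def diag)

lemma seminorm_nonneg: "f \<in> V \<Longrightarrow> 0 \<le> seminorm f"
  by (simp add: seminorm_def diag)

lemma seminorm_add:
  assumes "f \<in> V" "g \<in> V" shows "seminorm (\<lambda>x. f x + g x) \<le> seminorm f + seminorm g"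
proof (rule power2_le_imp_le)
  have "Re (\<Phi> f g) \<le> seminorm f * seminorm g"
    using cauchy_schwarz[OF assms] complex_Re_le_cmod order_trans by blast
  moreover have "(seminorm (\<lambda>x. f x + g x))\<^sup>2 = Re (\<Phi> f f) + 2 * Re (\<Phi> f g) + Re (\<Phi> g g)"
    using assms hermitian[OF assms] by (simp add: seminorm_power2 V_add add_left add_right)
  ultimately show "(seminorm (\<lambda>x. f x + g x))\<^sup>2 \<le> (seminorm f + seminorm g)\<^sup>2"
    using assms by (simp add: power2_sum seminorm_power2)
qed (use assms in \<open>simp add: seminorm_nonneg\<close>)

lemma seminorm_scale:
  assumes "f \<in> V" shows "seminorm (\<lambda>x. c * f x) = cmod c * seminorm f"
proof -
  have "\<Phi> (\<lambda>x. c * f x) (\<lambda>x. c * f x) = of_real ((cmod c)\<^sup>2) * \<Phi> f f"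
    using assms by (simp only: scale_left scale_right V_scale complex_norm_square) (simp add: mult_ac)
  then show ?thesis by (simp add: seminorm_def real_sqrt_mult)
qed

lemma V_diff: "f \<in> V \<Longrightarrow> g \<in> V \<Longrightarrow> (\<lambda>x. f x - g x) \<in> V"
  using V_add[OF _ V_scale[of g "-1"], of f] by simp

lemma V_partial_sum: "(\<And>n. e n \<in> V) \<Longrightarrow> f \<in> V \<Longrightarrow> (\<lambda>x. \<Sum>n<(N::nat). c n * e n x) \<in> V"
proof (induction N)
  case 0
  then show ?case using V_scale[of f 0] by simp
next
  case (Suc N)
  then show ?case using V_add[OF Suc.IH[OF Suc.prems] V_scale[OF Suc.prems(1)], of "c N" N] by simp
qed

lemma seminorm_partial_sum:
  assumes e: "\<And>n. e n \<in> V"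
  shows "seminorm (\<lambda>x. \<Sum>n<N. c n * e n x) \<le> (\<Sum>n<(N::nat). cmod (c n) * seminorm (e n))"
proof (induction N)
  case 0
  show ?case using seminorm_scale[OF e, of 0 0] by simp
next
  case (Suc N)
  then show ?case
    using seminorm_add[OF V_partial_sum[of e, OF e e[of 0], where c = c and N = N] V_scale[OF e, of "c N" N]]
    by (simp add: seminorm_scale e)
qed

lemma \<Phi>_partial_sum:
  assumes e: "\<And>n. e n \<in> V" and f: "f \<in> V"
  shows "\<Phi> f (\<lambda>x. \<Sum>n<N. c n * e n x) = (\<Sum>n<(N::nat). c n * \<Phi> f (e n))"
proof (induction N)
  case 0
  show ?case using scale_right[OF f f, of 0] by simp
next
  case (Suc N)
  then show ?case
    by (simp add: add_right[OF V_partial_sum[of e, OF e e[of 0]] V_scale[OF e] f] scale_right e f)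
qed

text \<open>The projections are subtracted one at a time. The vector e N is orthogonal to those
  already removed, so the remainder has the same coefficient against e N as f, and each subtraction
  lowers the squared seminorm by exactly the square of its modulus.\<close>

lemma bessel:
  assumes e: "\<And>n. e n \<in> V" "\<And>m n. \<Phi> (e m) (e n) = (if m = n then 1 else 0)" and f: "f \<in> V"
  shows "(\<Sum>n<(N::nat). (cmod (\<Phi> (e n) f))\<^sup>2) \<le> (seminorm f)\<^sup>2"
proof -
  define r where "r = (\<lambda>N x. f x - (\<Sum>n<N. \<Phi> (e n) f * e n x))"
  have r: "r N \<in> V" for N unfolding r_def by (intro V_diff f V_partial_sum[of e, OF e(1) f])
  have er: "\<Phi> (e N) (r N) = \<Phi> (e N) f" for N
  proof -
    have "\<Phi> (e N) (r N) = \<Phi> (e N) f + \<Phi> (e N) (\<lambda>x. (-1) * (\<Sum>n<N. \<Phi> (e n) f * e n x))"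
      using add_right[OF f V_scale[OF V_partial_sum[of e, OF e(1) f], of "-1"] e(1)] by (simp add: r_def)
    also have "\<Phi> (e N) (\<lambda>x. (-1) * (\<Sum>n<N. \<Phi> (e n) f * e n x)) = - (\<Sum>n<N. \<Phi> (e n) f * \<Phi> (e N) (e n))"
      by (subst scale_right[OF V_partial_sum[of e, OF e(1) f] e(1)], subst \<Phi>_partial_sum[OF e(1) e(1)]) simp
    also have "(\<Sum>n<N. \<Phi> (e n) f * \<Phi> (e N) (e n)) = 0" by (rule sum.neutral) (simp add: e(2))
    finally show ?thesis by simp
  qed
  have "Re (\<Phi> (r N) (r N)) = Re (\<Phi> f f) - (\<Sum>n<N. (cmod (\<Phi> (e n) f))\<^sup>2)"
  proof (induction N)
    case 0
    then show ?case by (simp add: r_def)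
  next
    case (Suc N)
    let ?c = "\<Phi> (e N) f"
    have "r (Suc N) = (\<lambda>x. r N x + (- ?c) * e N x)" by (auto simp: r_def fun_eq_iff)
    then have "\<Phi> (r (Suc N)) (r (Suc N)) = \<Phi> (r N) (r N) - ?c * cnj ?c - cnj ?c * ?c + cnj ?c * ?c"
      using expand[OF r e(1), of N "- ?c" N] hermitian[OF e(1) r, of N N] by (simp add: er e(2))
    also have "\<dots> = \<Phi> (r N) (r N) - of_real ((cmod ?c)\<^sup>2)" by (simp only: complex_norm_square) simp
    finally show ?case using Suc by simp
  qed
  with diag(2)[OF r, of N] f show ?thesis by (simp add: seminorm_power2)
qed

end

subsection \<open>Square integrable functions\<close>

lemma L2_measurable: "f \<in> L2 M \<Longrightarrow> f \<in> borel_measurable M"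
  by (simp add: L2_def)

lemma L2_iff: "f \<in> L2 M \<longleftrightarrow> f \<in> borel_measurable M \<and> integrable M (\<lambda>x. (cmod (f x))\<^sup>2)"
  by (auto simp: L2_def sq_norm_def integrable_iff_bounded)

lemma sq_norm_L2: "f \<in> L2 M \<Longrightarrow> sq_norm M f = ennreal (LINT x|M. (cmod (f x))\<^sup>2)"
  unfolding L2_iff sq_norm_def by (intro nn_integral_eq_integral) auto

lemma L2_add:
  assumes "f \<in> L2 M" "g \<in> L2 M" shows "(\<lambda>x. f x + g x) \<in> L2 M"
proof -
  have [measurable]: "f \<in> borel_measurable M" "g \<in> borel_measurable M"
    using assms by (auto simp: L2_iff)
  have "integrable M (\<lambda>x. 2 * (cmod (f x))\<^sup>2 + 2 * (cmod (g x))\<^sup>2)"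
    using assms by (auto simp: L2_iff)
  then have "integrable M (\<lambda>x. (cmod (f x + g x))\<^sup>2)"
  proof (rule Bochner_Integration.integrable_bound)
    have "(cmod (f x + g x))\<^sup>2 \<le> 2 * (cmod (f x))\<^sup>2 + 2 * (cmod (g x))\<^sup>2" for x
    proof -
      have "(cmod (f x + g x))\<^sup>2 \<le> (cmod (f x) + cmod (g x))\<^sup>2"
        by (intro power_mono norm_triangle_ineq) auto
      also have "\<dots> \<le> 2 * (cmod (f x))\<^sup>2 + 2 * (cmod (g x))\<^sup>2"
        using sum_squares_bound[of "cmod (f x)" "cmod (g x)"] by (simp add: power2_sum)
      finally show ?thesis .
    qed
    then show "AE x in M. norm ((cmod (f x + g x))\<^sup>2) \<le> norm (2 * (cmod (f x))\<^sup>2 + 2 * (cmod (g x))\<^sup>2)"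
      by (auto intro!: AE_I2)
  qed measurable
  then show ?thesis by (simp add: L2_iff)
qed

lemma L2_scale: "f \<in> L2 M \<Longrightarrow> (\<lambda>x. c * f x) \<in> L2 M"
  by (auto simp: L2_iff norm_mult power_mult_distrib)

lemma borel_measurable_cnj [measurable]: "cnj \<in> borel_measurable borel"
  by (intro borel_measurable_continuous_onI continuous_on_cnj continuous_on_id)

lemma L2_cnj: "f \<in> L2 M \<Longrightarrow> (\<lambda>x. cnj (f x)) \<in> L2 M"
  by (auto simp: L2_iff intro: measurable_compose[OF _ borel_measurable_cnj])

lemma L2_mult_integrable:
  assumes "f \<in> L2 M" "g \<in> L2 M" shows "integrable M (\<lambda>x. f x * g x)"
proof -
  have [measurable]: "f \<in> borel_measurable M" "g \<in> borel_measurable M"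
    using assms by (auto simp: L2_iff)
  have "integrable M (\<lambda>x. (cmod (f x))\<^sup>2 + (cmod (g x))\<^sup>2)"
    using assms by (auto simp: L2_iff)
  then show ?thesis
  proof (rule Bochner_Integration.integrable_bound)
    have "cmod (f x) * cmod (g x) \<le> (cmod (f x))\<^sup>2 + (cmod (g x))\<^sup>2" for x
    proof -
      have "2 * (cmod (f x) * cmod (g x)) \<le> (cmod (f x))\<^sup>2 + (cmod (g x))\<^sup>2"
        using sum_squares_bound[of "cmod (f x)" "cmod (g x)"] by simp
      moreover have "0 \<le> cmod (f x) * cmod (g x)" by simp
      ultimately show ?thesis by linarith
    qed
    then show "AE x in M. norm (f x * g x) \<le> norm ((cmod (f x))\<^sup>2 + (cmod (g x))\<^sup>2)"
      by (auto intro!: AE_I2 simp: norm_mult)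
  qed measurable
qed

lemma L2_inner_self: "L2_inner M f f = of_real (LINT x|M. (cmod (f x))\<^sup>2)"
proof -
  have "cnj (f x) * f x = of_real ((cmod (f x))\<^sup>2)" for x
    by (simp only: complex_norm_square mult.commute)
  then have "L2_inner M f f = (LINT x|M. complex_of_real ((cmod (f x))\<^sup>2))"
    by (simp only: L2_inner_def)
  then show ?thesis by (simp only: integral_complex_of_real)
qed

lemma positive_form_L2: "positive_form (L2 M) (L2_inner M)"
proof
  show "L2_inner M f f \<in> \<real>\<^sub>\<ge>\<^sub>0" for f
    by (simp add: L2_inner_self complex_nonneg_Reals_iff)
qed (auto simp: L2_inner_def L2_add L2_scale L2_mult_integrable L2_cnj distrib_left distrib_right mult.assoc mult.left_commute)

lemma L2_inner_cong_AE:
  assumes "f \<in> borel_measurable M" "g \<in> borel_measurable M" "h \<in> borel_measurable M" "AE x in M. f x = g x"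
  shows "L2_inner M h f = L2_inner M h g"
proof -
  note [measurable] = assms(1-3)
  show ?thesis unfolding L2_inner_def by (rule integral_cong_AE) (use assms(4) in auto)
qed


section \<open>Integral operators with square integrable kernels, and the trace norm\<close>

definition integral_op :: "'a measure \<Rightarrow> ('a \<Rightarrow> 'a \<Rightarrow> complex) \<Rightarrow> ('a \<Rightarrow> complex) \<Rightarrow> 'a \<Rightarrow> complex" where
  "integral_op M A f = (\<lambda>x. LINT y|M. A x y * f y)"

lemma ennreal_integral_bound:
  fixes f :: "'a \<Rightarrow> complex"
  shows "ennreal (cmod (LINT x|M. f x)) \<le> (\<integral>\<^sup>+x. ennreal (cmod (f x)) \<partial>M)"
proof (cases "integrable M f")
  case True
  then show ?thesis by (rule integral_norm_bound_ennreal)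
qed (simp add: not_integrable_integral_eq)

lemma L2_cauchy_schwarz_nn:
  assumes "f \<in> borel_measurable M" "g \<in> borel_measurable M"
  shows "ennreal ((cmod (LINT x|M. f x * g x))\<^sup>2) \<le> sq_norm M f * sq_norm M g"
proof -
  note [measurable] = assms
  have "ennreal ((cmod (LINT x|M. f x * g x))\<^sup>2) = (ennreal (cmod (LINT x|M. f x * g x)))\<^sup>2"
    by (simp add: ennreal_power)
  also have "\<dots> \<le> (\<integral>\<^sup>+x. ennreal (cmod (f x)) * ennreal (cmod (g x)) \<partial>M)\<^sup>2"
    using ennreal_integral_bound[of M "\<lambda>x. f x * g x"]
    by (intro power_mono) (simp_all add: norm_mult ennreal_mult)
  also have "\<dots> \<le> (\<integral>\<^sup>+x. (ennreal (cmod (f x)))\<^sup>2 \<partial>M) * (\<integral>\<^sup>+x. (ennreal (cmod (g x)))\<^sup>2 \<partial>M)"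
    by (rule Cauchy_Schwarz_nn_integral) measurable
  finally show ?thesis by (simp add: sq_norm_def ennreal_power)
qed

lemma L2_tensor:
  assumes M: "sigma_finite_measure M" and f: "f \<in> L2 M" and g: "g \<in> L2 M"
  shows "(\<lambda>(x, y). f x * g y) \<in> L2 (M \<Otimes>\<^sub>M M)"
    and "sq_norm (M \<Otimes>\<^sub>M M) (\<lambda>(x, y). f x * g y) = sq_norm M f * sq_norm M g"
proof -
  interpret sigma_finite_measure M by (rule M)
  have [measurable]: "f \<in> borel_measurable M" "g \<in> borel_measurable M"
    using f g by (auto simp: L2_iff)
  show *: "sq_norm (M \<Otimes>\<^sub>M M) (\<lambda>(x, y). f x * g y) = sq_norm M f * sq_norm M g"
    unfolding sq_norm_def
    by (subst nn_integral_fst[symmetric])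
      (auto simp: norm_mult power_mult_distrib ennreal_mult nn_integral_cmult nn_integral_multc)
  have "sq_norm M f * sq_norm M g < \<infinity>"
    using f g by (auto simp: L2_def ennreal_mult_less_top top.not_eq_extremum)
  with * show "(\<lambda>(x, y). f x * g y) \<in> L2 (M \<Otimes>\<^sub>M M)" by (simp add: L2_def)
qed

context
  fixes M :: "'a measure" and A :: "'a \<Rightarrow> 'a \<Rightarrow> complex"
  assumes M: "sigma_finite_measure M" and A: "(\<lambda>(x, y). A x y) \<in> L2 (M \<Otimes>\<^sub>M M)"
begin

interpretation sigma_finite_measure M by (rule M)
interpretation pair_sigma_finite M M by standard

lemma A_measurable [measurable]: "(\<lambda>(x, y). A x y) \<in> borel_measurable (M \<Otimes>\<^sub>M M)"
  using A by (rule L2_measurable)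

text \<open>The form (f, A g) is the pairing of the kernel with a tensor product, both of them
  square integrable on the product space. Linearity, the adjoint and the norm bound are all read off
  this double integral.\<close>

lemma integral_op_bilinear:
  assumes f: "f \<in> L2 M" and g: "g \<in> L2 M"
  shows "integrable (M \<Otimes>\<^sub>M M) (\<lambda>(x, y). A x y * (cnj (f x) * g y))"
    and "L2_inner M f (integral_op M A g) = integral\<^sup>L (M \<Otimes>\<^sub>M M) (\<lambda>(x, y). A x y * (cnj (f x) * g y))"
proof -
  show i: "integrable (M \<Otimes>\<^sub>M M) (\<lambda>(x, y). A x y * (cnj (f x) * g y))"
    using L2_mult_integrable[OF A L2_tensor(1)[OF M L2_cnj[OF f] g]] by (simp add: case_prod_unfold)
  have "integral\<^sup>L (M \<Otimes>\<^sub>M M) (\<lambda>(x, y). A x y * (cnj (f x) * g y)) = (LINT x|M. LINT y|M. A x y * (cnj (f x) * g y))"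
    using integral_fst'[OF i] by simp
  also have "\<dots> = (LINT x|M. LINT y|M. cnj (f x) * (A x y * g y))"
    by (simp add: mult.left_commute)
  finally show "L2_inner M f (integral_op M A g) = integral\<^sup>L (M \<Otimes>\<^sub>M M) (\<lambda>(x, y). A x y * (cnj (f x) * g y))"
    by (simp add: L2_inner_def integral_op_def)
qed

text \<open>The operator norm is at most the Hilbert-Schmidt norm: Cauchy-Schwarz on the product
  space, in squared form.\<close>

lemma integral_op_bound:
  assumes f: "f \<in> L2 M" and g: "g \<in> L2 M"
  shows "(cmod (L2_inner M f (integral_op M A g)))\<^sup>2
    \<le> (LINT z|(M \<Otimes>\<^sub>M M). (cmod (case z of (x, y) \<Rightarrow> A x y))\<^sup>2) * ((LINT x|M. (cmod (f x))\<^sup>2) * (LINT x|M. (cmod (g x))\<^sup>2))"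
proof -
  note t = L2_tensor[OF M L2_cnj[OF f] g]
  have "ennreal ((cmod (L2_inner M f (integral_op M A g)))\<^sup>2)
      \<le> sq_norm (M \<Otimes>\<^sub>M M) (\<lambda>(x, y). A x y) * sq_norm (M \<Otimes>\<^sub>M M) (\<lambda>(x, y). cnj (f x) * g y)"
    unfolding integral_op_bilinear(2)[OF f g]
    using L2_cauchy_schwarz_nn[OF L2_measurable[OF A] L2_measurable[OF t(1)]]
    by (simp add: case_prod_unfold)
  also have "\<dots> = ennreal ((LINT z|(M \<Otimes>\<^sub>M M). (cmod (case z of (x, y) \<Rightarrow> A x y))\<^sup>2) *
      ((LINT x|M. (cmod (f x))\<^sup>2) * (LINT x|M. (cmod (g x))\<^sup>2)))"
    unfolding t(2) sq_norm_L2[OF A] sq_norm_L2[OF L2_cnj[OF f]] sq_norm_L2[OF g]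
    by (simp add: ennreal_mult)
  finally show ?thesis by (simp add: zero_le_mult_iff)
qed

lemma integral_op_L2:
  assumes g: "g \<in> L2 M" shows "integral_op M A g \<in> L2 M"
proof -
  have [measurable]: "g \<in> borel_measurable M" using g by (rule L2_measurable)
  have m: "integral_op M A g \<in> borel_measurable M"
    unfolding integral_op_def by measurable
  have "sq_norm M (integral_op M A g) \<le> (\<integral>\<^sup>+x. sq_norm M (A x) * sq_norm M g \<partial>M)"
    unfolding sq_norm_def[of M "integral_op M A g"]
  proof (rule nn_integral_mono)
    fix x assume [measurable]: "x \<in> space M"
    have [measurable]: "A x \<in> borel_measurable M" using measurable_Pair2[OF A_measurable] by simp
    show "ennreal ((cmod (integral_op M A g x))\<^sup>2) \<le> sq_norm M (A x) * sq_norm M g"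
      unfolding integral_op_def by (rule L2_cauchy_schwarz_nn) measurable
  qed
  also have "\<dots> = (\<integral>\<^sup>+x. sq_norm M (A x) \<partial>M) * sq_norm M g"
    unfolding sq_norm_def by (rule nn_integral_multc) measurable
  also have "(\<integral>\<^sup>+x. sq_norm M (A x) \<partial>M) = sq_norm (M \<Otimes>\<^sub>M M) (\<lambda>(x, y). A x y)"
  proof -
    have "(\<lambda>z. ennreal ((cmod (case z of (x, y) \<Rightarrow> A x y))\<^sup>2)) \<in> borel_measurable (M \<Otimes>\<^sub>M M)"
      by measurable
    from sigma_finite_measure.nn_integral_fst[OF M this] show ?thesis by (simp add: sq_norm_def)
  qed
  also have "sq_norm (M \<Otimes>\<^sub>M M) (\<lambda>(x, y). A x y) * sq_norm M g < \<infinity>"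
    using A g by (auto simp: L2_def ennreal_mult_less_top top.not_eq_extremum)
  finally show ?thesis using m by (simp add: L2_def)
qed

lemma adjoint_L2: "(\<lambda>(x, y). cnj (A y x)) \<in> L2 (M \<Otimes>\<^sub>M M)"
proof -
  have "integrable (M \<Otimes>\<^sub>M M) (\<lambda>(x, y). (cmod (case (x, y) of (x, y) \<Rightarrow> A x y))\<^sup>2)"
    using A by (simp add: L2_iff case_prod_unfold)
  from integrable_product_swap[OF this]
  have "integrable (M \<Otimes>\<^sub>M M) (\<lambda>z. (cmod (case z of (x, y) \<Rightarrow> cnj (A y x)))\<^sup>2)"
    by (simp add: case_prod_unfold)
  moreover have "(\<lambda>(x, y). cnj (A y x)) \<in> borel_measurable (M \<Otimes>\<^sub>M M)"
    using measurable_compose[OF measurable_pair_swap'[of M M] A_measurable]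
    by (auto simp: case_prod_unfold intro: measurable_compose[OF _ borel_measurable_cnj])
  ultimately show ?thesis by (simp add: L2_iff)
qed

end

lemma integral_op_adjoint:
  assumes M: "sigma_finite_measure M" and A: "(\<lambda>(x, y). A x y) \<in> L2 (M \<Otimes>\<^sub>M M)"
    and f: "f \<in> L2 M" and g: "g \<in> L2 M"
  shows "L2_inner M f (integral_op M (\<lambda>x y. cnj (A y x)) g) = cnj (L2_inner M g (integral_op M A f))"
proof -
  interpret sigma_finite_measure M by (rule M)
  interpret pair_sigma_finite M M by standard
  have "L2_inner M f (integral_op M (\<lambda>x y. cnj (A y x)) g)
      = integral\<^sup>L (M \<Otimes>\<^sub>M M) (\<lambda>(x, y). cnj (A y x) * (cnj (f x) * g y))"
    by (rule integral_op_bilinear(2)[OF M adjoint_L2[OF M A] f g])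
  also have "\<dots> = integral\<^sup>L (M \<Otimes>\<^sub>M M) (\<lambda>(x, y). cnj (A x y * (cnj (g x) * f y)))"
    using integral_product_swap[OF measurable_compose[OF
          borel_measurable_integrable[OF integral_op_bilinear(1)[OF M A g f]] borel_measurable_cnj]]
    by (simp add: case_prod_unfold mult_ac)
  also have "\<dots> = cnj (integral\<^sup>L (M \<Otimes>\<^sub>M M) (\<lambda>(x, y). A x y * (cnj (g x) * f y)))"
    using Bochner_Integration.integral_cnj[of "M \<Otimes>\<^sub>M M" "\<lambda>(x, y). A x y * (cnj (g x) * f y)"]
    by (simp only: case_prod_unfold)
  finally show ?thesis by (simp only: integral_op_bilinear(2)[OF M A g f])
qed

lemma positive_form_integral_op:
  assumes M: "sigma_finite_measure M" and A: "(\<lambda>(x, y). A x y) \<in> L2 (M \<Otimes>\<^sub>M M)"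
    and pos: "\<And>f. f \<in> L2 M \<Longrightarrow> L2_inner M f (integral_op M A f) \<in> \<real>\<^sub>\<ge>\<^sub>0"
  shows "positive_form (L2 M) (\<lambda>f g. L2_inner M f (integral_op M A g))"
proof
  note b = integral_op_bilinear[OF M A]
  fix f g h assume f: "f \<in> L2 M" and h: "h \<in> L2 M"
  note i = b(1)[OF f h] b(1)[OF h f]
  show "L2_inner M (\<lambda>x. c * f x) (integral_op M A h) = cnj c * L2_inner M f (integral_op M A h)"
      "L2_inner M h (integral_op M A (\<lambda>x. c * f x)) = c * L2_inner M h (integral_op M A f)" for c
    using integral_mult_right_zero[of "M \<Otimes>\<^sub>M M" "cnj c" "\<lambda>(x, y). A x y * (cnj (f x) * h y)"]
      integral_mult_right_zero[of "M \<Otimes>\<^sub>M M" c "\<lambda>(x, y). A x y * (cnj (h x) * f y)"]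
    by (simp_all add: b(2) f h L2_scale case_prod_unfold mult_ac)
  assume g: "g \<in> L2 M"
  show "L2_inner M (\<lambda>x. f x + g x) (integral_op M A h)
      = L2_inner M f (integral_op M A h) + L2_inner M g (integral_op M A h)"
    "L2_inner M h (integral_op M A (\<lambda>x. f x + g x))
      = L2_inner M h (integral_op M A f) + L2_inner M h (integral_op M A g)"
    using Bochner_Integration.integral_add[OF i(1) b(1)[OF g h]] Bochner_Integration.integral_add[OF i(2) b(1)[OF h g]]
    by (simp_all add: b(2) f g h L2_add case_prod_unfold algebra_simps)
qed (use pos L2_add L2_scale in auto)

text \<open>A positive operator is bounded by its trace. On a partial sum of the expansion of f the
  triangle inequality for the seminorm of P, the Cauchy-Schwarz inequality for sums and Bessel's
  inequality give T times the squared norm of f. It remains to pass to the limit.\<close>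

lemma trace_bounds_form:
  assumes M: "sigma_finite_measure M" and P: "(\<lambda>(x, y). P x y) \<in> L2 (M \<Otimes>\<^sub>M M)"
    and pos: "\<And>f. f \<in> L2 M \<Longrightarrow> L2_inner M f (integral_op M P f) \<in> \<real>\<^sub>\<ge>\<^sub>0"
    and e: "hilbert_basis M e"
    and tr: "(\<Sum>n. ennreal (Re (L2_inner M (e n) (integral_op M P (e n))))) \<le> ennreal T" and T: "0 \<le> T"
    and f: "f \<in> L2 M"
  shows "Re (L2_inner M f (integral_op M P f)) \<le> T * (LINT x|M. (cmod (f x))\<^sup>2)"
proof -
  interpret I: positive_form "L2 M" "L2_inner M" by (rule positive_form_L2)
  interpret B: positive_form "L2 M" "\<lambda>f g. L2_inner M f (integral_op M P g)"
    by (rule positive_form_integral_op[OF M P pos])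
  define c where "c = (\<lambda>n. L2_inner M (e n) f)"
  define p where "p = (\<lambda>N x. \<Sum>n<N. c n * e n x)"
  have eV: "e n \<in> L2 M" and eo: "L2_inner M (e m) (e n) = (if m = n then 1 else 0)" for m n
    using e by (auto simp: hilbert_basis_def)
  have pV: "p N \<in> L2 M" for N unfolding p_def by (rule I.V_partial_sum[of e, OF eV f])
  define F where "F = (LINT x|M. (cmod (f x))\<^sup>2)"
  have F: "(I.seminorm f)\<^sup>2 = F" using f by (simp add: I.seminorm_power2 L2_inner_self F_def)
  have F0: "0 \<le> F" by (simp flip: F)
  have partial: "(B.seminorm (p N))\<^sup>2 \<le> T * F" for N
  proof -
    have "(B.seminorm (p N))\<^sup>2 \<le> (\<Sum>n<N. cmod (c n) * B.seminorm (e n))\<^sup>2"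
      unfolding p_def using pV[of N]
      by (intro power_mono B.seminorm_partial_sum eV B.seminorm_nonneg) (auto simp: p_def)
    also have "\<dots> \<le> (\<Sum>n<N. (cmod (c n))\<^sup>2) * (\<Sum>n<N. (B.seminorm (e n))\<^sup>2)"
      by (rule Cauchy_Schwarz_ineq_sum)
    also have "\<dots> \<le> F * T"
    proof (rule mult_mono)
      show "(\<Sum>n<N. (cmod (c n))\<^sup>2) \<le> F"
        unfolding c_def F[symmetric] by (rule I.bessel[OF eV eo f])
      have "ennreal (\<Sum>n<N. (B.seminorm (e n))\<^sup>2) = (\<Sum>n<N. ennreal (Re (L2_inner M (e n) (integral_op M P (e n)))))"
        by (simp add: B.seminorm_power2[OF eV] B.diag(2)[OF eV] sum_ennreal)
      also have "\<dots> \<le> ennreal T"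
        by (rule order_trans[OF sum_le_suminf tr]) auto
      finally show "(\<Sum>n<N. (B.seminorm (e n))\<^sup>2) \<le> T" using T by (simp add: ennreal_le_iff)
    qed (use F0 in \<open>auto intro: sum_nonneg\<close>)
    finally show ?thesis by (simp add: mult.commute)
  qed
  define K where "K = (LINT z|(M \<Otimes>\<^sub>M M). (cmod (case z of (x, y) \<Rightarrow> P x y))\<^sup>2)"
  define r where "r = (\<lambda>N x. f x - p N x)"
  have rV: "r N \<in> L2 M" for N unfolding r_def by (rule I.V_diff[OF f pV])
  have "(\<lambda>N. sq_norm M (r N)) \<longlonglongrightarrow> 0"
    using e f by (simp add: hilbert_basis_def r_def p_def c_def)
  then have n2: "(\<lambda>N. LINT x|M. (cmod (r N x))\<^sup>2) \<longlonglongrightarrow> 0"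
    by (subst (asm) sq_norm_L2[OF rV]) (auto simp: ennreal_tendsto_0_iff)
  \<comment> \<open>The form of P is bounded by the Hilbert-Schmidt norm sqrt K, so convergence of
    the expansion in L2 implies convergence in the seminorm of P.\<close>
  have small: "(B.seminorm (r N))\<^sup>2 \<le> sqrt K * (LINT x|M. (cmod (r N x))\<^sup>2)" for N
  proof -
    have "(cmod (L2_inner M (r N) (integral_op M P (r N))))\<^sup>2 \<le> K * (LINT x|M. (cmod (r N x))\<^sup>2)\<^sup>2"
      using integral_op_bound[OF M P rV rV, of N N] by (simp add: K_def power2_eq_square)
    then have "cmod (L2_inner M (r N) (integral_op M P (r N))) \<le> sqrt (K * (LINT x|M. (cmod (r N x))\<^sup>2)\<^sup>2)"
      by (simp add: real_le_rsqrt)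
    then show ?thesis
      using complex_Re_le_cmod[of "L2_inner M (r N) (integral_op M P (r N))"]
      by (simp add: B.seminorm_power2[OF rV] real_sqrt_mult)
  qed
  have "(\<lambda>N. B.seminorm (r N)) \<longlonglongrightarrow> 0"
  proof (rule Lim_null_comparison)
    show "\<forall>\<^sub>F N in sequentially. norm (B.seminorm (r N)) \<le> sqrt (sqrt K * (LINT x|M. (cmod (r N x))\<^sup>2))"
      using small by (intro always_eventually allI) (simp add: real_le_rsqrt B.seminorm_nonneg[OF rV])
    show "(\<lambda>N. sqrt (sqrt K * (LINT x|M. (cmod (r N x))\<^sup>2))) \<longlonglongrightarrow> 0"
      using tendsto_real_sqrt[OF tendsto_mult[OF tendsto_const[of "sqrt K"] n2]] by simp
  qed
  then have "(\<lambda>N. sqrt (T * F) + B.seminorm (r N)) \<longlonglongrightarrow> sqrt (T * F) + 0"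
    by (intro tendsto_add tendsto_const)
  moreover have "B.seminorm f \<le> sqrt (T * F) + B.seminorm (r N)" for N
  proof -
    have "B.seminorm f \<le> B.seminorm (p N) + B.seminorm (r N)"
      using B.seminorm_add[OF pV rV, of N N] by (simp add: r_def)
    moreover have "B.seminorm (p N) \<le> sqrt (T * F)" using partial by (rule real_le_rsqrt)
    ultimately show ?thesis by simp
  qed
  ultimately have "B.seminorm f \<le> sqrt (T * F)"
    by (auto intro: LIMSEQ_le_const)
  then have "(B.seminorm f)\<^sup>2 \<le> (sqrt (T * F))\<^sup>2"
    by (rule power_mono) (rule B.seminorm_nonneg[OF f])
  then show ?thesis
    using T F0 by (simp add: B.seminorm_power2[OF f] F_def)
qed

text \<open>With P in the role of the absolute value of A, the vectors A f and P f have the same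
  norm, and P \<le> T gives |P f| \<le> T |f|. The claim follows by Cauchy-Schwarz.\<close>

lemma absolute_value_bound:
  assumes M: "sigma_finite_measure M" and A: "(\<lambda>(x, y). A x y) \<in> L2 (M \<Otimes>\<^sub>M M)"
    and P: "(\<lambda>(x, y). P x y) \<in> L2 (M \<Otimes>\<^sub>M M)"
    and pos: "\<And>f. f \<in> L2 M \<Longrightarrow> L2_inner M f (integral_op M P f) \<in> \<real>\<^sub>\<ge>\<^sub>0"
    and sqr: "\<And>f. f \<in> L2 M \<Longrightarrow> AE x in M. integral_op M P (integral_op M P f) x
          = integral_op M (\<lambda>x y. cnj (A y x)) (integral_op M A f) x"
    and bound: "\<And>f. f \<in> L2 M \<Longrightarrow> Re (L2_inner M f (integral_op M P f)) \<le> T * (LINT x|M. (cmod (f x))\<^sup>2)"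
    and T: "0 < T" and f: "f \<in> L2 M"
  shows "cmod (L2_inner M f (integral_op M A f)) \<le> T * (LINT x|M. (cmod (f x))\<^sup>2)"
proof -
  interpret I: positive_form "L2 M" "L2_inner M" by (rule positive_form_L2)
  interpret B: positive_form "L2 M" "\<lambda>f g. L2_inner M f (integral_op M P g)"
    by (rule positive_form_integral_op[OF M P pos])
  define n2 where "n2 = (\<lambda>g. LINT x|M. (cmod (g x))\<^sup>2)"
  let ?g = "integral_op M P f" and ?h = "integral_op M A f"
  have g: "?g \<in> L2 M" by (rule integral_op_L2[OF M P f])
  have h: "?h \<in> L2 M" by (rule integral_op_L2[OF M A f])
  \<comment> \<open>Symmetry of P moves one factor P to the right, where P^2 is replaced by A* A.
    This identity is known almost everywhere, which is enough inside an inner product.\<close>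
  have "of_real (n2 ?g) = L2_inner M f (integral_op M P ?g)"
    using B.hermitian[OF g f] by (simp add: L2_inner_self n2_def)
  also have "\<dots> = L2_inner M f (integral_op M (\<lambda>x y. cnj (A y x)) ?h)"
    by (rule L2_inner_cong_AE[OF L2_measurable[OF integral_op_L2[OF M P g]]
        L2_measurable[OF integral_op_L2[OF M adjoint_L2[OF M A] h]] L2_measurable[OF f] sqr[OF f]])
  also have "\<dots> = of_real (n2 ?h)"
    by (simp add: integral_op_adjoint[OF M A f h] L2_inner_self n2_def)
  finally have gh: "n2 ?g = n2 ?h" by (simp only: of_real_eq_iff)
  \<comment> \<open>Positivity of P at f - (1/T) P f. Estimating the two diagonal terms by the bound
    T leaves 0 \<le> T |f|^2 - |P f|^2 / T.\<close>
  have "0 \<le> Re (L2_inner M f (integral_op M P f)) + 2 * Re (of_real (- 1 / T) * L2_inner M f (integral_op M P ?g))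
      + (cmod (of_real (- 1 / T)))\<^sup>2 * Re (L2_inner M ?g (integral_op M P ?g))"
    by (rule B.expand_nonneg[OF f g])
  also have "L2_inner M f (integral_op M P ?g) = of_real (n2 ?g)"
    using B.hermitian[OF g f] by (simp add: L2_inner_self n2_def)
  also have "Re (L2_inner M f (integral_op M P f)) + 2 * Re (of_real (- 1 / T) * complex_of_real (n2 ?g))
      + (cmod (of_real (- 1 / T)))\<^sup>2 * Re (L2_inner M ?g (integral_op M P ?g))
      \<le> T * n2 f + 2 * Re (of_real (- 1 / T) * complex_of_real (n2 ?g)) + (cmod (of_real (- 1 / T)))\<^sup>2 * (T * n2 ?g)"
    unfolding n2_def by (intro add_mono mult_left_mono bound f g order_refl) auto
  also have "\<dots> = T * n2 f - n2 ?g / T"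
    using T by (simp add: norm_divide power2_eq_square field_simps)
  finally have "n2 ?h \<le> T\<^sup>2 * n2 f"
    using T by (simp add: gh power2_eq_square field_simps)
  then have "I.seminorm ?h \<le> T * I.seminorm f"
    using T by (simp add: I.seminorm_def L2_inner_self n2_def real_sqrt_mult real_le_lsqrt
        flip: real_sqrt_abs2) (metis abs_of_pos power2_eq_square real_sqrt_abs real_sqrt_le_iff real_sqrt_mult)
  then have "I.seminorm f * I.seminorm ?h \<le> I.seminorm f * (T * I.seminorm f)"
    by (intro mult_left_mono I.seminorm_nonneg f)
  moreover have "I.seminorm f * (T * I.seminorm f) = T * (I.seminorm f)\<^sup>2"
    by (simp add: power2_eq_square)
  ultimately show ?thesis
    using I.cauchy_schwarz[OF f h] f by (simp add: I.seminorm_power2 L2_inner_self)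
qed

lemma sigma_finite_lebk: "sigma_finite_measure (lebk k)"
proof -
  interpret finite_product_sigma_finite "\<lambda>_. lborel" "{1..k}" by standard auto
  show ?thesis unfolding lebk_def by (rule sigma_finite_measure_axioms)
qed

lemma kernel_op_eq: "kernel_op k A = integral_op (lebk k) A"
  by (simp add: kernel_op_def integral_op_def fun_eq_iff)

text \<open>Being strictly above an infimum, T admits a particular absolute value and a particular
  Hilbert basis with trace below T; the two preceding estimates apply to this pair.\<close>

lemma trace_norm_bound:
  assumes A: "L2_kernel k A" and tr: "trace_norm k A < ennreal T" and f: "f \<in> L2 (lebk k)"
  shows "cmod (L2_inner (lebk k) f (kernel_op k A f)) \<le> T * (LINT x|lebk k. (cmod (f x))\<^sup>2)"
proof -
  from tr obtain P e where P: "is_abs k A P" and e: "hilbert_basis (lebk k) e"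
    and t: "(\<Sum>n. ennreal (Re (L2_inner (lebk k) (e n) (kernel_op k P (e n))))) < ennreal T"
    by (auto simp: trace_norm_def INF_less_iff)
  have T: "0 < T" using t by (metis ennreal_neg not_less_zero not_le)
  show ?thesis
    using A P unfolding kernel_op_eq
    by (intro absolute_value_bound[OF sigma_finite_lebk _ _ _ _ trace_bounds_form[OF sigma_finite_lebk _ _ e] T f, where P = P])
      (use t T in \<open>auto simp: is_abs_def L2_kernel_def kernel_op_eq adjoint_kernel_def less_imp_le\<close>)
qed

subsection \<open>Fourier inversion for cut-off smooth functions\<close>

lemma DERIV_pos_part_power:
  assumes "0 < k"
  shows "((\<lambda>p::real. max 0 p ^ Suc k) has_real_derivative real (Suc k) * max 0 p ^ k) (at p)"
proof -
  consider "p > 0" | "p < 0" | "p = 0" by linarith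
  then show ?thesis
  proof cases
    case 1
    have "((\<lambda>p::real. p ^ Suc k) has_real_derivative real (Suc k) * max 0 p ^ k) (at p)"
      using 1 DERIV_pow[of "Suc k" p] by simp
    then show ?thesis
      by (rule has_field_derivative_transform_within_open[of _ _ _ "{0<..}"]) (use 1 in auto)
  next
    case 2
    have "((\<lambda>p::real. 0) has_real_derivative real (Suc k) * max 0 p ^ k) (at p)"
      using 2 assms by (auto intro!: derivative_eq_intros)
    then show ?thesis
      by (rule has_field_derivative_transform_within_open[of _ _ _ "{..<0}"]) (use 2 in auto)
  next
    \<comment> \<open>At the kink the difference quotient is the function \<open>max 0 z ^ k\<close>
      itself; it is continuous, and it vanishes at 0 because k is positive. This is Caratheodory's
      form of the derivative.\<close>
    case 3
    have "isCont (\<lambda>z::real. max 0 z ^ k) p" by (intro continuous_intros)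
    moreover have "max 0 z ^ Suc k - max 0 p ^ Suc k = max 0 z ^ k * (z - p)" for z :: real
      using 3 assms by (cases "z \<ge> 0") auto
    ultimately show ?thesis
      unfolding CARAT_DERIV using 3 assms by (intro exI[of _ "\<lambda>z. max 0 z ^ k"]) auto
  qed
qed

definition cutoff :: "real \<Rightarrow> nat \<Rightarrow> real \<Rightarrow> real" where
  "cutoff R k x = max 0 (1 - (x / R)\<^sup>2) ^ k"

text \<open>
  Functions of compact support and of limited smoothness: the index \<open>k\<close> drops by one under
  \<open>xderiv\<close>, so that one can stay with polynomial cut-off functions.
\<close>

definition cut_smooth :: "real \<Rightarrow> nat \<Rightarrow> (real \<Rightarrow> complex) set" where
  "cut_smooth R k = {f. \<exists>u. smooth u \<and> f = (\<lambda>x. of_real (cutoff R k x) * u x)}"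

lemma cut_smoothI: "smooth u \<Longrightarrow> (\<lambda>x. of_real (cutoff R k x) * u x) \<in> cut_smooth R k"
  by (auto simp: cut_smooth_def)

lemma cutoff_Suc: "0 < k \<Longrightarrow> cutoff R (Suc k) x = cutoff R k x * (1 - (x / R)\<^sup>2)"
  by (cases "1 - (x / R)\<^sup>2 \<ge> 0") (auto simp: cutoff_def mult.commute)

lemma cut_smooth_xderiv:
  assumes f: "f \<in> cut_smooth R (Suc k)" and k: "0 < k"
  shows "xderiv f \<in> cut_smooth R k" "(f has_vector_derivative xderiv f x) (at x)"
proof -
  obtain u where u: "smooth u" "f = (\<lambda>x. of_real (cutoff R (Suc k) x) * u x)"
    using f by (auto simp: cut_smooth_def)
  \<comment> \<open>Differentiating the power of the cut-off lowers its exponent by one, and the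
    other term of the product rule can spare one factor 1 - (x/R)^2. So \<open>cutoff R k\<close>
    splits off, and v is what remains.\<close>
  define v where "v = (\<lambda>x. of_real (real (Suc k) * (-2 * x / R\<^sup>2)) * u x + of_real (1 - (x / R)\<^sup>2) * xderiv u x)"
  have der: "(f has_vector_derivative of_real (cutoff R k x) * v x) (at x)" for x
  proof -
    have "((\<lambda>x. 1 - (x / R)\<^sup>2) has_real_derivative - (2 * x / R\<^sup>2)) (at x)"
      unfolding divide_inverse by (auto intro!: derivative_eq_intros simp: power2_eq_square)
    then have "(cutoff R (Suc k) has_real_derivative real (Suc k) * cutoff R k x * - (2 * x / R\<^sup>2)) (at x)"
      unfolding cutoff_def by (rule DERIV_chain2[OF DERIV_pos_part_power[OF k]])
    then have "((\<lambda>x. complex_of_real (cutoff R (Suc k) x)) has_vector_derivative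
        of_real (real (Suc k) * cutoff R k x * - (2 * x / R\<^sup>2))) (at x)"
      by (rule has_vector_derivative_of_real)
    from has_vector_derivative_mult[OF this smooth_has_xderiv[OF u(1)]]
    show ?thesis
      unfolding u(2) by (rule has_vector_derivative_eq_rhs) (simp add: v_def cutoff_Suc[OF k] algebra_simps add_divide_distrib)
  qed
  have "smooth v"
  proof -
    have "v = (\<lambda>x. (of_real (real (Suc k) * (-2 / R\<^sup>2)) * of_real x) * u x + (1 - of_real (1 / R\<^sup>2) * of_real x ^ 2) * xderiv u x)"
      by (auto simp: v_def fun_eq_iff power_divide)
    then show ?thesis by (simp only:) (intro smooth_intros u(1))
  qed
  with xderiv_eqI[OF der] show "xderiv f \<in> cut_smooth R k" by (auto simp: cut_smooth_def)
  show "(f has_vector_derivative xderiv f x) (at x)" using der by (simp add: xderiv_eqI[OF der])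
qed

lemma cut_smooth_mult: "f \<in> cut_smooth R k \<Longrightarrow> smooth g \<Longrightarrow> (\<lambda>x. g x * f x) \<in> cut_smooth R k"
proof -
  assume "f \<in> cut_smooth R k" and g: "smooth g"
  then obtain u where u: "smooth u" "f = (\<lambda>x. of_real (cutoff R k x) * u x)"
    by (auto simp: cut_smooth_def)
  then have "(\<lambda>x. g x * f x) = (\<lambda>x. of_real (cutoff R k x) * (g x * u x))" by auto
  then show ?thesis using cut_smoothI[OF smooth_mult[OF g u(1)]] by simp
qed

lemma cut_smooth_diff: "f \<in> cut_smooth R k \<Longrightarrow> g \<in> cut_smooth R k \<Longrightarrow> (\<lambda>x. f x - g x) \<in> cut_smooth R k"
proof -
  assume "f \<in> cut_smooth R k" "g \<in> cut_smooth R k"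
  then obtain u v where u: "smooth u" "f = (\<lambda>x. of_real (cutoff R k x) * u x)"
    and v: "smooth v" "g = (\<lambda>x. of_real (cutoff R k x) * v x)"
    by (auto simp: cut_smooth_def)
  then have "(\<lambda>x. f x - g x) = (\<lambda>x. of_real (cutoff R k x) * (u x - v x))"
    by (auto simp: right_diff_distrib)
  then show ?thesis using cut_smoothI[OF smooth_diff[OF u(1) v(1)]] by simp
qed

lemma cut_smooth_cnj: "f \<in> cut_smooth R k \<Longrightarrow> (\<lambda>x. cnj (f x)) \<in> cut_smooth R k"
proof -
  assume "f \<in> cut_smooth R k"
  then obtain u where u: "smooth u" "f = (\<lambda>x. of_real (cutoff R k x) * u x)"
    by (auto simp: cut_smooth_def)
  then have "(\<lambda>x. cnj (f x)) = (\<lambda>x. of_real (cutoff R k x) * cnj (u x))" by auto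
  then show ?thesis using cut_smoothI[OF smooth_cnj[OF u(1)]] by simp
qed

text \<open>Surplus factors 1 - (x/R)^2 are absorbed into the smooth function. The remaining
  exponent must stay positive, for otherwise nothing would cut off outside the interval.\<close>

lemma cut_smooth_mono:
  assumes "f \<in> cut_smooth R (k + n)" "0 < k" shows "f \<in> cut_smooth R k"
  using assms(1)
proof (induction n arbitrary: f)
  case (Suc n)
  then obtain u where u: "smooth u" "f = (\<lambda>x. of_real (cutoff R (Suc (k + n)) x) * u x)"
    by (auto simp: cut_smooth_def)
  have "f = (\<lambda>x. of_real (cutoff R (k + n) x) * ((1 - of_real (1 / R\<^sup>2) * of_real x ^ 2) * u x))"
    using assms(2) by (auto simp: u cutoff_Suc fun_eq_iff power_divide)
  also have "\<dots> \<in> cut_smooth R (k + n)" using u(1) by (intro cut_smoothI smooth_intros)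
  finally show ?case by (rule Suc.IH)
qed simp

lemma cut_smooth_continuous: "f \<in> cut_smooth R k \<Longrightarrow> continuous_on A f"
proof -
  assume "f \<in> cut_smooth R k"
  then obtain u where u: "smooth u" "f = (\<lambda>x. of_real (cutoff R k x) * u x)"
    by (auto simp: cut_smooth_def)
  show ?thesis
    unfolding u(2) cutoff_def divide_inverse
    by (intro continuous_intros smooth_continuous[OF u(1)])
qed

lemma cut_smooth_borel: "f \<in> cut_smooth R k \<Longrightarrow> f \<in> borel_measurable borel"
  by (intro borel_measurable_continuous_onI cut_smooth_continuous)

lemma cut_smooth_support:
  assumes "f \<in> cut_smooth R k" "0 < k" "0 < R" "\<bar>x\<bar> \<ge> R" shows "f x = 0"
proof -
  have "1 \<le> \<bar>x / R\<bar>" using assms(3,4) by simp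
  then have "1 \<le> (x / R)\<^sup>2" using abs_le_square_iff[of 1 "x / R"] by simp
  then have "cutoff R k x = 0" using assms(2) by (simp add: cutoff_def)
  then show ?thesis using assms(1) by (auto simp: cut_smooth_def)
qed

lemma compact_support_integrable:
  fixes g :: "real \<Rightarrow> 'b::euclidean_space"
  assumes "continuous_on UNIV g" "\<And>x. \<bar>x\<bar> \<ge> R \<Longrightarrow> g x = 0"
  shows "integrable lborel g" "(LINT x|lborel. g x) = integral {-R..R} g"
proof -
  have i: "set_integrable lborel {-R..R} g"
    using assms(1) by (intro borel_integrable_atLeastAtMost') (auto intro: continuous_on_subset)
  have g: "(\<lambda>x. indicator {-R..R} x *\<^sub>R g x) = g"
    using assms(2) by (auto simp: indicator_def fun_eq_iff abs_if)
  show "integrable lborel g" using i by (simp add: set_integrable_def g)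
  show "(LINT x|lborel. g x) = integral {-R..R} g"
    using set_borel_integral_eq_integral(2)[OF i] by (simp add: set_lebesgue_integral_def g)
qed

lemma cut_smooth_integrable:
  assumes "f \<in> cut_smooth R k" "0 < k" "0 < R"
  shows "integrable lborel f" "integrable lborel (\<lambda>x. (cmod (f x))\<^sup>2)"
  using assms
  by (auto intro!: compact_support_integrable(1)[where R = R] continuous_intros
      cut_smooth_continuous[OF assms(1)] simp: cut_smooth_support[OF assms])

lemma cut_smooth_integral_xderiv:
  assumes f: "f \<in> cut_smooth R (Suc k)" and k: "0 < k" and R: "0 < R"
  shows "(LINT x|lborel. xderiv f x) = 0"
proof -
  note d = cut_smooth_xderiv[OF f k]
  have "(xderiv f has_integral (f R - f (- R))) {-R..R}"
    using R by (intro fundamental_theorem_of_calculus has_vector_derivative_at_within[OF d(2)]) auto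
  moreover have "f R = 0" "f (- R) = 0" using R by (auto intro!: cut_smooth_support[OF f])
  ultimately have "integral {-R..R} (xderiv f) = 0" by (simp add: integral_unique)
  then show ?thesis
    using compact_support_integrable(2)[OF cut_smooth_continuous[OF d(1)] cut_smooth_support[OF d(1) k R]] by simp
qed

section \<open>The operator 1 - \<Delta> and the Fourier transform of cut-off functions\<close>

definition helmholtz :: "(real \<Rightarrow> complex) \<Rightarrow> real \<Rightarrow> complex" where
  "helmholtz f = (\<lambda>x. f x - xderiv (xderiv f) x)"

lemma smooth_helmholtz: "smooth f \<Longrightarrow> smooth (helmholtz f)"
  unfolding helmholtz_def by (intro smooth_intros)

lemma cut_smooth_helmholtz:
  assumes "f \<in> cut_smooth R (k + 2)" "0 < k" shows "helmholtz f \<in> cut_smooth R k"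
  unfolding helmholtz_def
proof (rule cut_smooth_diff)
  show "f \<in> cut_smooth R k" using assms by (rule cut_smooth_mono)
  have "xderiv f \<in> cut_smooth R (Suc k)" using assms by (intro cut_smooth_xderiv(1)) auto
  then show "xderiv (xderiv f) \<in> cut_smooth R k" using assms by (intro cut_smooth_xderiv(1)) auto
qed

text \<open>Green's second identity: \<psi> f'' - \<psi>'' f is the derivative of \<psi> f' -
  \<psi>' f, which has compact support through f. No decay of \<psi> enters, so exponentials and the
  unknown solution are both admissible.\<close>

lemma integral_helmholtz:
  assumes f: "f \<in> cut_smooth R (k + 2)" and k: "0 < k" and R: "0 < R" and \<psi>: "smooth \<psi>"
  shows "(LINT x|lborel. \<psi> x * helmholtz f x) = (LINT x|lborel. helmholtz \<psi> x * f x)"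
proof -
  have f2: "f \<in> cut_smooth R (Suc (Suc k))" using f by simp
  note f' = cut_smooth_xderiv[OF f2 zero_less_Suc]
  note f'' = cut_smooth_xderiv[OF f'(1) k]
  have f0: "f \<in> cut_smooth R (Suc k)" "f \<in> cut_smooth R k"
    using cut_smooth_mono[of f R "Suc k" 1] cut_smooth_mono[of f R k 2] f k by auto
  define G where "G = (\<lambda>x. \<psi> x * xderiv f x - xderiv \<psi> x * f x)"
  have G: "G \<in> cut_smooth R (Suc k)"
    unfolding G_def by (intro cut_smooth_diff cut_smooth_mult f' f0 smooth_intros \<psi>)
  have "(G has_vector_derivative (\<psi> x * xderiv (xderiv f) x - xderiv (xderiv \<psi>) x * f x)) (at x)" for x
    unfolding G_def
    by (rule has_vector_derivative_eq_rhs[OF has_vector_derivative_diff[OF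
          has_vector_derivative_mult[OF smooth_has_xderiv[OF \<psi>] f''(2)]
          has_vector_derivative_mult[OF smooth_has_xderiv[OF smooth_xderiv[OF \<psi>]] f'(2)]]]) simp
  from cut_smooth_integral_xderiv[OF G k R, unfolded xderiv_eqI[OF this]]
  have 0: "(LINT x|lborel. \<psi> x * xderiv (xderiv f) x - xderiv (xderiv \<psi>) x * f x) = 0" .
  have i: "integrable lborel (\<lambda>x. helmholtz \<psi> x * f x)"
    "integrable lborel (\<lambda>x. \<psi> x * xderiv (xderiv f) x - xderiv (xderiv \<psi>) x * f x)"
    by (intro cut_smooth_integrable(1)[OF _ k R] cut_smooth_mult cut_smooth_diff f0 f'' smooth_helmholtz smooth_intros \<psi>)+
  have "(LINT x|lborel. \<psi> x * helmholtz f x)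
      = (LINT x|lborel. helmholtz \<psi> x * f x - (\<psi> x * xderiv (xderiv f) x - xderiv (xderiv \<psi>) x * f x))"
    by (simp add: helmholtz_def algebra_simps)
  also have "\<dots> = (LINT x|lborel. helmholtz \<psi> x * f x)"
    by (simp add: Bochner_Integration.integral_diff[OF i] 0)
  finally show ?thesis .
qed

lemma cut_smooth_helmholtz_power:
  "f \<in> cut_smooth R (k + 2 * p) \<Longrightarrow> 0 < k \<Longrightarrow> (helmholtz ^^ p) f \<in> cut_smooth R k"
proof (induction p arbitrary: k)
  case (Suc p)
  have "(helmholtz ^^ p) f \<in> cut_smooth R (k + 2)" using Suc.prems by (intro Suc.IH) auto
  then show ?case using Suc.prems(2) by (simp add: cut_smooth_helmholtz)
qed simp

lemma smooth_helmholtz_power: "smooth f \<Longrightarrow> smooth ((helmholtz ^^ p) f)"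
  by (induction p) (auto intro: smooth_helmholtz)

lemma integral_helmholtz_power:
  assumes f: "f \<in> cut_smooth R (k + 2 * p)" and k: "0 < k" and R: "0 < R" and \<psi>: "smooth \<psi>"
  shows "(LINT x|lborel. \<psi> x * (helmholtz ^^ p) f x) = (LINT x|lborel. (helmholtz ^^ p) \<psi> x * f x)"
  using f \<psi>
proof (induction p arbitrary: \<psi>)
  case (Suc p)
  have f1: "f \<in> cut_smooth R ((k + 2) + 2 * p)" "f \<in> cut_smooth R (k + 2 * p)"
    using Suc.prems(1) cut_smooth_mono[of f R "k + 2 * p" 2] k by auto
  have "(LINT x|lborel. \<psi> x * (helmholtz ^^ Suc p) f x) = (LINT x|lborel. helmholtz \<psi> x * (helmholtz ^^ p) f x)"
    using integral_helmholtz[OF cut_smooth_helmholtz_power[OF f1(1)] k R Suc.prems(2)] by simp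
  also have "\<dots> = (LINT x|lborel. (helmholtz ^^ Suc p) \<psi> x * f x)"
    using Suc.IH[OF f1(2) smooth_helmholtz[OF Suc.prems(2)]] by (simp add: funpow_swap1)
  finally show ?case .
qed simp

text \<open>The sign is opposite to that of \<open>fourier_trunc\<close>, and there is no constant.
  In the duality argument the phase of \<open>fourier_trunc\<close> meets the transformed test
  function, and the integral over \<xi> becomes the inversion integral.\<close>

definition fourier :: "(real \<Rightarrow> complex) \<Rightarrow> real \<Rightarrow> complex" where
  "fourier f \<xi> = (LINT x|lborel. exp (\<i> * of_real (\<xi> * x)) * f x)"

lemma helmholtz_exp: "helmholtz (\<lambda>x. c * exp (\<i> * of_real (\<xi> * x))) = (\<lambda>x. (of_real (1 + \<xi>\<^sup>2) * c) * exp (\<i> * of_real (\<xi> * x)))"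
  unfolding helmholtz_def xderiv_exp by (auto simp: fun_eq_iff power2_eq_square algebra_simps)

lemma helmholtz_power_exp:
  "(helmholtz ^^ p) (\<lambda>x. exp (\<i> * of_real (\<xi> * x))) = (\<lambda>x. of_real ((1 + \<xi>\<^sup>2) ^ p) * exp (\<i> * of_real (\<xi> * x)))"
proof (induction p)
  case (Suc p)
  then show ?case using helmholtz_exp[of "of_real ((1 + \<xi>\<^sup>2) ^ p)" \<xi>] by simp
qed simp

text \<open>The powers of the operator are moved onto the exponential, an eigenfunction with
  eigenvalue 1 + \<xi>^2.\<close>

lemma fourier_helmholtz_power:
  assumes f: "f \<in> cut_smooth R (k + 2 * p)" and k: "0 < k" and R: "0 < R"
  shows "fourier ((helmholtz ^^ p) f) \<xi> = of_real ((1 + \<xi>\<^sup>2) ^ p) * fourier f \<xi>"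
proof -
  have s: "smooth (\<lambda>x. exp (\<i> * of_real (\<xi> * x)))" using smooth_exp[of 1 \<xi>] by simp
  show ?thesis
    unfolding fourier_def integral_helmholtz_power[OF f k R s]
    by (simp only: helmholtz_power_exp mult.assoc integral_mult_right_zero)
qed

lemma fourier_norm_le: "cmod (fourier f \<xi>) \<le> (LINT x|lborel. cmod (f x))"
proof -
  have "cmod (fourier f \<xi>) \<le> (LINT x|lborel. cmod (exp (\<i> * of_real (\<xi> * x)) * f x))"
    unfolding fourier_def by (rule integral_norm_bound)
  then show ?thesis by (simp add: norm_mult)
qed

lemma fourier_borel:
  assumes [measurable]: "f \<in> borel_measurable borel" shows "fourier f \<in> borel_measurable borel"
  unfolding fourier_def by measurable

lemma integrable_inverse_square: "integrable lborel (\<lambda>x::real. 1 / (1 + x\<^sup>2))"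
  using integrable_inverse_1_plus_square by (simp add: set_integrable_def inverse_eq_divide)

text \<open>The index 3 is 1 + 2: one application of \<open>helmholtz\<close> leaves index 1, hence
  an integrable function, whose bounded transform yields the decay C / (1 + \<xi>^2). The square is
  integrable since the transform is also bounded.\<close>

lemma cut_smooth_fourier_integrable:
  assumes f: "f \<in> cut_smooth R 3" and R: "0 < R"
  shows "integrable lborel (fourier f)" "integrable lborel (\<lambda>\<xi>. (cmod (fourier f \<xi>))\<^sup>2)"
proof -
  note [measurable] = fourier_borel[OF cut_smooth_borel[OF f]]
  define C where "C = (LINT x|lborel. cmod (helmholtz f x))"
  have bound: "cmod (fourier f \<xi>) \<le> C * (1 / (1 + \<xi>\<^sup>2))" for \<xi>
  proof -
    have "cmod (fourier (helmholtz f) \<xi>) = (1 + \<xi>\<^sup>2) * cmod (fourier f \<xi>)"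
      using fourier_helmholtz_power[of f R 1 1 \<xi>] f R
      by (simp add: norm_mult eval_nat_numeral del: of_real_add)
    with fourier_norm_le[of "helmholtz f" \<xi>] show ?thesis
      by (simp add: C_def field_simps add_pos_nonneg)
  qed
  show i: "integrable lborel (fourier f)"
    by (rule Bochner_Integration.integrable_bound[OF integrable_mult_right[OF integrable_inverse_square, of C]])
      (use bound in \<open>auto intro!: AE_I2 simp: C_def\<close>)
  show "integrable lborel (\<lambda>\<xi>. (cmod (fourier f \<xi>))\<^sup>2)"
  proof (rule Bochner_Integration.integrable_bound[OF integrable_mult_right[OF integrable_norm[OF i], of "LINT x|lborel. cmod (f x)"]])
    show "AE \<xi> in lborel. norm ((cmod (fourier f \<xi>))\<^sup>2) \<le> norm ((LINT x|lborel. cmod (f x)) * norm (fourier f \<xi>))"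
      using mult_right_mono[OF fourier_norm_le[of f] norm_ge_zero]
      by (auto intro!: AE_I2 order_trans[OF _ abs_ge_self] simp: power2_eq_square)
  qed measurable
qed

lemma integrable_tensor:
  fixes f :: "'a \<Rightarrow> complex" and g :: "'b \<Rightarrow> complex"
  assumes "sigma_finite_measure M" "sigma_finite_measure N" "integrable M f" "integrable N g"
  shows "integrable (M \<Otimes>\<^sub>M N) (\<lambda>(x, y). f x * g y)"
proof -
  interpret M: sigma_finite_measure M by fact
  interpret N: sigma_finite_measure N by fact
  interpret pair_sigma_finite M N by standard
  note [measurable] = borel_measurable_integrable[OF assms(3)] borel_measurable_integrable[OF assms(4)]
  show ?thesis
    by (rule Fubini_integrable) (use assms in \<open>auto simp: norm_mult\<close>)
qed

text \<open>Rescaling \<xi> by n reduces the integral to the characteristic function of the standard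
  normal distribution at n a.\<close>

lemma gaussian_fourier:
  assumes "0 < n"
  shows "(LINT \<xi>|lborel. exp (\<i> * of_real (\<xi> * a)) * of_real (exp (- (\<xi> / n)\<^sup>2 / 2)))
    = of_real (n * sqrt (2 * pi) * exp (- (n * a)\<^sup>2 / 2))"
proof -
  have "(LINT \<xi>|lborel. exp (\<i> * of_real (\<xi> * a)) * of_real (exp (- (\<xi> / n)\<^sup>2 / 2)))
      = n *\<^sub>R (LINT \<xi>|lborel. exp (\<i> * of_real (n * \<xi> * a)) * of_real (exp (- \<xi>\<^sup>2 / 2)))"
    using assms by (subst lborel_integral_real_affine[where c = n and t = 0]) auto
  also have "(LINT \<xi>|lborel. exp (\<i> * of_real (n * \<xi> * a)) * complex_of_real (exp (- \<xi>\<^sup>2 / 2)))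
      = (LINT \<xi>|lborel. of_real (sqrt (2 * pi)) * (std_normal_density \<xi> *\<^sub>R iexp (n * a * \<xi>)))"
    by (rule Bochner_Integration.integral_cong)
      (auto simp: std_normal_density_def scaleR_conv_of_real mult_ac)
  also have "\<dots> = of_real (sqrt (2 * pi)) * (LINT \<xi>|lborel. std_normal_density \<xi> *\<^sub>R iexp (n * a * \<xi>))"
    by (rule integral_mult_right_zero)
  also have "(LINT \<xi>|lborel. std_normal_density \<xi> *\<^sub>R iexp (n * a * \<xi>)) = char std_normal_distribution (n * a)"
    unfolding char_def by (subst integral_density) auto
  finally show ?thesis
    by (simp add: char_std_normal_distribution scaleR_conv_of_real)
qed

lemma integrable_gaussian:
  assumes "0 < n" shows "integrable lborel (\<lambda>\<xi>. complex_of_real (exp (- (\<xi> / n)\<^sup>2 / 2)))"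
proof -
  have "integrable lborel (\<lambda>\<xi>. sqrt (2 * pi) * std_normal_density (0 + (1 / n) * \<xi>))"
    using integrable_std_normal_moment[of 0] assms
    by (intro integrable_mult_right lborel_integrable_real_affine) auto
  then show ?thesis by (simp add: std_normal_density_def)
qed

text \<open>The Gaussian factor makes the double integral absolutely convergent, so the order of
  integration may be changed. The inner integral is then a Gaussian in x - y of width 1 / n, and the
  result is a normal average of f about y.\<close>

lemma fourier_gaussian:
  assumes f: "f \<in> cut_smooth R k" "0 < k" "0 < R" and n: "0 < n"
  shows "(LINT \<xi>|lborel. exp (- \<i> * of_real (\<xi> * y)) * fourier f \<xi> * of_real (exp (- (\<xi> / n)\<^sup>2 / 2)))
    = 2 * of_real pi * (LINT s|lborel. std_normal_density s *\<^sub>R f (y + s / n))"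
proof -
  note [measurable] = cut_smooth_borel[OF f(1)]
  let ?g = "\<lambda>\<xi>. complex_of_real (exp (- (\<xi> / n)\<^sup>2 / 2))"
  have i: "integrable (lborel \<Otimes>\<^sub>M lborel) (\<lambda>(\<xi>, x). exp (\<i> * of_real (\<xi> * (x - y))) * ?g \<xi> * f x)"
    by (rule Bochner_Integration.integrable_bound[OF integrable_tensor[OF _ _ integrable_gaussian[OF n] cut_smooth_integrable(1)[OF f]]])
      (auto simp: norm_mult intro: sigma_finite_lborel)
  have "(LINT \<xi>|lborel. exp (- \<i> * of_real (\<xi> * y)) * fourier f \<xi> * ?g \<xi>)
      = (LINT \<xi>|lborel. LINT x|lborel. exp (\<i> * of_real (\<xi> * (x - y))) * ?g \<xi> * f x)"
  proof (rule Bochner_Integration.integral_cong[OF refl])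
    fix \<xi>
    have "exp (- \<i> * of_real (\<xi> * y)) * fourier f \<xi> * ?g \<xi>
        = (exp (- \<i> * of_real (\<xi> * y)) * ?g \<xi>) * (LINT x|lborel. exp (\<i> * of_real (\<xi> * x)) * f x)"
      by (simp add: fourier_def)
    also have "\<dots> = (LINT x|lborel. (exp (- \<i> * of_real (\<xi> * y)) * ?g \<xi>) * (exp (\<i> * of_real (\<xi> * x)) * f x))"
      by (rule integral_mult_right_zero[symmetric])
    also have "\<dots> = (LINT x|lborel. exp (\<i> * of_real (\<xi> * (x - y))) * ?g \<xi> * f x)"
    proof (rule Bochner_Integration.integral_cong[OF refl])
      fix x
      have "exp (- \<i> * of_real (\<xi> * y)) * exp (\<i> * of_real (\<xi> * x)) = exp (\<i> * of_real (\<xi> * (x - y)))"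
        unfolding exp_add[symmetric] by (rule arg_cong[where f = exp]) (simp add: algebra_simps)
      then show "(exp (- \<i> * of_real (\<xi> * y)) * ?g \<xi>) * (exp (\<i> * of_real (\<xi> * x)) * f x)
          = exp (\<i> * of_real (\<xi> * (x - y))) * ?g \<xi> * f x"
        unfolding \<open>_ = exp (\<i> * of_real (\<xi> * (x - y)))\<close>[symmetric] by (simp only: mult_ac)
    qed
    finally show "exp (- \<i> * of_real (\<xi> * y)) * fourier f \<xi> * ?g \<xi>
        = (LINT x|lborel. exp (\<i> * of_real (\<xi> * (x - y))) * ?g \<xi> * f x)" .
  qed
  also have "\<dots> = (LINT x|lborel. LINT \<xi>|lborel. exp (\<i> * of_real (\<xi> * (x - y))) * ?g \<xi> * f x)"
    using lborel_pair.Fubini_integral[OF i] by simp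
  also have "\<dots> = (LINT x|lborel. of_real (n * sqrt (2 * pi) * exp (- (n * (x - y))\<^sup>2 / 2)) * f x)"
    by (simp only: integral_mult_left_zero gaussian_fourier[OF n])
  also have "\<dots> = \<bar>1 / n\<bar> *\<^sub>R (LINT s|lborel. of_real (n * sqrt (2 * pi) * exp (- (n * ((y + (1 / n) * s) - y))\<^sup>2 / 2)) * f (y + (1 / n) * s))"
    using n by (intro lborel_integral_real_affine) auto
  also have "\<dots> = \<bar>1 / n\<bar> *\<^sub>R (LINT s|lborel. of_real (n * (2 * pi)) * (std_normal_density s *\<^sub>R f (y + s / n)))"
  proof (intro arg_cong[where f = "\<lambda>z. \<bar>1 / n\<bar> *\<^sub>R z"] Bochner_Integration.integral_cong refl)
    fix s
    have "n * sqrt (2 * pi) * exp (- (n * ((y + (1 / n) * s) - y))\<^sup>2 / 2) = n * (2 * pi) * std_normal_density s"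
    proof -
      have "n * ((y + (1 / n) * s) - y) = s" using n by simp
      moreover have "n * (2 * pi) * ((1 / sqrt (2 * pi)) * exp (- s\<^sup>2 / 2))
          = n * ((2 * pi) / sqrt (2 * pi)) * exp (- s\<^sup>2 / 2)"
        by (simp only: divide_inverse mult_ac mult_1_left)
      moreover have "(2 * pi) / sqrt (2 * pi) = sqrt (2 * pi)" by (rule real_div_sqrt) simp
      ultimately show ?thesis unfolding std_normal_density_def by (simp only:)
    qed
    then show "of_real (n * sqrt (2 * pi) * exp (- (n * ((y + (1 / n) * s) - y))\<^sup>2 / 2)) * f (y + (1 / n) * s)
        = of_real (n * (2 * pi)) * (std_normal_density s *\<^sub>R f (y + s / n))"
      by (simp only: of_real_mult scaleR_conv_of_real mult.assoc) simp
  qed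
  also have "\<dots> = 2 * of_real pi * (LINT s|lborel. std_normal_density s *\<^sub>R f (y + s / n))"
    using n by (simp add: scaleR_conv_of_real)
  finally show ?thesis .
qed

text \<open>The limit n \<rightarrow> \<infinity> of the regularized formula: on the left by
  dominated convergence with the integrable majorant |\<open>fourier f\<close>|, on the right
  because f is bounded and continuous.\<close>

lemma fourier_inversion:
  assumes f: "f \<in> cut_smooth R 3" and R: "0 < R"
  shows "(LINT \<xi>|lborel. exp (- \<i> * of_real (\<xi> * y)) * fourier f \<xi>) = 2 * of_real pi * f y"
proof -
  note [measurable] = cut_smooth_borel[OF f] fourier_borel[OF cut_smooth_borel[OF f]]
  have inv: "(\<lambda>n. s / real (Suc n)) \<longlonglongrightarrow> 0" for s
    using tendsto_mult_right_zero[OF LIMSEQ_Suc[OF lim_1_over_n], of s] by simp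
  have "(\<lambda>n. LINT \<xi>|lborel. exp (- \<i> * of_real (\<xi> * y)) * fourier f \<xi> * of_real (exp (- (\<xi> / real (Suc n))\<^sup>2 / 2)))
      \<longlonglongrightarrow> (LINT \<xi>|lborel. exp (- \<i> * of_real (\<xi> * y)) * fourier f \<xi>)"
  proof (rule integral_dominated_convergence[where w = "\<lambda>\<xi>. cmod (fourier f \<xi>)"])
    have "(\<lambda>n. exp (- \<i> * of_real (\<xi> * y)) * fourier f \<xi> * of_real (exp (- (\<xi> / real (Suc n))\<^sup>2 / 2)))
        \<longlonglongrightarrow> exp (- \<i> * of_real (\<xi> * y)) * fourier f \<xi> * of_real (exp (- 0\<^sup>2 / 2))" for \<xi>
      by (rule tendsto_mult[OF tendsto_const tendsto_of_real[OF tendsto_exp[OF tendsto_divide[OF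
              tendsto_minus[OF tendsto_power[OF inv]] tendsto_const]]]]) simp
    then show "AE \<xi> in lborel. (\<lambda>n. exp (- \<i> * of_real (\<xi> * y)) * fourier f \<xi> * of_real (exp (- (\<xi> / real (Suc n))\<^sup>2 / 2)))
        \<longlonglongrightarrow> exp (- \<i> * of_real (\<xi> * y)) * fourier f \<xi>" by (intro AE_I2) simp
    show "AE \<xi> in lborel. norm (exp (- \<i> * of_real (\<xi> * y)) * fourier f \<xi> * of_real (exp (- (\<xi> / real (Suc n))\<^sup>2 / 2)))
        \<le> cmod (fourier f \<xi>)" for n
      by (intro AE_I2) (simp add: norm_mult mult_left_le del: of_nat_Suc)
  qed (use cut_smooth_fourier_integrable[OF f R] in auto)
  note lim = this
  have "(\<lambda>n. LINT s|lborel. std_normal_density s *\<^sub>R f (y + s / real (Suc n))) \<longlonglongrightarrow> (LINT s|lborel. std_normal_density s *\<^sub>R f y)"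
  proof -
    obtain C where C: "\<And>x. cmod (f x) \<le> C"
    proof -
      have "compact (f ` {-R..R})"
        by (intro compact_continuous_image cut_smooth_continuous[OF f]) auto
      then obtain C where C: "\<forall>z\<in>f ` {-R..R}. cmod z \<le> C"
        using compact_imp_bounded bounded_iff by blast
      have "cmod (f x) \<le> max C 0" for x
      proof (cases "x \<in> {-R..R}")
        case True
        with C have "cmod (f x) \<le> C" by blast
        then show ?thesis by simp
      next
        case False
        then show ?thesis using cut_smooth_support[OF f _ R, of x] by auto
      qed
      then show ?thesis by (rule that)
    qed
    show ?thesis
    proof (rule integral_dominated_convergence[where w = "\<lambda>s. std_normal_density s * C"])
      have "(\<lambda>n. std_normal_density s *\<^sub>R f (y + s / real (Suc n))) \<longlonglongrightarrow> std_normal_density s *\<^sub>R f (y + 0)" for s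
      proof (intro tendsto_scaleR tendsto_const)
        have "isCont f (y + 0)"
          using cut_smooth_continuous[OF f, of UNIV] by (simp add: continuous_on_eq_continuous_at)
        then show "(\<lambda>n. f (y + s / real (Suc n))) \<longlonglongrightarrow> f (y + 0)"
          by (rule isCont_tendsto_compose) (rule tendsto_add[OF tendsto_const inv])
      qed
      then show "AE s in lborel. (\<lambda>n. std_normal_density s *\<^sub>R f (y + s / real (Suc n))) \<longlonglongrightarrow> std_normal_density s *\<^sub>R f y"
        by simp
      show "AE s in lborel. norm (std_normal_density s *\<^sub>R f (y + s / real (Suc n))) \<le> std_normal_density s * C" for n
        using C by (intro AE_I2) (simp add: mult_left_mono normal_density_nonneg del: of_nat_Suc)
      show "integrable lborel (\<lambda>s. std_normal_density s * C)"
        using integrable_std_normal_moment[of 0] by simp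
    qed measurable
  qed
  then have "(\<lambda>n. 2 * of_real pi * (LINT s|lborel. std_normal_density s *\<^sub>R f (y + s / real (Suc n))))
      \<longlonglongrightarrow> 2 * of_real pi * (LINT s|lborel. std_normal_density s *\<^sub>R f y)"
    by (intro tendsto_mult tendsto_const)
  moreover have "(LINT s|lborel. std_normal_density s *\<^sub>R f y) = f y"
    using integral_std_normal_moment_even[of 0] by simp
  moreover have "(LINT \<xi>|lborel. exp (- \<i> * of_real (\<xi> * y)) * fourier f \<xi> * of_real (exp (- (\<xi> / real (Suc n))\<^sup>2 / 2)))
      = 2 * of_real pi * (LINT s|lborel. std_normal_density s *\<^sub>R f (y + s / real (Suc n)))" for n
    by (rule fourier_gaussian[OF f _ R]) simp_all
  ultimately show ?thesis
    by (intro LIMSEQ_unique[OF lim]) (simp only:)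
qed

subsection \<open>Kernels in one variable pair\<close>

lemma lebk_component: "(\<lambda>x. x 1) \<in> borel_measurable (lebk 1)"
  unfolding lebk_def using measurable_component_singleton[of 1 "{1..1}" "\<lambda>_. lborel"] by simp

lemma lebk_nn_integral:
  assumes [measurable]: "f \<in> borel_measurable borel"
  shows "(\<integral>\<^sup>+x. f (x 1) \<partial>lebk 1) = (\<integral>\<^sup>+y. f y \<partial>lborel)"
proof -
  interpret product_sigma_finite "\<lambda>_::nat. lborel :: real measure" by standard
  show ?thesis using product_nn_integral_singleton[of f 1] by (simp add: lebk_def)
qed

lemma lebk_integral:
  fixes f :: "real \<Rightarrow> 'b::{banach, second_countable_topology}"
  assumes [measurable]: "f \<in> borel_measurable borel"
  shows "(LINT x|lebk 1. f (x 1)) = (LINT y|lborel. f y)"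
proof -
  interpret product_sigma_finite "\<lambda>_::nat. lborel :: real measure" by standard
  show ?thesis using product_integral_singleton[of f 1] by (simp add: lebk_def)
qed

lemma lebk_integrable:
  fixes f :: "real \<Rightarrow> 'b::{banach, second_countable_topology}"
  assumes f: "integrable lborel f" shows "integrable (lebk 1) (\<lambda>x. f (x 1))"
proof -
  have [measurable]: "f \<in> borel_measurable borel" using borel_measurable_integrable[OF f] by simp
  have "(\<integral>\<^sup>+x. ennreal (norm (f (x 1))) \<partial>lebk 1) = (\<integral>\<^sup>+y. ennreal (norm (f y)) \<partial>lborel)"
    by (rule lebk_nn_integral) measurable
  moreover have "(\<lambda>x. f (x 1)) \<in> borel_measurable (lebk 1)"
    by (rule measurable_compose[OF lebk_component]) measurable
  ultimately show ?thesis
    using f by (simp add: integrable_iff_bounded del: One_nat_def)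
qed

lemma lebk_L2: "f \<in> L2 lborel \<Longrightarrow> (\<lambda>x. f (x 1)) \<in> L2 (lebk 1)"
  unfolding L2_iff using lebk_integrable[of "\<lambda>x. (cmod (f x))\<^sup>2"]
  by (auto intro: measurable_compose[OF lebk_component] simp del: One_nat_def)

lemma cut_smooth_L2: "f \<in> cut_smooth R k \<Longrightarrow> 0 < k \<Longrightarrow> 0 < R \<Longrightarrow> f \<in> L2 lborel"
  by (simp add: L2_iff cut_smooth_borel cut_smooth_integrable)

lemma cut_smooth_fourier_L2: "f \<in> cut_smooth R 3 \<Longrightarrow> 0 < R \<Longrightarrow> fourier f \<in> L2 lborel"
  by (simp add: L2_iff fourier_borel cut_smooth_borel cut_smooth_fourier_integrable)

lemma integral_tensor:
  fixes f :: "'a \<Rightarrow> complex" and g :: "'b \<Rightarrow> complex"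
  assumes "sigma_finite_measure M" "sigma_finite_measure N" "integrable M f" "integrable N g"
  shows "integral\<^sup>L (M \<Otimes>\<^sub>M N) (\<lambda>(x, y). f x * g y) = (LINT x|M. f x) * (LINT y|N. g y)"
proof -
  interpret M: sigma_finite_measure M by fact
  interpret N: sigma_finite_measure N by fact
  interpret pair_sigma_finite M N by standard
  show ?thesis using integral_fst'[OF integrable_tensor[OF assms]] by simp
qed

definition pair_phase :: "(nat \<Rightarrow> real) \<times> (nat \<Rightarrow> real) \<Rightarrow> (nat \<Rightarrow> real) \<times> (nat \<Rightarrow> real) \<Rightarrow> complex" where
  "pair_phase z \<zeta> = exp (- \<i> * of_real (fst \<zeta> 1 * fst z 1 + snd \<zeta> 1 * snd z 1))"

lemma norm_pair_phase: "cmod (pair_phase z \<zeta>) = 1"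
  by (simp add: pair_phase_def flip: of_real_mult of_real_add)

abbreviation lebk_pair :: "((nat \<Rightarrow> real) \<times> (nat \<Rightarrow> real)) measure" where
  "lebk_pair \<equiv> lebk 1 \<Otimes>\<^sub>M lebk 1"

lemma pair_phase_measurable:
  "(\<lambda>p. pair_phase (fst p) (snd p)) \<in> borel_measurable (lebk_pair \<Otimes>\<^sub>M lebk_pair)"
  "(\<lambda>p. pair_phase (snd p) (fst p)) \<in> borel_measurable (lebk_pair \<Otimes>\<^sub>M lebk_pair)"
proof -
  note [measurable] = lebk_component
  show "(\<lambda>p. pair_phase (fst p) (snd p)) \<in> borel_measurable (lebk_pair \<Otimes>\<^sub>M lebk_pair)"
    "(\<lambda>p. pair_phase (snd p) (fst p)) \<in> borel_measurable (lebk_pair \<Otimes>\<^sub>M lebk_pair)"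
    unfolding pair_phase_def by measurable
qed

lemma sigma_finite_lebk_pair: "sigma_finite_measure lebk_pair"
proof -
  interpret A: sigma_finite_measure "lebk 1" by (rule sigma_finite_lebk)
  interpret pair_sigma_finite "lebk 1" "lebk 1" by standard
  show ?thesis by (rule sigma_finite_measure_axioms)
qed

definition cube :: "real \<Rightarrow> (nat \<Rightarrow> real) \<times> (nat \<Rightarrow> real) \<Rightarrow> complex" where
  "cube R z = of_bool (\<bar>fst z 1\<bar> \<le> R) * of_bool (\<bar>snd z 1\<bar> \<le> R)"

lemma cube_L2: "cube R \<in> L2 lebk_pair"
proof -
  have "(\<lambda>x::real. indicator {-R..R} x :: real) = (\<lambda>x. (cmod (of_bool (\<bar>x\<bar> \<le> R)))\<^sup>2)"
    by (auto simp: indicator_def fun_eq_iff)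
  moreover have "integrable lborel (\<lambda>x::real. indicator {-R..R} x :: real)"
    by (simp add: integrable_indicator_iff emeasure_lborel_Icc_eq)
  ultimately have "(\<lambda>x. of_bool (\<bar>x\<bar> \<le> R)) \<in> L2 lborel"
    by (auto simp: L2_iff)
  from lebk_L2[OF this] have "(\<lambda>x. of_bool (\<bar>x 1\<bar> \<le> R)) \<in> L2 (lebk 1)" .
  from L2_tensor(1)[OF sigma_finite_lebk this this]
  show ?thesis by (simp add: cube_def[abs_def] case_prod_unfold)
qed

lemma fourier_trunc_eq:
  "fourier_trunc 1 R \<gamma> \<xi> \<xi>' = of_real (1 / (2 * pi)) *
     (LINT z|lebk_pair. (cube R z * (case z of (x, x') \<Rightarrow> \<gamma> x x')) * pair_phase z (\<xi>, \<xi>'))"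
proof -
  have "(\<lambda>(x, x'). of_bool (\<forall>j\<in>{1..1}. \<bar>x j\<bar> \<le> R \<and> \<bar>x' j\<bar> \<le> R) *
        exp (- \<i> * of_real (\<Sum>j=1..1. \<xi> j * x j + \<xi>' j * x' j)) * \<gamma> x x')
     = (\<lambda>z. (cube R z * (case z of (x, x') \<Rightarrow> \<gamma> x x')) * pair_phase z (\<xi>, \<xi>'))"
    by (auto simp: fun_eq_iff cube_def pair_phase_def)
  then show ?thesis by (simp only: fourier_trunc_def power_one_right)
qed

text \<open>
  The multiplication formula for the Fourier transform: no inversion is involved, but the test
  function must be such that its transform is square integrable.
\<close>

lemma fourier_pairing:
  assumes F: "is_fourier 1 \<gamma> g"
    and h1: "integrable lebk_pair h" and h2: "h \<in> L2 lebk_pair"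
    and ft: "\<And>z. (LINT \<zeta>|lebk_pair. pair_phase z \<zeta> * h \<zeta>) = k z" and k: "k \<in> L2 lebk_pair"
  shows "(LINT \<zeta>|lebk_pair. (case \<zeta> of (\<xi>, \<xi>') \<Rightarrow> g \<xi> \<xi>') * h \<zeta>)
    = of_real (1 / (2 * pi)) * (LINT z|lebk_pair. (case z of (x, x') \<Rightarrow> \<gamma> x x') * k z)"
proof -
  interpret Q: sigma_finite_measure lebk_pair by (rule sigma_finite_lebk_pair)
  interpret QQ: pair_sigma_finite lebk_pair lebk_pair by standard
  define G where "G = (\<lambda>\<zeta>. case \<zeta> of (\<xi>, \<xi>') \<Rightarrow> g \<xi> \<xi>')"
  define \<Gamma> where "\<Gamma> = (\<lambda>z. case z of (x, x') \<Rightarrow> \<gamma> x x')"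
  define T where "T = (\<lambda>n \<zeta>. fourier_trunc 1 (real n) \<gamma> (fst \<zeta>) (snd \<zeta>))"
  have G: "G \<in> L2 lebk_pair" and \<Gamma>: "\<Gamma> \<in> L2 lebk_pair"
    using F by (auto simp: is_fourier_def L2_kernel_def G_def \<Gamma>_def)
  note [measurable] = L2_measurable[OF G] L2_measurable[OF \<Gamma>] L2_measurable[OF h2] L2_measurable[OF k]
    L2_measurable[OF cube_L2] pair_phase_measurable
  have T: "T n \<zeta> = of_real (1 / (2 * pi)) * (LINT z|lebk_pair. (cube (real n) z * \<Gamma> z) * pair_phase z \<zeta>)" for n \<zeta>
    by (simp only: T_def fourier_trunc_eq \<Gamma>_def prod.collapse)
  have T_measurable: "T n \<in> borel_measurable lebk_pair" for n
  proof -
    have "(\<lambda>p. (cube (real n) (snd p) * \<Gamma> (snd p)) * pair_phase (snd p) (fst p)) \<in> borel_measurable (lebk_pair \<Otimes>\<^sub>M lebk_pair)"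
      by (rule borel_measurable_times[OF borel_measurable_times[OF
            measurable_compose[OF measurable_snd L2_measurable[OF cube_L2]]
            measurable_compose[OF measurable_snd L2_measurable[OF \<Gamma>]]] pair_phase_measurable(2)])
    then have "(\<lambda>\<zeta>. LINT z|lebk_pair. (cube (real n) z * \<Gamma> z) * pair_phase z \<zeta>) \<in> borel_measurable lebk_pair"
      by (intro Q.borel_measurable_lebesgue_integral) (simp add: case_prod_unfold)
    then show ?thesis unfolding T[abs_def] by measurable
  qed
  \<comment> \<open>On a cube a square integrable function is integrable. This is what the
    truncation provides: Fubini can be applied to the truncated kernel.\<close>
  have bi: "integrable lebk_pair (\<lambda>z. cube (real n) z * \<Gamma> z)" for n
    by (rule L2_mult_integrable[OF cube_L2 \<Gamma>])
  have i: "integrable (lebk_pair \<Otimes>\<^sub>M lebk_pair) (\<lambda>(z, \<zeta>). (cube (real n) z * \<Gamma> z) * (pair_phase z \<zeta> * h \<zeta>))" for n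
  proof (rule Bochner_Integration.integrable_bound[OF integrable_tensor[OF sigma_finite_lebk_pair sigma_finite_lebk_pair bi[of n] h1]])
    show "(\<lambda>(z, \<zeta>). (cube (real n) z * \<Gamma> z) * (pair_phase z \<zeta> * h \<zeta>)) \<in> borel_measurable (lebk_pair \<Otimes>\<^sub>M lebk_pair)"
      unfolding case_prod_unfold
      by (rule borel_measurable_times[OF borel_measurable_times[OF
            measurable_compose[OF measurable_fst L2_measurable[OF cube_L2]]
            measurable_compose[OF measurable_fst L2_measurable[OF \<Gamma>]]]
          borel_measurable_times[OF pair_phase_measurable(1)
            measurable_compose[OF measurable_snd L2_measurable[OF h2]]]])
  qed (simp add: norm_mult norm_pair_phase case_prod_unfold)
  have Th: "T n \<zeta> * h \<zeta> = of_real (1 / (2 * pi)) * (LINT z|lebk_pair. (cube (real n) z * \<Gamma> z) * (pair_phase z \<zeta> * h \<zeta>))" for n \<zeta>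
    unfolding T mult.assoc by (subst integral_mult_left_zero[symmetric]) (simp only: mult.assoc)
  have Ti: "integrable lebk_pair (\<lambda>\<zeta>. T n \<zeta> * h \<zeta>)" for n
  proof -
    have "integrable lebk_pair (\<lambda>\<zeta>. LINT z|lebk_pair. (cube (real n) z * \<Gamma> z) * (pair_phase z \<zeta> * h \<zeta>))"
      using QQ.integrable_snd[OF i[of n]] by (simp only: prod.case)
    then show ?thesis unfolding Th by (rule integrable_mult_right)
  qed
  have trunc: "(LINT \<zeta>|lebk_pair. T n \<zeta> * h \<zeta>)
      = of_real (1 / (2 * pi)) * (LINT z|lebk_pair. (cube (real n) z * \<Gamma> z) * k z)" for n
  proof -
    have "(LINT \<zeta>|lebk_pair. T n \<zeta> * h \<zeta>) = of_real (1 / (2 * pi)) *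
        (LINT \<zeta>|lebk_pair. LINT z|lebk_pair. (cube (real n) z * \<Gamma> z) * (pair_phase z \<zeta> * h \<zeta>))"
      unfolding Th by (rule integral_mult_right_zero)
    also have "(LINT \<zeta>|lebk_pair. LINT z|lebk_pair. (cube (real n) z * \<Gamma> z) * (pair_phase z \<zeta> * h \<zeta>))
        = (LINT z|lebk_pair. LINT \<zeta>|lebk_pair. (cube (real n) z * \<Gamma> z) * (pair_phase z \<zeta> * h \<zeta>))"
      by (rule QQ.Fubini_integral[OF i])
    also have "\<dots> = (LINT z|lebk_pair. (cube (real n) z * \<Gamma> z) * k z)"
      by (simp only: integral_mult_right_zero ft)
    finally show ?thesis .
  qed
  \<comment> \<open>On the position side the truncation is removed by dominated convergence; on the
    frequency side it is removed below by Cauchy-Schwarz, from the L2 convergence in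
    \<open>is_fourier\<close>.\<close>
  have "(\<lambda>n. LINT z|lebk_pair. (cube (real n) z * \<Gamma> z) * k z) \<longlonglongrightarrow> (LINT z|lebk_pair. \<Gamma> z * k z)"
  proof (rule integral_dominated_convergence[where w = "\<lambda>z. cmod (\<Gamma> z * k z)"])
    show "integrable lebk_pair (\<lambda>z. cmod (\<Gamma> z * k z))"
      by (intro integrable_norm L2_mult_integrable \<Gamma> k)
    show "AE z in lebk_pair. norm ((cube (real n) z * \<Gamma> z) * k z) \<le> cmod (\<Gamma> z * k z)" for n
      by (intro AE_I2) (auto simp: cube_def)
    have "(\<lambda>n. (cube (real n) z * \<Gamma> z) * k z) \<longlonglongrightarrow> \<Gamma> z * k z" for z
    proof (rule Lim_transform_eventually[OF tendsto_const])
      show "\<forall>\<^sub>F n in sequentially. \<Gamma> z * k z = (cube (real n) z * \<Gamma> z) * k z"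
        using eventually_ge_at_top[of "nat \<lceil>max \<bar>fst z 1\<bar> \<bar>snd z 1\<bar>\<rceil>"]
      proof eventually_elim
        case (elim n)
        then have "\<bar>fst z 1\<bar> \<le> real n" "\<bar>snd z 1\<bar> \<le> real n" by linarith+
        then show ?case by (simp add: cube_def)
      qed
    qed
    then show "AE z in lebk_pair. (\<lambda>n. (cube (real n) z * \<Gamma> z) * k z) \<longlonglongrightarrow> \<Gamma> z * k z" by simp
  qed measurable
  then have 1: "(\<lambda>n. LINT \<zeta>|lebk_pair. T n \<zeta> * h \<zeta>) \<longlonglongrightarrow> of_real (1 / (2 * pi)) * (LINT z|lebk_pair. \<Gamma> z * k z)"
    unfolding trunc by (intro tendsto_mult tendsto_const)
  have Gh: "integrable lebk_pair (\<lambda>\<zeta>. G \<zeta> * h \<zeta>)" by (rule L2_mult_integrable[OF G h2])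
  have sq: "(\<lambda>n. sq_norm lebk_pair (\<lambda>\<zeta>. G \<zeta> - T n \<zeta>)) \<longlonglongrightarrow> 0"
  proof -
    have "((\<lambda>R. sq_norm lebk_pair (\<lambda>\<zeta>. G \<zeta> - fourier_trunc 1 R \<gamma> (fst \<zeta>) (snd \<zeta>))) \<longlongrightarrow> 0) at_top"
      using F by (simp add: is_fourier_def G_def case_prod_unfold)
    from filterlim_compose[OF this filterlim_real_sequentially] show ?thesis by (simp add: T_def)
  qed
  define d where "d = (\<lambda>n. (LINT \<zeta>|lebk_pair. G \<zeta> * h \<zeta>) - (LINT \<zeta>|lebk_pair. T n \<zeta> * h \<zeta>))"
  have d: "ennreal ((cmod (d n))\<^sup>2) \<le> sq_norm lebk_pair (\<lambda>\<zeta>. G \<zeta> - T n \<zeta>) * sq_norm lebk_pair h" for n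
  proof -
    have "d n = (LINT \<zeta>|lebk_pair. (G \<zeta> - T n \<zeta>) * h \<zeta>)"
      unfolding d_def left_diff_distrib by (rule Bochner_Integration.integral_diff[OF Gh Ti, symmetric])
    moreover have "(\<lambda>\<zeta>. G \<zeta> - T n \<zeta>) \<in> borel_measurable lebk_pair"
      by (rule borel_measurable_diff[OF L2_measurable[OF G] T_measurable])
    ultimately show ?thesis by (simp only: L2_cauchy_schwarz_nn[OF _ L2_measurable[OF h2]])
  qed
  have "sq_norm lebk_pair h < \<infinity>" using h2 unfolding L2_def by blast
  then have h: "sq_norm lebk_pair h \<noteq> top" by (simp only: infinity_ennreal_def less_top)
  have "(\<lambda>n. sq_norm lebk_pair (\<lambda>\<zeta>. G \<zeta> - T n \<zeta>) * sq_norm lebk_pair h) \<longlonglongrightarrow> 0 * sq_norm lebk_pair h"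
    by (rule tendsto_mult_ennreal[OF sq tendsto_const]) (use h in \<open>simp only: infinity_ennreal_def ennreal_zero_neq_top simp_thms\<close>)
  then have "(\<lambda>n. ennreal ((cmod (d n))\<^sup>2)) \<longlonglongrightarrow> 0"
    unfolding mult_zero_left
    by (rule tendsto_sandwich[OF _ _ tendsto_const, rotated 2]) (use d in \<open>auto intro!: always_eventually\<close>)
  then have "(\<lambda>n. (cmod (d n))\<^sup>2) \<longlonglongrightarrow> 0"
    by (simp add: ennreal_tendsto_0_iff)
  from tendsto_real_sqrt[OF this] have "(\<lambda>n. cmod (d n)) \<longlonglongrightarrow> 0" by simp
  then have "d \<longlonglongrightarrow> 0" by (rule tendsto_norm_zero_cancel)
  from tendsto_diff[OF tendsto_const[of "LINT \<zeta>|lebk_pair. G \<zeta> * h \<zeta>"] this]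
  have 2: "(\<lambda>n. LINT \<zeta>|lebk_pair. T n \<zeta> * h \<zeta>) \<longlonglongrightarrow> (LINT \<zeta>|lebk_pair. G \<zeta> * h \<zeta>)"
    unfolding d_def by simp
  show ?thesis using LIMSEQ_unique[OF 2 1] by (simp only: G_def \<Gamma>_def)
qed

text \<open>The constant 2\<pi> results from two inversions, each contributing 2\<pi>, and the
  factor 1 / (2\<pi>) in \<open>fourier_trunc\<close>.\<close>

lemma fourier_pairing_cut_smooth:
  assumes F: "is_fourier 1 \<gamma> g" and f: "f1 \<in> cut_smooth R 3" "f2 \<in> cut_smooth R 3" and R: "0 < R"
  shows "integral\<^sup>L lebk_pair (\<lambda>(\<xi>, \<xi>'). g \<xi> \<xi>' * (fourier f1 (\<xi> 1) * fourier f2 (\<xi>' 1)))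
    = 2 * of_real pi * integral\<^sup>L lebk_pair (\<lambda>(x, x'). \<gamma> x x' * (f1 (x 1) * f2 (x' 1)))"
proof -
  let ?h = "\<lambda>(\<xi>, \<xi>'). fourier f1 (\<xi> 1) * fourier f2 (\<xi>' 1)"
  let ?k = "\<lambda>(x, x'). (2 * of_real pi * f1 (x 1)) * (2 * of_real pi * f2 (x' 1))"
  note S = sigma_finite_lebk
  have ft: "(LINT \<zeta>|lebk_pair. pair_phase z \<zeta> * ?h \<zeta>) = ?k z" for z
  proof -
    note [measurable] = cut_smooth_borel[OF f(1), THEN fourier_borel] cut_smooth_borel[OF f(2), THEN fourier_borel]
    have i: "integrable lborel (\<lambda>\<xi>. exp (- \<i> * of_real (\<xi> * y)) * fourier f \<xi>)" if "f \<in> cut_smooth R 3" for f y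
    proof (rule Bochner_Integration.integrable_bound[OF cut_smooth_fourier_integrable(1)[OF that R]])
      note [measurable] = cut_smooth_borel[OF that, THEN fourier_borel]
      show "(\<lambda>\<xi>. exp (- \<i> * of_real (\<xi> * y)) * fourier f \<xi>) \<in> borel_measurable lborel" by measurable
    qed (simp add: norm_mult)
    have "(\<lambda>\<zeta>. pair_phase z \<zeta> * ?h \<zeta>) = (\<lambda>(\<xi>, \<xi>'). (exp (- \<i> * of_real (\<xi> 1 * fst z 1)) * fourier f1 (\<xi> 1)) *
        (exp (- \<i> * of_real (\<xi>' 1 * snd z 1)) * fourier f2 (\<xi>' 1)))"
      by (auto simp: fun_eq_iff pair_phase_def exp_add[symmetric] ring_distribs exp_diff exp_minus field_simps)
    then have "(LINT \<zeta>|lebk_pair. pair_phase z \<zeta> * ?h \<zeta>)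
        = (LINT \<xi>|lebk 1. exp (- \<i> * of_real (\<xi> 1 * fst z 1)) * fourier f1 (\<xi> 1)) *
          (LINT \<xi>'|lebk 1. exp (- \<i> * of_real (\<xi>' 1 * snd z 1)) * fourier f2 (\<xi>' 1))"
      using integral_tensor[OF S S lebk_integrable[OF i[OF f(1)]] lebk_integrable[OF i[OF f(2)]]]
      by (simp only:)
    also have "\<dots> = (2 * of_real pi * f1 (fst z 1)) * (2 * of_real pi * f2 (snd z 1))"
      unfolding fourier_inversion[OF f(1) R, symmetric] fourier_inversion[OF f(2) R, symmetric]
      by (intro arg_cong2[where f = "(*)"] lebk_integral) measurable
    finally show ?thesis by (simp add: case_prod_unfold)
  qed
  have k: "?k \<in> L2 lebk_pair"
    by (intro L2_tensor(1)[OF S] L2_scale lebk_L2 cut_smooth_L2[OF f(1)] cut_smooth_L2[OF f(2)] R) auto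
  have "(LINT \<zeta>|lebk_pair. (case \<zeta> of (\<xi>, \<xi>') \<Rightarrow> g \<xi> \<xi>') * ?h \<zeta>)
    = of_real (1 / (2 * pi)) * (LINT z|lebk_pair. (case z of (x, x') \<Rightarrow> \<gamma> x x') * ?k z)"
    by (rule fourier_pairing[OF F integrable_tensor[OF S S
          lebk_integrable[OF cut_smooth_fourier_integrable(1)[OF f(1) R]] lebk_integrable[OF cut_smooth_fourier_integrable(1)[OF f(2) R]]]
        L2_tensor(1)[OF S lebk_L2[OF cut_smooth_fourier_L2[OF f(1) R]] lebk_L2[OF cut_smooth_fourier_L2[OF f(2) R]]] ft k])
  also have "(\<lambda>z. (case z of (x, x') \<Rightarrow> \<gamma> x x') * ?k z)
     = (\<lambda>z. (2 * of_real pi)\<^sup>2 * (case z of (x, x') \<Rightarrow> \<gamma> x x' * (f1 (x 1) * f2 (x' 1))))"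
    by (auto simp: fun_eq_iff power2_eq_square mult_ac)
  finally show ?thesis by (simp add: case_prod_unfold power2_eq_square)
qed

text \<open>S is moved from the kernel to the test functions. On the frequency side its multiplier
  is a polynomial and may be attached to the transforms of f1 and f2 instead, where it amounts to p
  applications of \<open>helmholtz\<close>. These leave index 3, as the inversion formula
  requires.\<close>

lemma is_S_pairing:
  assumes S: "is_S 1 (2 * real p) \<gamma> \<sigma>"
    and f: "f1 \<in> cut_smooth R (3 + 2 * p)" "f2 \<in> cut_smooth R (3 + 2 * p)" and R: "0 < R"
  shows "integral\<^sup>L lebk_pair (\<lambda>(x, x'). \<sigma> x x' * (f1 (x 1) * f2 (x' 1)))
    = integral\<^sup>L lebk_pair (\<lambda>(x, x'). \<gamma> x x' * ((helmholtz ^^ p) f1 (x 1) * (helmholtz ^^ p) f2 (x' 1)))"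
proof -
  obtain g where g: "is_fourier 1 \<gamma> g"
    and m: "is_fourier 1 \<sigma> (\<lambda>\<xi> \<xi>'. complex_of_real (\<Prod>j=1..1.
        (1 + (\<xi> j)\<^sup>2) powr (2 * real p / 2) * (1 + (\<xi>' j)\<^sup>2) powr (2 * real p / 2)) * g \<xi> \<xi>')"
    using S by (auto simp: is_S_def)
  have f3: "f1 \<in> cut_smooth R 3" "f2 \<in> cut_smooth R 3"
    using cut_smooth_mono[OF f(1)] cut_smooth_mono[OF f(2)] by auto
  note hf = cut_smooth_helmholtz_power[OF f(1) zero_less_numeral] cut_smooth_helmholtz_power[OF f(2) zero_less_numeral]
  have w: "complex_of_real (\<Prod>j=1..1. (1 + (\<xi> j)\<^sup>2) powr (2 * real p / 2) * (1 + (\<xi>' j)\<^sup>2) powr (2 * real p / 2)) * g \<xi> \<xi>'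
        * (fourier f1 (\<xi> 1) * fourier f2 (\<xi>' 1))
      = g \<xi> \<xi>' * (fourier ((helmholtz ^^ p) f1) (\<xi> 1) * fourier ((helmholtz ^^ p) f2) (\<xi>' 1))" for \<xi> \<xi>' :: "nat \<Rightarrow> real"
    by (simp add: fourier_helmholtz_power[OF f(1) zero_less_numeral R] fourier_helmholtz_power[OF f(2) zero_less_numeral R]
        powr_realpow add_pos_nonneg)
  show ?thesis
    using fourier_pairing_cut_smooth[OF m f3 R] fourier_pairing_cut_smooth[OF g hf R]
    unfolding w by simp
qed

subsection \<open>Sobolev bounds from the trace norm\<close>

lemma cutoff_bounds: "0 \<le> cutoff R k x" "cutoff R k x \<le> 1"
  by (auto simp: cutoff_def intro!: power_le_one)

lemma helmholtz_power_cnj: "smooth f \<Longrightarrow> (helmholtz ^^ p) (\<lambda>x. cnj (f x)) = (\<lambda>x. cnj ((helmholtz ^^ p) f x))"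
proof (induction p)
  case (Suc p)
  have "helmholtz (\<lambda>x. cnj (g x)) = (\<lambda>x. cnj (helmholtz g x))" if "smooth g" for g
    using that by (simp add: helmholtz_def xderiv_cnj smooth_xderiv)
  from this[OF smooth_helmholtz_power[OF Suc.prems]] Suc show ?case by simp
qed simp

lemma factorized_1: "factorized f 1 = (\<lambda>x x'. f (x 1) * cnj (f (x' 1)))"
  by (simp add: factorized_def)

text \<open>Let a be the cut-off integral and f the product of the cut-off c with u. Since \<gamma>
  factorizes, the form of \<sigma> at f is a^2, while the trace norm bounds it by T \<integral> c^2
  |u|^2 \<le> T a, as 0 \<le> c \<le> 1. Hence a \<le> T. The compact support of c makes a finite
  before u is known to be square integrable, so that a may be cancelled.\<close>

lemma h_norm_cutoff_bound:
  assumes \<phi>: "smooth \<phi>" and h: "h_norm 1 (2 * real p) (factorized \<phi> 1) < ennreal T" and R: "0 < R"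
  defines "u \<equiv> (helmholtz ^^ p) \<phi>"
  shows "(LINT x|lborel. cutoff R (3 + 2 * p) x * (cmod (u x))\<^sup>2) \<le> T"
proof -
  obtain \<sigma> where S: "is_S 1 (2 * real p) (factorized \<phi> 1) \<sigma>" and tr: "trace_norm 1 \<sigma> < ennreal T"
    using h by (auto simp: h_norm_def INF_less_iff)
  have \<sigma>: "L2_kernel 1 \<sigma>" using S by (auto simp: is_S_def is_fourier_def)
  have T: "0 \<le> T" using tr by (metis ennreal_neg not_less_zero linear)
  define c where "c = cutoff R (3 + 2 * p)"
  define f where "f = (\<lambda>x. of_real (c x) * u x)"
  have u: "smooth u" unfolding u_def by (rule smooth_helmholtz_power[OF \<phi>])
  have f: "f \<in> cut_smooth R (3 + 2 * p)" unfolding f_def c_def by (rule cut_smoothI[OF u])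
  have f': "(\<lambda>x. cnj (f x)) \<in> cut_smooth R (3 + 2 * p)" by (rule cut_smooth_cnj[OF f])
  have f2: "(\<lambda>x. f (x 1)) \<in> L2 (lebk 1)"
    using f R by (intro lebk_L2 cut_smooth_L2) auto
  note hf = cut_smooth_helmholtz_power[OF f zero_less_numeral] cut_smooth_helmholtz_power[OF f' zero_less_numeral]
  define a where "a = (LINT x|lborel. c x * (cmod (u x))\<^sup>2)"
  have a_eq: "(LINT x|lborel. u x * cnj (f x)) = of_real a" "(LINT x|lborel. cnj (u x) * f x) = of_real a"
  proof -
    have "u x * cnj (f x) = of_real (c x * (cmod (u x))\<^sup>2)" "cnj (u x) * f x = of_real (c x * (cmod (u x))\<^sup>2)" for x
      unfolding f_def of_real_mult complex_norm_square by (simp_all add: mult_ac)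
    then show "(LINT x|lborel. u x * cnj (f x)) = of_real a" "(LINT x|lborel. cnj (u x) * f x) = of_real a"
      unfolding a_def by (simp_all only: integral_complex_of_real)
  qed
  have "L2_inner (lebk 1) (\<lambda>x. f (x 1)) (kernel_op 1 \<sigma> (\<lambda>x. f (x 1)))
      = integral\<^sup>L lebk_pair (\<lambda>(x, y). \<sigma> x y * (cnj (f (x 1)) * f (y 1)))"
    unfolding kernel_op_eq using \<sigma>
    by (intro integral_op_bilinear(2)[OF sigma_finite_lebk _ f2 f2]) (simp only: L2_kernel_def)
  also have "\<dots> = integral\<^sup>L lebk_pair (\<lambda>(x, y). factorized \<phi> 1 x y *
      ((helmholtz ^^ p) (\<lambda>x. cnj (f x)) (x 1) * (helmholtz ^^ p) f (y 1)))"
    by (rule is_S_pairing[OF S f' f R])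
  also have "\<dots> = integral\<^sup>L lebk_pair (\<lambda>(x, y). (\<phi> (x 1) * (helmholtz ^^ p) (\<lambda>x. cnj (f x)) (x 1)) *
      (cnj (\<phi> (y 1)) * (helmholtz ^^ p) f (y 1)))"
    unfolding factorized_1 by (simp only: mult_ac)
  also have "\<dots> = (LINT x|lebk 1. \<phi> (x 1) * (helmholtz ^^ p) (\<lambda>x. cnj (f x)) (x 1)) *
      (LINT y|lebk 1. cnj (\<phi> (y 1)) * (helmholtz ^^ p) f (y 1))"
    by (rule integral_tensor[OF sigma_finite_lebk sigma_finite_lebk])
      (rule lebk_integrable[of "\<lambda>x. _ x * _ x"], rule cut_smooth_integrable(1)[OF cut_smooth_mult[OF hf(2) \<phi>] zero_less_numeral R],
       rule lebk_integrable[of "\<lambda>x. _ x * _ x"], rule cut_smooth_integrable(1)[OF cut_smooth_mult[OF hf(1) smooth_cnj[OF \<phi>]] zero_less_numeral R])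
  also have "(LINT x|lebk 1. \<phi> (x 1) * (helmholtz ^^ p) (\<lambda>x. cnj (f x)) (x 1))
      = (LINT x|lborel. \<phi> x * (helmholtz ^^ p) (\<lambda>x. cnj (f x)) x)"
    by (rule lebk_integral[OF cut_smooth_borel[OF cut_smooth_mult[OF hf(2) \<phi>]]])
  also have "\<dots> = of_real a"
    unfolding integral_helmholtz_power[OF f' zero_less_numeral R \<phi>] using a_eq(1) by (simp only: u_def)
  also have "(LINT y|lebk 1. cnj (\<phi> (y 1)) * (helmholtz ^^ p) f (y 1))
      = (LINT x|lborel. cnj (\<phi> x) * (helmholtz ^^ p) f x)"
    by (rule lebk_integral[OF cut_smooth_borel[OF cut_smooth_mult[OF hf(1) smooth_cnj[OF \<phi>]]]])
  also have "\<dots> = of_real a"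
    unfolding integral_helmholtz_power[OF f zero_less_numeral R smooth_cnj[OF \<phi>]] helmholtz_power_cnj[OF \<phi>]
    using a_eq(2) by (simp only: u_def)
  finally have inner: "L2_inner (lebk 1) (\<lambda>x. f (x 1)) (kernel_op 1 \<sigma> (\<lambda>x. f (x 1))) = of_real (a * a)"
    by (simp only: of_real_mult)
  have a0: "0 \<le> a" unfolding a_def c_def by (simp add: cutoff_bounds)
  have "a * a \<le> T * (LINT x|lebk 1. (cmod (f (x 1)))\<^sup>2)"
    using trace_norm_bound[OF \<sigma> tr f2] a0 unfolding inner by (simp add: norm_mult)
  also have "(LINT x|lebk 1. (cmod (f (x 1)))\<^sup>2) = (LINT x|lborel. (cmod (f x))\<^sup>2)"
  proof (rule lebk_integral[of "\<lambda>y. (cmod (f y))\<^sup>2"])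
    note [measurable] = cut_smooth_borel[OF f]
    show "(\<lambda>y. (cmod (f y))\<^sup>2) \<in> borel_measurable borel" by measurable
  qed
  also have "\<dots> \<le> a"
    unfolding a_def
  proof (rule integral_mono)
    show "integrable lborel (\<lambda>x. (cmod (f x))\<^sup>2)" by (rule cut_smooth_integrable(2)[OF f _ R]) simp
    have "integrable lborel (\<lambda>x. cmod (cnj (u x) * f x))"
      by (intro integrable_norm cut_smooth_integrable(1)[OF cut_smooth_mult[OF f smooth_cnj[OF u]] _ R]) simp
    then show "integrable lborel (\<lambda>x. c x * (cmod (u x))\<^sup>2)"
      by (simp add: f_def norm_mult c_def cutoff_bounds power2_eq_square mult_ac)
    fix x
    have "c x * c x * (cmod (u x))\<^sup>2 \<le> c x * 1 * (cmod (u x))\<^sup>2"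
      unfolding c_def by (intro mult_right_mono mult_left_mono cutoff_bounds) auto
    then show "(cmod (f x))\<^sup>2 \<le> c x * (cmod (u x))\<^sup>2"
      by (simp add: f_def norm_mult power2_eq_square c_def cutoff_bounds mult_ac)
  qed
  finally have "a * a \<le> T * a" using T by (simp add: mult_left_mono)
  then have "a \<le> T" using a0 T by (cases "a = 0") auto
  then show ?thesis by (simp add: a_def c_def)
qed

text \<open>The bound on the cut-off integrals does not depend on R, so Fatou's lemma carries it to
  the whole line.\<close>

lemma h_norm_sobolev_bound:
  assumes \<phi>: "smooth \<phi>" and h: "h_norm 1 (2 * real p) (factorized \<phi> 1) < ennreal T"
  shows "sq_norm lborel ((helmholtz ^^ p) \<phi>) \<le> ennreal T"
proof -
  define u where "u = (helmholtz ^^ p) \<phi>"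
  have u: "smooth u" unfolding u_def by (rule smooth_helmholtz_power[OF \<phi>])
  note [measurable] = smooth_borel[OF u]
  define c where "c = (\<lambda>n. cutoff (real (Suc n)) (3 + 2 * p))"
  have [measurable]: "c n \<in> borel_measurable borel" for n
    unfolding c_def cutoff_def by measurable
  have lim: "(\<lambda>n. ennreal (c n x * (cmod (u x))\<^sup>2)) \<longlonglongrightarrow> ennreal ((cmod (u x))\<^sup>2)" for x
  proof -
    have "(\<lambda>n. x * (1 / real (Suc n))) \<longlonglongrightarrow> 0"
      by (rule tendsto_mult_right_zero[OF LIMSEQ_Suc[OF lim_1_over_n]])
    then have "(\<lambda>n. max 0 (1 - (x * (1 / real (Suc n)))\<^sup>2) ^ (3 + 2 * p) * (cmod (u x))\<^sup>2)
        \<longlonglongrightarrow> max 0 (1 - 0\<^sup>2) ^ (3 + 2 * p) * (cmod (u x))\<^sup>2"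
      by (intro tendsto_mult tendsto_power tendsto_max tendsto_diff tendsto_const)
    then have "(\<lambda>n. c n x * (cmod (u x))\<^sup>2) \<longlonglongrightarrow> (cmod (u x))\<^sup>2"
      by (simp add: c_def cutoff_def)
    then show ?thesis by (rule tendsto_ennrealI)
  qed
  have le: "(\<integral>\<^sup>+x. ennreal (c n x * (cmod (u x))\<^sup>2) \<partial>lborel) \<le> ennreal T" for n
  proof -
    have R: "0 < real (Suc n)" by simp
    have "integrable lborel (\<lambda>x. cmod (cnj (u x) * (of_real (c n x) * u x)))"
      unfolding c_def by (intro integrable_norm cut_smooth_integrable(1)[OF cut_smooth_mult[OF cut_smoothI[OF u] smooth_cnj[OF u]] _ R]) simp
    then have "integrable lborel (\<lambda>x. c n x * (cmod (u x))\<^sup>2)"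
      by (simp add: norm_mult c_def cutoff_bounds power2_eq_square mult_ac)
    then have "(\<integral>\<^sup>+x. ennreal (c n x * (cmod (u x))\<^sup>2) \<partial>lborel) = ennreal (LINT x|lborel. c n x * (cmod (u x))\<^sup>2)"
      by (intro nn_integral_eq_integral) (auto simp: c_def cutoff_bounds)
    also have "\<dots> \<le> ennreal T"
      unfolding c_def u_def by (intro ennreal_leI h_norm_cutoff_bound[OF \<phi> h R])
    finally show ?thesis .
  qed
  have "sq_norm lborel u = (\<integral>\<^sup>+x. liminf (\<lambda>n. ennreal (c n x * (cmod (u x))\<^sup>2)) \<partial>lborel)"
    unfolding sq_norm_def by (simp add: lim_imp_Liminf[OF sequentially_bot lim])
  also have "\<dots> \<le> liminf (\<lambda>n. \<integral>\<^sup>+x. ennreal (c n x * (cmod (u x))\<^sup>2) \<partial>lborel)"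
    by (rule nn_integral_liminf) measurable
  also have "\<dots> \<le> ennreal T"
    by (rule order_trans[OF Liminf_mono Liminf_const[THEN eq_refl]]) (use le in \<open>auto intro: always_eventually\<close>)
  finally show ?thesis by (simp add: u_def)
qed

section \<open>Interpolation and Sobolev inequalities on the line\<close>

text \<open>Cauchy-Schwarz on the unit interval. The weights a to come are 1 - s and the constant
  -1.\<close>

lemma unit_integral_bound:
  fixes f :: "real \<Rightarrow> complex" and a :: "real \<Rightarrow> real" and x :: real
  assumes f: "continuous_on UNIV f" and a: "continuous_on UNIV a" "\<And>s. s \<in> {0..1} \<Longrightarrow> \<bar>a s\<bar> \<le> 1"
  shows "ennreal ((cmod (integral {0..1} (\<lambda>s. a s *\<^sub>R f (x + s))))\<^sup>2)
    \<le> (\<integral>\<^sup>+s. indicator {0..1} s * ennreal ((cmod (f (x + s)))\<^sup>2) \<partial>lborel)"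
proof -
  have fx: "continuous_on A (\<lambda>s. f (x + s))" for A
    by (intro continuous_on_compose2[OF f] continuous_intros) auto
  have ac: "continuous_on A a" for A using a(1) by (rule continuous_on_subset) simp
  have [measurable]: "(\<lambda>s. f (x + s)) \<in> borel_measurable borel" "a \<in> borel_measurable borel"
    using fx ac by (auto intro: borel_measurable_continuous_onI)
  have "set_integrable lborel {0..1} (\<lambda>s. a s *\<^sub>R f (x + s))"
    by (intro borel_integrable_atLeastAtMost' continuous_on_scaleR ac fx)
  from set_borel_integral_eq_integral(2)[OF this]
  have "(LINT s|lborel. indicator {0..1} s *\<^sub>R (a s *\<^sub>R f (x + s))) = integral {0..1} (\<lambda>s. a s *\<^sub>R f (x + s))"
    by (simp only: set_lebesgue_integral_def)
  moreover have "(\<lambda>s. indicator {0..1} s *\<^sub>R (a s *\<^sub>R f (x + s)))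
      = (\<lambda>s. of_real (indicator {0..1} s * a s) * (of_real (indicator {0..1} s) * f (x + s)))"
    by (auto simp: fun_eq_iff indicator_def scaleR_conv_of_real)
  ultimately have "integral {0..1} (\<lambda>s. a s *\<^sub>R f (x + s))
      = (LINT s|lborel. of_real (indicator {0..1} s * a s) * (of_real (indicator {0..1} s) * f (x + s)))"
    by (simp only:)
  then have "ennreal ((cmod (integral {0..1} (\<lambda>s. a s *\<^sub>R f (x + s))))\<^sup>2)
      \<le> sq_norm lborel (\<lambda>s. of_real (indicator {0..1} s * a s)) * sq_norm lborel (\<lambda>s. of_real (indicator {0..1} s) * f (x + s))"
    by (simp only:) (rule L2_cauchy_schwarz_nn; measurable)
  also have "\<dots> \<le> 1 * sq_norm lborel (\<lambda>s. of_real (indicator {0..1} s) * f (x + s))"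
  proof (rule mult_right_mono)
    have "sq_norm lborel (\<lambda>s. of_real (indicator {0..1} s * a s)) \<le> (\<integral>\<^sup>+s. indicator {0..1} s \<partial>(lborel :: real measure))"
      unfolding sq_norm_def
      by (intro nn_integral_mono) (use a(2) in \<open>auto simp: indicator_def abs_square_le_1\<close>)
    then show "sq_norm lborel (\<lambda>s::real. complex_of_real (indicator {0..1} s * a s)) \<le> 1" by simp
  qed simp
  also have "sq_norm lborel (\<lambda>s. of_real (indicator {0..1} s) * f (x + s))
      = (\<integral>\<^sup>+s. indicator {0..1} s * ennreal ((cmod (f (x + s)))\<^sup>2) \<partial>lborel)"
    unfolding sq_norm_def by (intro nn_integral_cong) (auto simp: indicator_def)
  finally show ?thesis by simp
qed

lemma sq_norm_translate:
  fixes f :: "real \<Rightarrow> complex"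
  assumes [measurable]: "f \<in> borel_measurable borel"
  shows "(\<integral>\<^sup>+x. ennreal ((cmod (f (x + s)))\<^sup>2) \<partial>lborel) = sq_norm lborel f"
  unfolding sq_norm_def
  using nn_integral_real_affine[of "\<lambda>x. ennreal ((cmod (f x))\<^sup>2)" 1 s] by (simp add: add.commute)

lemma ennreal_square_add3:
  fixes a b c :: real
  assumes "0 \<le> d" "d \<le> a + b + c" "0 \<le> a" "0 \<le> b" "0 \<le> c"
  shows "ennreal (d\<^sup>2) \<le> 3 * (ennreal (a\<^sup>2) + ennreal (b\<^sup>2) + ennreal (c\<^sup>2))"
proof -
  have "d\<^sup>2 \<le> (a + b + c)\<^sup>2" using assms by (intro power_mono) auto
  also have "\<dots> \<le> 3 * (a\<^sup>2 + b\<^sup>2 + c\<^sup>2)"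
    using zero_le_power2[of "a - b"] zero_le_power2[of "b - c"] zero_le_power2[of "a - c"]
    by (simp add: power2_eq_square algebra_simps)
  finally have "ennreal (d\<^sup>2) \<le> ennreal (3 * (a\<^sup>2 + b\<^sup>2 + c\<^sup>2))" by (rule ennreal_leI)
  then show ?thesis by (simp add: ennreal_mult)
qed

lemma smooth_shift:
  assumes "smooth f" shows "((\<lambda>s. f (x + s)) has_vector_derivative xderiv f (x + s)) (at s within A)"
proof -
  have "((\<lambda>s. x + s) has_vector_derivative 1) (at s within A)"
    by (auto intro!: derivative_eq_intros)
  from vector_diff_chain_within[OF this, of f "xderiv f (x + s)"] show ?thesis
    using has_vector_derivative_at_within[OF smooth_has_xderiv[OF assms]] by (simp add: o_def)
qed

text \<open>Taylor's formula on \<open>[x, x + 1]\<close> expresses \<open>f' x\<close> through \<open>f\<close> and \<open>f''\<close>.\<close>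

lemma sq_norm_xderiv_interpolation:
  assumes f: "smooth f"
  shows "sq_norm lborel (xderiv f) \<le> 3 * (sq_norm lborel f + sq_norm lborel f + sq_norm lborel (xderiv (xderiv f)))"
proof -
  let ?g = "xderiv (xderiv f)"
  have g: "smooth ?g" using f by (intro smooth_xderiv)
  note [measurable] = smooth_borel[OF f] smooth_borel[OF g]
  let ?I = "\<lambda>x. integral {0..1} (\<lambda>s. (1 - s) *\<^sub>R ?g (x + s))"
  have taylor: "xderiv f x = f (x + 1) - f x - ?I x" for x
  proof -
    have "((\<lambda>s. (1 - s) *\<^sub>R xderiv f (x + s) + f (x + s)) has_vector_derivative (1 - s) *\<^sub>R ?g (x + s)) (at s within {0..1})" for s
      by (rule has_vector_derivative_eq_rhs[OF has_vector_derivative_add[OF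
            has_vector_derivative_scaleR[OF DERIV_diff[OF DERIV_const DERIV_ident] smooth_shift[OF smooth_xderiv[OF f]]] smooth_shift[OF f]]]) simp
    then have "((\<lambda>s. (1 - s) *\<^sub>R ?g (x + s)) has_integral
        ((1 - 1) *\<^sub>R xderiv f (x + 1) + f (x + 1)) - ((1 - 0) *\<^sub>R xderiv f (x + 0) + f (x + 0))) {0..1}"
      by (intro fundamental_theorem_of_calculus) auto
    then show ?thesis by (simp add: integral_unique)
  qed
  have "ennreal ((cmod (xderiv f x))\<^sup>2) \<le> 3 * (ennreal ((cmod (f (x + 1)))\<^sup>2) + ennreal ((cmod (f x))\<^sup>2)
      + (\<integral>\<^sup>+s. indicator {0..1} s * ennreal ((cmod (?g (x + s)))\<^sup>2) \<partial>lborel))" for x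
  proof -
    have "cmod (xderiv f x) \<le> cmod (f (x + 1)) + cmod (f x) + cmod (?I x)"
      unfolding taylor[of x]
      using norm_triangle_ineq4[of "f (x + 1) - f x" "?I x"] norm_triangle_ineq4[of "f (x + 1)" "f x"] by linarith
    from ennreal_square_add3[OF norm_ge_zero this norm_ge_zero norm_ge_zero norm_ge_zero]
    have "ennreal ((cmod (xderiv f x))\<^sup>2) \<le> 3 * (ennreal ((cmod (f (x + 1)))\<^sup>2) + ennreal ((cmod (f x))\<^sup>2) + ennreal ((cmod (?I x))\<^sup>2))" .
    also have "\<dots> \<le> 3 * (ennreal ((cmod (f (x + 1)))\<^sup>2) + ennreal ((cmod (f x))\<^sup>2)
      + (\<integral>\<^sup>+s. indicator {0..1} s * ennreal ((cmod (?g (x + s)))\<^sup>2) \<partial>lborel))"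
      by (intro mult_left_mono add_left_mono unit_integral_bound smooth_continuous[OF g]) (auto intro!: continuous_intros)
    finally show ?thesis .
  qed
  then have "sq_norm lborel (xderiv f) \<le> (\<integral>\<^sup>+x. 3 * (ennreal ((cmod (f (x + 1)))\<^sup>2) + ennreal ((cmod (f x))\<^sup>2)
      + (\<integral>\<^sup>+s. indicator {0..1} s * ennreal ((cmod (?g (x + s)))\<^sup>2) \<partial>lborel)) \<partial>lborel)"
    unfolding sq_norm_def[of _ "xderiv f"] by (intro nn_integral_mono)
  also have "\<dots> = 3 * ((\<integral>\<^sup>+x. ennreal ((cmod (f (x + 1)))\<^sup>2) \<partial>lborel) + sq_norm lborel f
      + (\<integral>\<^sup>+x. \<integral>\<^sup>+s. indicator {0..1} s * ennreal ((cmod (?g (x + s)))\<^sup>2) \<partial>lborel \<partial>lborel))"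
    unfolding sq_norm_def by (simp add: nn_integral_cmult nn_integral_add)
  \<comment> \<open>After exchanging the integrals every shift by s has the same norm, and the
    average over the unit interval costs nothing.\<close>
  also have "(\<integral>\<^sup>+x. \<integral>\<^sup>+s. indicator {0..1} s * ennreal ((cmod (?g (x + s)))\<^sup>2) \<partial>lborel \<partial>lborel)
      = (\<integral>\<^sup>+s. \<integral>\<^sup>+x. indicator {0..1} s * ennreal ((cmod (?g (x + s)))\<^sup>2) \<partial>lborel \<partial>lborel)"
    by (rule lborel_pair.Fubini'[symmetric]) measurable
  also have "\<dots> = (\<integral>\<^sup>+s. indicator {0..1} s * sq_norm lborel ?g \<partial>(lborel :: real measure))"
    by (simp add: nn_integral_cmult sq_norm_translate)
  also have "\<dots> = sq_norm lborel ?g"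
    by (simp add: nn_integral_multc)
  finally show ?thesis by (simp add: sq_norm_translate)
qed

text \<open>The Sobolev inequality in one dimension. The weight 1 - s equals 1 at s = 0 and 0 at s =
  1, so integrating the derivative of (1 - s) f (x + s) over the unit interval recovers - f x from
  averages of f and f'.\<close>

lemma sup_bound:
  assumes f: "smooth f"
  shows "ennreal ((cmod (f x))\<^sup>2) \<le> 3 * (sq_norm lborel f + sq_norm lborel (xderiv f))"
proof -
  have g: "smooth (xderiv f)" using f by (intro smooth_xderiv)
  note [measurable] = smooth_borel[OF f] smooth_borel[OF g]
  let ?I = "integral {0..1} (\<lambda>s. (-1) *\<^sub>R f (x + s))" and ?J = "integral {0..1} (\<lambda>s. (1 - s) *\<^sub>R xderiv f (x + s))"
  have sh: "continuous_on A (\<lambda>s. h (x + s))" if "smooth h" for h A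
    by (rule continuous_on_compose2[OF smooth_continuous[OF that, of UNIV]]) (auto intro!: continuous_intros)
  have "((\<lambda>s. (1 - s) *\<^sub>R f (x + s)) has_vector_derivative (-1) *\<^sub>R f (x + s) + (1 - s) *\<^sub>R xderiv f (x + s)) (at s within {0..1})" for s
    by (rule has_vector_derivative_eq_rhs[OF
          has_vector_derivative_scaleR[OF DERIV_diff[OF DERIV_const DERIV_ident] smooth_shift[OF f]]]) simp
  then have "((\<lambda>s. (-1) *\<^sub>R f (x + s) + (1 - s) *\<^sub>R xderiv f (x + s)) has_integral
      ((1 - 1) *\<^sub>R f (x + 1)) - ((1 - 0) *\<^sub>R f (x + 0))) {0..1}"
    by (intro fundamental_theorem_of_calculus) auto
  then have "integral {0..1} (\<lambda>s. (-1) *\<^sub>R f (x + s) + (1 - s) *\<^sub>R xderiv f (x + s)) = - f x"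
    by (simp add: integral_unique)
  moreover have "integral {0..1} (\<lambda>s. (-1) *\<^sub>R f (x + s) + (1 - s) *\<^sub>R xderiv f (x + s)) = ?I + ?J"
    by (intro integral_add integrable_continuous_interval continuous_intros sh f g)
  ultimately have "- f x = ?I + ?J" by simp
  then have "cmod (f x) = cmod (?I + ?J)" by (metis norm_minus_cancel)
  then have "cmod (f x) \<le> cmod ?I + cmod ?J + 0"
    using norm_triangle_ineq[of ?I ?J] by simp
  from ennreal_square_add3[OF norm_ge_zero this norm_ge_zero norm_ge_zero order_refl]
  have "ennreal ((cmod (f x))\<^sup>2) \<le> 3 * (ennreal ((cmod ?I)\<^sup>2) + ennreal ((cmod ?J)\<^sup>2))" by simp
  also have "\<dots> \<le> 3 * (sq_norm lborel f + sq_norm lborel (xderiv f))"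
  proof (intro mult_left_mono add_mono)
    have U: "(\<integral>\<^sup>+s. indicator {0..1} s * ennreal ((cmod (h (x + s)))\<^sup>2) \<partial>lborel) \<le> sq_norm lborel h" if "smooth h" for h
    proof -
      have "(\<integral>\<^sup>+s. indicator {0..1} s * ennreal ((cmod (h (x + s)))\<^sup>2) \<partial>lborel) \<le> (\<integral>\<^sup>+s. ennreal ((cmod (h (s + x)))\<^sup>2) \<partial>lborel)"
        by (intro nn_integral_mono) (auto simp: indicator_def add.commute)
      then show ?thesis by (simp add: sq_norm_translate smooth_borel[OF that])
    qed
    show "ennreal ((cmod ?I)\<^sup>2) \<le> sq_norm lborel f"
      by (rule order_trans[OF unit_integral_bound U[OF f]]) (auto intro!: continuous_intros smooth_continuous f)
    show "ennreal ((cmod ?J)\<^sup>2) \<le> sq_norm lborel (xderiv f)"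
      by (rule order_trans[OF unit_integral_bound U[OF g]]) (auto intro!: continuous_intros smooth_continuous g)
  qed simp
  finally show ?thesis .
qed

section \<open>Families bounded in L2 and in the supremum norm, uniformly in the index\<close>

definition L2_bounded :: "('i \<Rightarrow> real \<Rightarrow> complex) \<Rightarrow> bool" where
  "L2_bounded u \<longleftrightarrow> (\<exists>C<top. \<forall>i. sq_norm lborel (u i) \<le> C)"

lemma sq_norm_add_le:
  assumes [measurable]: "f \<in> borel_measurable borel" "g \<in> borel_measurable borel"
  shows "sq_norm lborel (\<lambda>x. f x + g x) \<le> 3 * (sq_norm lborel f + sq_norm lborel g)"
proof -
  have "ennreal ((cmod (f x + g x))\<^sup>2) \<le> 3 * (ennreal ((cmod (f x))\<^sup>2) + ennreal ((cmod (g x))\<^sup>2))" for x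
    using ennreal_square_add3[of "cmod (f x + g x)" "cmod (f x)" "cmod (g x)" 0] norm_triangle_ineq[of "f x" "g x"] by simp
  then have "sq_norm lborel (\<lambda>x. f x + g x) \<le> (\<integral>\<^sup>+x. 3 * (ennreal ((cmod (f x))\<^sup>2) + ennreal ((cmod (g x))\<^sup>2)) \<partial>lborel)"
    unfolding sq_norm_def by (intro nn_integral_mono)
  then show ?thesis unfolding sq_norm_def by (simp add: nn_integral_cmult nn_integral_add)
qed

lemma L2_boundedI: "(\<And>i. sq_norm lborel (u i) \<le> C) \<Longrightarrow> C < top \<Longrightarrow> L2_bounded u"
  unfolding L2_bounded_def by blast

lemma L2_boundedD:
  assumes "L2_bounded u"
  obtains C where "\<And>i. sq_norm lborel (u i) \<le> C" "C < top"
  using assms unfolding L2_bounded_def by blast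

lemma L2_bounded_add:
  assumes s: "\<And>i. smooth (u i)" "\<And>i. smooth (v i)" and u: "L2_bounded u" and v: "L2_bounded v"
  shows "L2_bounded (\<lambda>i x. u i x + v i x)"
proof -
  obtain C where C: "\<And>i. sq_norm lborel (u i) \<le> C" "C < top" by (rule L2_boundedD[OF u]) (rule that)
  obtain D where D: "\<And>i. sq_norm lborel (v i) \<le> D" "D < top" by (rule L2_boundedD[OF v]) (rule that)
  show ?thesis
  proof (rule L2_boundedI)
    show "sq_norm lborel (\<lambda>x. u i x + v i x) \<le> 3 * (C + D)" for i
      by (rule order_trans[OF sq_norm_add_le[OF s[THEN smooth_borel]]]) (intro mult_left_mono add_mono C D, simp)
  qed (use C D in \<open>simp add: ennreal_mult_less_top\<close>)
qed

lemma L2_bounded_scale: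
  assumes s: "\<And>i. smooth (u i)" and u: "L2_bounded u"
  shows "L2_bounded (\<lambda>i x. c * u i x)"
proof -
  obtain C where C: "\<And>i. sq_norm lborel (u i) \<le> C" "C < top" by (rule L2_boundedD[OF u]) (rule that)
  note [measurable] = smooth_borel[OF s]
  have eq: "sq_norm lborel (\<lambda>x. c * u i x) = ennreal ((cmod c)\<^sup>2) * sq_norm lborel (u i)" for i
    unfolding sq_norm_def by (simp add: norm_mult power_mult_distrib ennreal_mult nn_integral_cmult)
  show ?thesis
    by (rule L2_boundedI[where C = "ennreal ((cmod c)\<^sup>2) * C"])
      (use C in \<open>auto simp: eq ennreal_mult_less_top intro: mult_left_mono\<close>)
qed

lemma L2_bounded_xderiv:
  assumes s: "\<And>i. smooth (u i)" and u: "L2_bounded u" "L2_bounded (\<lambda>i. xderiv (xderiv (u i)))"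
  shows "L2_bounded (\<lambda>i. xderiv (u i))"
proof -
  obtain C where C: "\<And>i. sq_norm lborel (u i) \<le> C" "C < top" by (rule L2_boundedD[OF u(1)]) (rule that)
  obtain D where D: "\<And>i. sq_norm lborel (xderiv (xderiv (u i))) \<le> D" "D < top"
    by (rule L2_boundedD[OF u(2)]) (rule that)
  show ?thesis
  proof (rule L2_boundedI)
    show "sq_norm lborel (xderiv (u i)) \<le> 3 * (C + C + D)" for i
      by (rule order_trans[OF sq_norm_xderiv_interpolation[OF s]]) (intro mult_left_mono add_mono C D, simp)
  qed (use C D in \<open>simp add: ennreal_mult_less_top\<close>)
qed

lemma helmholtz_power_xderiv: "smooth f \<Longrightarrow> (helmholtz ^^ p) (xderiv f) = xderiv ((helmholtz ^^ p) f)"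
proof (induction p)
  case (Suc p)
  have "helmholtz (xderiv g) = xderiv (helmholtz g)" if "smooth g" for g
    using that by (simp add: helmholtz_def xderiv_diff smooth_xderiv)
  from this[OF smooth_helmholtz_power[OF Suc.prems]] Suc show ?case by simp
qed simp

text \<open>The hypothesis on all powers of 1 - \<Delta> passes from u to u', after which the
  induction repeats. For v = (1 - \<Delta>)^p u, the second derivative is v minus the next power, so
  v and v'' are bounded in L2; interpolation bounds v', which is (1 - \<Delta>)^p u'.\<close>

lemma L2_bounded_derivatives:
  assumes s: "\<And>i. smooth (u i)" and h: "\<And>p. L2_bounded (\<lambda>i. (helmholtz ^^ p) (u i))"
  shows "L2_bounded (\<lambda>i. (xderiv ^^ m) (u i))"
  using assms
proof (induction m arbitrary: u)
  case 0
  show ?case using "0.prems"(2)[of 0] by simp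
next
  case (Suc m)
  have "L2_bounded (\<lambda>i. (helmholtz ^^ p) (xderiv (u i)))" for p
  proof -
    let ?v = "\<lambda>i. (helmholtz ^^ p) (u i)"
    have v: "smooth (?v i)" for i by (rule smooth_helmholtz_power[OF Suc.prems(1)])
    have "xderiv (xderiv (?v i)) = (\<lambda>x. ?v i x + (-1) * (helmholtz ^^ Suc p) (u i) x)" for i
      by (simp add: helmholtz_def)
    moreover have "L2_bounded (\<lambda>i x. ?v i x + (-1) * (helmholtz ^^ Suc p) (u i) x)"
      by (intro L2_bounded_add L2_bounded_scale smooth_helmholtz_power Suc.prems smooth_mult smooth_const)
    ultimately have "L2_bounded (\<lambda>i. xderiv (xderiv (?v i)))" by simp
    with L2_bounded_xderiv[OF v Suc.prems(2)] show ?thesis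
      by (simp add: helmholtz_power_xderiv[OF Suc.prems(1)])
  qed
  from Suc.IH[OF smooth_xderiv[OF Suc.prems(1)] this] show ?case
    by (simp add: funpow_Suc_right del: funpow.simps)
qed

text \<open>The sup bound is included because boundedness in L2 alone is not preserved by
  products.\<close>

definition bounded_L2 :: "('i \<Rightarrow> real \<Rightarrow> complex) \<Rightarrow> bool" where
  "bounded_L2 u \<longleftrightarrow> L2_bounded u \<and> (\<exists>C. \<forall>i x. cmod (u i x) \<le> C)"

lemma bounded_L2_mult:
  assumes s: "\<And>i. smooth (u i)" "\<And>i. smooth (v i)" and u: "bounded_L2 u" and v: "bounded_L2 v"
  shows "bounded_L2 (\<lambda>i x. u i x * v i x)"
proof -
  obtain C where C: "\<And>i x. cmod (u i x) \<le> C" using u by (auto simp: bounded_L2_def)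
  obtain D where D: "\<And>i x. cmod (v i x) \<le> D" using v by (auto simp: bounded_L2_def)
  obtain E where E: "\<And>i. sq_norm lborel (v i) \<le> E" "E < top"
    using v L2_boundedD[of v] unfolding bounded_L2_def by blast
  have C0: "0 \<le> C" using order_trans[OF norm_ge_zero C] .
  have "cmod (u i x * v i x) \<le> C * D" for i x
    unfolding norm_mult using C0 by (intro mult_mono C D) auto
  moreover have "sq_norm lborel (\<lambda>x. u i x * v i x) \<le> ennreal (C\<^sup>2) * E" for i
  proof -
    note [measurable] = smooth_borel[OF s(2)]
    have "sq_norm lborel (\<lambda>x. u i x * v i x) \<le> (\<integral>\<^sup>+x. ennreal (C\<^sup>2) * ennreal ((cmod (v i x))\<^sup>2) \<partial>lborel)"
      unfolding sq_norm_def
      by (intro nn_integral_mono) (auto simp: norm_mult power_mult_distrib C intro!: ennreal_leI mult_right_mono power_mono simp flip: ennreal_mult)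
    also have "\<dots> = ennreal (C\<^sup>2) * sq_norm lborel (v i)"
      unfolding sq_norm_def by (intro nn_integral_cmult) measurable
    also have "\<dots> \<le> ennreal (C\<^sup>2) * E"
      by (intro mult_left_mono E) simp
    finally show ?thesis .
  qed
  moreover have "ennreal (C\<^sup>2) * E < top" using E(2) by (simp add: ennreal_mult_less_top)
  ultimately show ?thesis unfolding bounded_L2_def L2_bounded_def by blast
qed

lemma family_class_bounded_L2: "family_class bounded_L2"
proof
  fix u v :: "'i \<Rightarrow> real \<Rightarrow> complex"
  assume s: "\<And>i. smooth (u i)" and u: "bounded_L2 u"
  obtain C where C: "\<And>i x. cmod (u i x) \<le> C" using u by (auto simp: bounded_L2_def)
  show "bounded_L2 (\<lambda>i x. c * u i x)" for c
  proof -
    have "cmod (c * u i x) \<le> cmod c * C" for i x by (simp add: norm_mult mult_left_mono C)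
    then show ?thesis using u s L2_bounded_scale[of u c] unfolding bounded_L2_def by blast
  qed
  show "bounded_L2 (\<lambda>i x. cnj (u i x))"
    using u by (simp add: bounded_L2_def L2_bounded_def sq_norm_def)
  assume s': "\<And>i. smooth (v i)" and v: "bounded_L2 v"
  show "bounded_L2 (\<lambda>i x. u i x * v i x)" by (rule bounded_L2_mult[OF s s' u v])
  obtain D where D: "\<And>i x. cmod (v i x) \<le> D" using v by (auto simp: bounded_L2_def)
  have "cmod (u i x + v i x) \<le> C + D" for i x by (intro norm_triangle_le add_mono C D)
  then show "bounded_L2 (\<lambda>i x. u i x + v i x)"
    using u v s s' L2_bounded_add[of u v] unfolding bounded_L2_def by blast
qed

lemma tower_bounded_L2:
  assumes s: "\<And>i. smooth (u i)" and h: "\<And>p. L2_bounded (\<lambda>i. (helmholtz ^^ p) (u i))"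
  shows "tower bounded_L2 u"
  unfolding tower_def
proof (intro conjI allI s)
  fix m
  note b = L2_bounded_derivatives[OF s h]
  obtain C where C: "\<And>i. sq_norm lborel ((xderiv ^^ m) (u i)) \<le> C" "C < top"
    by (rule L2_boundedD[OF b[of m]]) (rule that)
  obtain D where D: "\<And>i. sq_norm lborel (xderiv ((xderiv ^^ m) (u i))) \<le> D" "D < top"
    by (rule L2_boundedD[OF b[of "Suc m"]]) (auto intro: that)
  have "3 * (C + D) < top" using C D by (simp add: ennreal_mult_less_top)
  then obtain E where E: "3 * (C + D) = ennreal E" "0 \<le> E" by (cases "3 * (C + D)") auto
  \<comment> \<open>The L2 bounds for the derivatives of orders m and m + 1 give the sup bound for
    order m.\<close>
  have "cmod ((xderiv ^^ m) (u i) x) \<le> sqrt E" for i x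
  proof -
    have "ennreal ((cmod ((xderiv ^^ m) (u i) x))\<^sup>2) \<le> ennreal E"
      unfolding E(1)[symmetric]
      by (rule order_trans[OF sup_bound[OF smooth_xderiv_power[OF s]]]) (intro mult_left_mono add_mono C D, simp)
    then show ?thesis by (intro real_le_rsqrt) (simp only: ennreal_le_iff[OF E(2)])
  qed
  with b[of m] show "bounded_L2 (\<lambda>i. (xderiv ^^ m) (u i))"
    unfolding bounded_L2_def by blast
qed

lemma bounded_L2_product:
  assumes s: "\<And>i. smooth (u i)" "\<And>i. smooth (v i)" and u: "bounded_L2 u" and v: "bounded_L2 v"
  shows "integrable lborel (\<lambda>x. u i x * v i x)"
    and "\<exists>C. \<forall>i. (LINT x|lborel. cmod (u i x * v i x)) \<le> C"
proof -
  obtain C where C: "\<And>i. sq_norm lborel (u i) \<le> C" "C < top"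
    using u L2_boundedD[of u] unfolding bounded_L2_def by blast
  obtain D where D: "\<And>i. sq_norm lborel (v i) \<le> D" "D < top"
    using v L2_boundedD[of v] unfolding bounded_L2_def by blast
  have L2: "u i \<in> L2 lborel" "v i \<in> L2 lborel" for i
    using le_less_trans[OF C] le_less_trans[OF D] s[THEN smooth_borel] by (auto simp: L2_def)
  show i: "integrable lborel (\<lambda>x. u i x * v i x)" for i
    by (rule L2_mult_integrable[OF L2])
  have "ennreal (LINT x|lborel. cmod (u i x * v i x)) \<le> C + D" for i
  proof -
    note [measurable] = s[THEN smooth_borel]
    have "ennreal (LINT x|lborel. cmod (u i x * v i x)) = (\<integral>\<^sup>+x. ennreal (cmod (u i x * v i x)) \<partial>lborel)"
      by (intro nn_integral_eq_integral[symmetric] integrable_norm i) simp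
    also have "\<dots> \<le> (\<integral>\<^sup>+x. ennreal ((cmod (u i x))\<^sup>2) + ennreal ((cmod (v i x))\<^sup>2) \<partial>lborel)"
    proof (rule nn_integral_mono)
      fix x
      have "2 * (cmod (u i x) * cmod (v i x)) \<le> (cmod (u i x))\<^sup>2 + (cmod (v i x))\<^sup>2"
        using sum_squares_bound[of "cmod (u i x)" "cmod (v i x)"] by simp
      moreover have "0 \<le> cmod (u i x) * cmod (v i x)" by simp
      ultimately have "cmod (u i x * v i x) \<le> (cmod (u i x))\<^sup>2 + (cmod (v i x))\<^sup>2"
        unfolding norm_mult by linarith
      then show "ennreal (cmod (u i x * v i x)) \<le> ennreal ((cmod (u i x))\<^sup>2) + ennreal ((cmod (v i x))\<^sup>2)"
        using ennreal_leI by fastforce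
    qed
    also have "\<dots> = sq_norm lborel (u i) + sq_norm lborel (v i)"
      unfolding sq_norm_def by (rule nn_integral_add) measurable
    also have "\<dots> \<le> C + D" by (intro add_mono C D)
    finally show ?thesis .
  qed
  moreover obtain E where "C + D = ennreal E" "0 \<le> E"
    using C(2) D(2) by (cases "C + D") auto
  ultimately show "\<exists>C. \<forall>i. (LINT x|lborel. cmod (u i x * v i x)) \<le> C"
    by (auto simp: ennreal_le_iff)
qed

subsection \<open>Conservation\<close>

interpretation BL: family_class bounded_L2
  by (rule family_class_bounded_L2)

text \<open>Differentiability in time gives continuity of \<psi> in time; that of its second space
  derivative, and hence of \<open>nls_rhs\<close>, comes from two uses of
  \<open>time_continuous_xderiv\<close>.\<close>

lemma nls_evolves:
  assumes \<psi>: "tower locally_bounded \<psi>"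
    and der: "\<And>t x. t \<ge> 0 \<Longrightarrow> ((\<lambda>s. \<psi> s x) has_vector_derivative nls_rhs \<kappa> (\<psi> t) x) (at t within {0..})"
  shows "evolves \<psi> (\<lambda>t. nls_rhs \<kappa> (\<psi> t))"
proof -
  have c: "time_continuous \<psi>"
    unfolding time_continuous_def using der
    by (intro allI continuous_on_vector_derivative) auto
  have c2: "time_continuous (\<lambda>t. xderiv (xderiv (\<psi> t)))"
    by (intro time_continuous_xderiv tower_xderiv \<psi> c)
  have eq: "nls_rhs \<kappa> (\<psi> t) = (\<lambda>x. \<i> * xderiv (xderiv (\<psi> t)) x + (- 2 * \<i> * of_real \<kappa>) * (\<psi> t x * \<psi> t x * cnj (\<psi> t x)))" for t
    by (simp add: nls_rhs_def)
  have "tower locally_bounded (\<lambda>t. nls_rhs \<kappa> (\<psi> t))"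
    unfolding eq
    by (rule LB.tower_add[OF LB.tower_scale[OF tower_xderiv[OF tower_xderiv[OF \<psi>]]]
          LB.tower_scale[OF LB.tower_mult[OF LB.tower_mult[OF \<psi> \<psi>] LB.tower_cnj[OF \<psi>]]]])
  moreover have "time_continuous (\<lambda>t. nls_rhs \<kappa> (\<psi> t))"
    using c c2 unfolding eq time_continuous_def by (intro allI continuous_intros) auto
  ultimately show ?thesis using \<psi> c der by (simp add: evolves_def)
qed

lemma conservation:
  assumes \<psi>: "evolves \<psi> (\<lambda>t. nls_rhs \<kappa> (\<psi> t))" and B: "tower bounded_L2 \<psi>"
    and n: "0 < n" and t: "0 \<le> t"
  shows "(LINT x|lborel. cnj (\<psi> t x) * w \<kappa> (\<psi> t) n x) = (LINT x|lborel. cnj (\<psi> 0 x) * w \<kappa> (\<psi> 0) n x)"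
proof -
  note tw = BL.tower_w[OF B, of \<kappa>]
  note tc = BL.tower_cnj[OF B] and tcx = BL.tower_cnj[OF tower_xderiv[OF B]]
  have prod: "integrable lborel (\<lambda>x. u i x * v i x)" "\<exists>C. \<forall>i. (LINT x|lborel. cmod (u i x * v i x)) \<le> C"
    if "tower bounded_L2 u" "tower bounded_L2 v" for u v :: "real \<Rightarrow> real \<Rightarrow> complex" and i
    using bounded_L2_product[OF tower_smooth[OF that(1)] tower_smooth[OF that(2)] tower_base[OF that(1)] tower_base[OF that(2)]]
    by auto
  \<comment> \<open>The flux is a sum of two products of families bounded in L2, so each product is
    bounded in L1 uniformly in time.\<close>
  obtain C1 where C1: "\<And>t. (LINT x|lborel. cmod (cnj (\<psi> t x) * w \<kappa> (\<psi> t) (Suc n) x)) \<le> C1"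
    using prod(2)[OF tc tw] by blast
  obtain C2 where C2: "\<And>t. (LINT x|lborel. cmod (cnj (xderiv (\<psi> t) x) * w \<kappa> (\<psi> t) n x)) \<le> C2"
    using prod(2)[OF tcx tw] by blast
  have s: "smooth (\<psi> t)" for t by (rule tower_smooth[OF B])
  have i: "integrable lborel (w_flux \<kappa> (\<psi> t) n)" for t
    unfolding w_flux_def
    by (rule Bochner_Integration.integrable_add[OF prod(1)[OF tc tw] integrable_mult_right[OF prod(1)[OF tcx tw]]])
  have C: "(LINT x|lborel. cmod (w_flux \<kappa> (\<psi> t) n x)) \<le> C1 + C2" for t
  proof -
    note i1 = integrable_norm[OF prod(1)[OF tc tw[of "Suc n"]], of t]
      and i2 = integrable_norm[OF prod(1)[OF tcx tw[of n]], of t]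
    have "(LINT x|lborel. cmod (w_flux \<kappa> (\<psi> t) n x)) \<le> (LINT x|lborel.
        cmod (cnj (\<psi> t x) * w \<kappa> (\<psi> t) (Suc n) x) + cmod (cnj (xderiv (\<psi> t) x) * w \<kappa> (\<psi> t) n x))"
    proof (rule integral_mono[OF integrable_norm[OF i] Bochner_Integration.integrable_add[OF i1 i2]])
      fix x
      show "cmod (w_flux \<kappa> (\<psi> t) n x) \<le> cmod (cnj (\<psi> t x) * w \<kappa> (\<psi> t) (Suc n) x) + cmod (cnj (xderiv (\<psi> t) x) * w \<kappa> (\<psi> t) n x)"
        unfolding w_flux_def
        using norm_triangle_ineq[of "cnj (\<psi> t x) * w \<kappa> (\<psi> t) (Suc n) x" "\<i> * (cnj (xderiv (\<psi> t) x) * w \<kappa> (\<psi> t) n x)"]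
        by (simp only: norm_mult norm_ii mult_1)
    qed
    also have "\<dots> \<le> C1 + C2"
      unfolding Bochner_Integration.integral_add[OF i1 i2] by (intro add_mono C1 C2)
    finally show ?thesis .
  qed
  show ?thesis
  proof (rule integral_conserved[OF density_evolves[OF \<psi> n] _ i C _ t])
    show "smooth (w_flux \<kappa> (\<psi> t) n)" for t
      unfolding w_flux_def by (intro smooth_intros smooth_w s)
    show "integrable lborel (\<lambda>x. cnj (\<psi> t x) * w \<kappa> (\<psi> t) n x)" for t
      by (rule prod(1)[OF tc tw])
  qed
qed

lemma full_trace_W_factorized:
  assumes f: "smooth f" "sq_norm lborel f = 1" and n: "0 < n"
  shows "full_trace {1} (W \<kappa> n 1 (factorized f n)) = (LINT x|lborel. cnj (f x) * w \<kappa> f n x)"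
proof -
  note [measurable] = smooth_borel[OF f(1)] smooth_borel[OF smooth_w[OF f(1)]]
  have "f \<in> L2 lborel" using f by (simp add: L2_def smooth_borel)
  from sq_norm_L2[OF this] f(2) have "(LINT x|lborel. (cmod (f x))\<^sup>2) = 1"
    by (simp flip: ennreal_1 add: ennreal_inj)
  then have "L2_inner lborel f f = 1" by (simp add: L2_inner_self)
  then have "(LINT y|lborel. f y * cnj (f y)) = 1" by (simp add: L2_inner_def mult.commute)
  from W_factorized[OF f(1) this n] have "W \<kappa> n 1 (factorized f n) = (\<lambda>x x'. w \<kappa> f n (x 1) * cnj (f (x' 1)))" .
  then have "full_trace {1} (W \<kappa> n 1 (factorized f n)) = full_trace {1} (\<lambda>x x'. cnj (f (x 1)) * w \<kappa> f n (x 1))"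
    by (simp add: full_trace_def mult.commute)
  also have "\<dots> = (LINT x|lborel. cnj (f x) * w \<kappa> f n x)"
    using full_trace_singleton[of "\<lambda>x. cnj (f x) * w \<kappa> f n x" 1] by simp
  finally show ?thesis .
qed

theorem theorem4p3:
  fixes \<kappa> :: real and \<phi> :: "real \<Rightarrow> real \<Rightarrow> complex"
  assumes "\<kappa> \<in> {1, -1}"
    and "Linfty_smooth \<phi>"
    and "\<forall>t\<ge>0. sq_norm lborel (\<phi> t) = 1"
    and "nls_solution \<kappa> \<phi>"
    and "gp_solution \<kappa> (\<lambda>t n. factorized (\<phi> t) n)"
    and "Linfty_H_infty (\<lambda>t n. factorized (\<phi> t) n)"
  shows "\<forall>n\<ge>1. \<forall>t\<ge>0. full_trace {1} (W \<kappa> n 1 (factorized (\<phi> t) n))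
                        = full_trace {1} (W \<kappa> n 1 (factorized (\<phi> 0) n))"
proof -
  \<comment> \<open>Reflecting in time makes all hypotheses hold for every real time, as the families require.\<close>
  define \<psi> where "\<psi> = (\<lambda>t. \<phi> \<bar>t\<bar>)"
  have s: "smooth (\<psi> t)" for t
    using assms(2) by (simp add: \<psi>_def Linfty_smooth_def)
  have LB: "tower locally_bounded \<psi>"
    unfolding tower_def locally_bounded_def
  proof (intro conjI allI s)
    fix m a b
    obtain C where "\<forall>t\<ge>0. \<forall>x\<in>{a..b}. cmod ((xderiv ^^ m) (\<phi> t) x) \<le> C"
      using assms(2) unfolding Linfty_smooth_def by blast
    then show "\<exists>C. \<forall>t. \<forall>x\<in>{a..b}. cmod ((xderiv ^^ m) (\<psi> t) x) \<le> C"
      unfolding \<psi>_def by (intro exI[of _ C]) auto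
  qed
  have "((\<lambda>s. \<psi> s x) has_vector_derivative nls_rhs \<kappa> (\<psi> t) x) (at t within {0..})" if t: "t \<ge> 0" for t x
  proof -
    obtain D where D: "((\<lambda>s. \<phi> s x) has_vector_derivative D) (at t within {0..})"
      and eq: "\<i> * D + (xderiv ^^ 2) (\<phi> t) x = complex_of_real (2 * \<kappa> * (cmod (\<phi> t x))\<^sup>2) * \<phi> t x"
      using assms(4) t unfolding nls_solution_def by blast
    have 2: "complex_of_real (2 * \<kappa> * (cmod (\<phi> t x))\<^sup>2) = 2 * of_real \<kappa> * (\<phi> t x * cnj (\<phi> t x))"
      by (simp only: of_real_mult complex_norm_square of_real_numeral)
    have "D = - \<i> * (\<i> * D)" by simp
    also have "\<i> * D = 2 * of_real \<kappa> * (\<phi> t x * cnj (\<phi> t x)) * \<phi> t x - xderiv (xderiv (\<phi> t)) x"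
      using eq unfolding 2 by (simp add: eval_nat_numeral algebra_simps)
    finally have "D = nls_rhs \<kappa> (\<psi> t) x"
      using t by (simp add: nls_rhs_def \<psi>_def algebra_simps)
    with D have "((\<lambda>s. \<phi> s x) has_vector_derivative nls_rhs \<kappa> (\<psi> t) x) (at t within {0..})" by simp
    then show ?thesis
      by (rule has_vector_derivative_transform[rotated 2]) (use t in \<open>auto simp: \<psi>_def\<close>)
  qed
  with LB have ev: "evolves \<psi> (\<lambda>t. nls_rhs \<kappa> (\<psi> t))" by (rule nls_evolves)
  have "L2_bounded (\<lambda>t. (helmholtz ^^ p) (\<psi> t))" for p
  proof -
    \<comment> \<open>The member k = 1 with \<alpha> = 2p supplies the bound T = R^2 for (1 -
      \<Delta>)^p \<psi>. R may vary with p but is common to all times.\<close>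
    obtain R :: real where R: "\<forall>k\<ge>1. (SUP t\<in>{0..}. h_norm k (2 * real p) (factorized (\<phi> t) k)) < ennreal (R ^ (2 * k))"
      using assms(6) unfolding Linfty_H_infty_def by (metis mult_nonneg_nonneg of_nat_0_le_iff zero_le_numeral)
    have "h_norm 1 (2 * real p) (factorized (\<psi> t) 1) < ennreal (R ^ (2 * 1))" for t
    proof (rule le_less_trans)
      show "h_norm 1 (2 * real p) (factorized (\<psi> t) 1) \<le> (SUP t\<in>{0..}. h_norm 1 (2 * real p) (factorized (\<phi> t) 1))"
        unfolding \<psi>_def by (rule SUP_upper[of "\<bar>t\<bar>" _ "\<lambda>t. h_norm 1 (2 * real p) (factorized (\<phi> t) 1)"]) simp
      show "(SUP t\<in>{0..}. h_norm 1 (2 * real p) (factorized (\<phi> t) 1)) < ennreal (R ^ (2 * 1))"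
        using R by blast
    qed
    then show ?thesis
      by (intro L2_boundedI[of _ "ennreal (R ^ (2 * 1))"] h_norm_sobolev_bound[OF s]) auto
  qed
  then have BL: "tower bounded_L2 \<psi>" by (rule tower_bounded_L2[OF s])
  have tr: "full_trace {1} (W \<kappa> n 1 (factorized (\<phi> t) n)) = (LINT x|lborel. cnj (\<psi> t x) * w \<kappa> (\<psi> t) n x)"
    if "0 < n" "0 \<le> t" for n t
    using full_trace_W_factorized[of "\<phi> t", OF _ _ that(1)] s[of t] that(2) assms(3) by (simp add: \<psi>_def)
  show ?thesis
  proof (intro allI impI)
    fix n t assume "1 \<le> (n::nat)" "0 \<le> (t::real)"
    then have n: "0 < n" and t: "0 \<le> t" by auto
    show "full_trace {1} (W \<kappa> n 1 (factorized (\<phi> t) n)) = full_trace {1} (W \<kappa> n 1 (factorized (\<phi> 0) n))"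
      unfolding tr[OF n t] tr[OF n order_refl] by (rule conservation[OF ev BL n t])
  qed
qed

end
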